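(* For any $0<h\leq1$, $0\leq s\leq t\leq1$, and $\beta\in\mathcal{D}(h,s,t,1)$, there exists an IFS of similarities on $[0,1]$ satisfying the bounded neighbourhood condition with attractor $\Lambda$ and fixed point set $F$ such that $\dim_{\mathrm{H}}\Lambda=h$, $\underline{\dim}_{\mathrm{B}}F=s$, $\overline{\dim}_{\mathrm{B}}F=t$, and $\underline{\dim}_{\mathrm{B}}\Lambda=\beta$.
   Context: For $0\leq s\leq t\leq\alpha$ and $0\leq h\leq\alpha$, set $$\mathcal{D}(h,s,t,\alpha)=\begin{cases}\{h\}&: t\leq h,\\ \left[\max\{h,s\},\,h+\frac{(t-h)(\alpha-h)s}{\alpha t-hs}\right]&: t>h.\end{cases}$$ An IFS of similarities on $X=[0,1]$ is a family $\{f_i\}_{i\in\mathcal{I}}$, with $\mathcal{I}$ a non-empty finite or countably infinite index set, of maps $f_i\colon X\to X$ such that $|f_i(x)-f_i(y)|=\rho(i)|x-y|$ for all $x,y\in X$, where $0<\rho(i)\leq\xi$ for all $i\in\mathcal{I}$ for some constant $\xi<1$ independent of $i$. Let $\mathcal{I}^*=\bigcup_{n\geq0}\mathcal{I}^n$ be the set of finite words, including the empty word. For $\mathtt{i}=(i_1,\ldots,i_n)\in\mathcal{I}^*$ write $f_{\mathtt{i}}=f_{i_1}\circ\cdots\circ f_{i_n}$ and $\rho(\mathtt{i})=\rho(i_1)\cdots\rho(i_n)$ (identity map and $1$ for the empty word). The attractor $\Lambda$ is the maximal set $\Lambda\subset X$ with $\Lambda=\bigcup_{i\in\mathcal{I}}f_i(\Lambda)$;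 equivalently, the image of the map $\pi\colon\mathcal{I}^{\mathbb{N}}\to X$ with $\{\pi((i_n)_{n\ge1})\}=\bigcap_nf_{i_1}\circ\cdots\circ f_{i_n}(X)$. The fixed point set is $F=\{x_i:i\in\mathcal{I}\}$, where $x_i$ is the unique fixed point of $f_i$. A subset $\mathcal{F}\subset\mathcal{I}^*$ is mutually incomparable if $\mathtt{i}$ is not a prefix of $\mathtt{j}$ for all distinct $\mathtt{i},\mathtt{j}\in\mathcal{F}$. The IFS satisfies the bounded neighbourhood condition if there is $M\in\mathbb{N}$ such that for all mutually incomparable $\mathcal{F}\subset\mathcal{I}^*$, all $x\in X$ and all $r\in(0,1)$, $\#\{\mathtt{i}\in\mathcal{F}:\rho(\mathtt{i})>r\text{ and }f_{\mathtt{i}}(X)\cap B(x,r)\neq\varnothing\}\leq M$. $\dim_{\mathrm{H}}$ is Hausdorff dimension, and $\underline{\dim}_{\mathrm{B}}$, $\overline{\dim}_{\mathrm{B}}$ are the lower and upper box (Minkowski) dimensions. *)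

theory Defs
  imports "HOL-Analysis.Analysis" "HOL-Library.Sublist"
begin

text \<open>
  The \<open>s\<close>-th power of the diameter, with the conventions of the theory of Hausdorff measures:
  the empty set has weight \<open>0\<close> and every other set has weight \<open>1\<close> for \<open>s = 0\<close>
  (whereas \<open>0 powr 0 = 0\<close>).
\<close>

definition diam_pow :: "real \<Rightarrow> 'a::metric_space set \<Rightarrow> ennreal" where
  "diam_pow s U =
     (if U = {} then 0 else if s = 0 then 1 else ennreal (diameter U powr s))"

text \<open>
  Boundedness is required explicitly because \<open>diameter\<close> is only meaningful for bounded sets.
\<close>

definition countable_covers :: "real \<Rightarrow> 'a::metric_space set \<Rightarrow> (nat \<Rightarrow> 'a set) set" where
  "countable_covers \<delta> A =
     {U. A \<subseteq> (\<Union>n. U n) \<and> (\<forall>n. bounded (U n) \<and> diameter (U n) \<le> \<delta>)}"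

definition hausdorff_premeasure :: "real \<Rightarrow> real \<Rightarrow> 'a::metric_space set \<Rightarrow> ennreal" where
  "hausdorff_premeasure s \<delta> A = (INF U\<in>countable_covers \<delta> A. \<Sum>n. diam_pow s (U n))"

definition hausdorff_measure :: "real \<Rightarrow> 'a::metric_space set \<Rightarrow> ennreal" where
  "hausdorff_measure s A = (SUP \<delta>\<in>{0<..}. hausdorff_premeasure s \<delta> A)"

definition hausdorff_dim :: "'a::metric_space set \<Rightarrow> ereal" where
  "hausdorff_dim A = Inf {ereal s |s. 0 \<le> s \<and> hausdorff_measure s A = 0}"

text \<open>
  Least number of open balls of radius \<open>r\<close> needed to cover a totally bounded set \<open>A\<close>
  (for sets that are not totally bounded the value \<open>Inf {} = 0\<close> is meaningless).
\<close>

definition covering_number :: "'a::metric_space set \<Rightarrow> real \<Rightarrow> nat" where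
  "covering_number A r = Inf {card C |C. finite C \<and> A \<subseteq> (\<Union>x\<in>C. ball x r)}"

definition lower_box_dim :: "'a::metric_space set \<Rightarrow> ereal" where
  "lower_box_dim A =
     Liminf (at_right 0) (\<lambda>r. ereal (ln (real (covering_number A r)) / ln (1 / r)))"

definition upper_box_dim :: "'a::metric_space set \<Rightarrow> ereal" where
  "upper_box_dim A =
     Limsup (at_right 0) (\<lambda>r. ereal (ln (real (covering_number A r)) / ln (1 / r)))"

text \<open>
  The maps are total functions on the reals; only their values on \<open>{0..1}\<close> are relevant.
\<close>

definition similarity_ifs :: "'i set \<Rightarrow> ('i \<Rightarrow> real \<Rightarrow> real) \<Rightarrow> ('i \<Rightarrow> real) \<Rightarrow> bool" where
  "similarity_ifs I f \<rho> \<longleftrightarrow>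
     I \<noteq> {} \<and> countable I \<and>
     (\<forall>i\<in>I. f i ` {0..1} \<subseteq> {0..1}) \<and>
     (\<forall>i\<in>I. \<forall>x\<in>{0..1}. \<forall>y\<in>{0..1}. \<bar>f i x - f i y\<bar> = \<rho> i * \<bar>x - y\<bar>) \<and>
     (\<exists>\<xi><1. \<forall>i\<in>I. 0 < \<rho> i \<and> \<rho> i \<le> \<xi>)"

definition word_map :: "('i \<Rightarrow> real \<Rightarrow> real) \<Rightarrow> 'i list \<Rightarrow> real \<Rightarrow> real" where
  "word_map f w = foldr (\<lambda>i g. f i \<circ> g) w id"

definition word_ratio :: "('i \<Rightarrow> real) \<Rightarrow> 'i list \<Rightarrow> real" where
  "word_ratio \<rho> w = prod_list (map \<rho> w)"

definition mutually_incomparable :: "'i list set \<Rightarrow> bool" where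
  "mutually_incomparable W \<longleftrightarrow> (\<forall>v\<in>W. \<forall>w\<in>W. v \<noteq> w \<longrightarrow> \<not> prefix v w)"

definition bounded_neighbourhood_condition ::
    "'i set \<Rightarrow> ('i \<Rightarrow> real \<Rightarrow> real) \<Rightarrow> ('i \<Rightarrow> real) \<Rightarrow> bool" where
  "bounded_neighbourhood_condition I f \<rho> \<longleftrightarrow>
     (\<exists>M::nat. \<forall>W. W \<subseteq> lists I \<and> mutually_incomparable W \<longrightarrow>
        (\<forall>x\<in>{0..1}. \<forall>r\<in>{0<..<1}.
           let N = {w\<in>W. word_ratio \<rho> w > r \<and> word_map f w ` {0..1} \<inter> ball x r \<noteq> {}}
           in finite N \<and> card N \<le> M))"

text \<open>
  The union of all invariant subsets of \<open>{0..1}\<close>; the two lemmas below show that it is the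
  largest one.
\<close>

definition attractor :: "'i set \<Rightarrow> ('i \<Rightarrow> real \<Rightarrow> real) \<Rightarrow> real set" where
  "attractor I f = \<Union>{L. L \<subseteq> {0..1} \<and> L = (\<Union>i\<in>I. f i ` L)}"

lemma attractor_invariant:
  "attractor I f \<subseteq> {0..1}" "attractor I f = (\<Union>i\<in>I. f i ` attractor I f)"
proof -
  show "attractor I f \<subseteq> {0..1}"
    unfolding attractor_def by blast
  have sub: "L \<subseteq> attractor I f" if "L \<subseteq> {0..1}" "L = (\<Union>i\<in>I. f i ` L)" for L
    using that unfolding attractor_def by blast
  show "attractor I f = (\<Union>i\<in>I. f i ` attractor I f)"
  proof (rule equalityI; rule subsetI)
    fix x assume "x \<in> attractor I f"
    then obtain L where L: "L \<subseteq> {0..1}" "L = (\<Union>i\<in>I. f i ` L)" "x \<in> L"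
      unfolding attractor_def by blast
    from L(2,3) obtain i y where "i \<in> I" "y \<in> L" "x = f i y" by blast
    with sub[OF L(1,2)] show "x \<in> (\<Union>i\<in>I. f i ` attractor I f)" by blast
  next
    fix x assume "x \<in> (\<Union>i\<in>I. f i ` attractor I f)"
    then obtain i y L where L: "i \<in> I" "x = f i y" "y \<in> L" "L \<subseteq> {0..1}" "L = (\<Union>i\<in>I. f i ` L)"
      unfolding attractor_def by blast
    from L(1,2,3) have "x \<in> (\<Union>i\<in>I. f i ` L)" by blast
    with L(5) have "x \<in> L" by simp
    with sub[OF L(4,5)] show "x \<in> attractor I f" by blast
  qed
qed

lemma attractor_greatest:
  assumes "L \<subseteq> {0..1}" "L = (\<Union>i\<in>I. f i ` L)"
  shows "L \<subseteq> attractor I f"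
  using assms unfolding attractor_def by blast

definition fixed_point_set :: "'i set \<Rightarrow> ('i \<Rightarrow> real \<Rightarrow> real) \<Rightarrow> real set" where
  "fixed_point_set I f = {x\<in>{0..1}. \<exists>i\<in>I. f i x = x}"

lemma similarity_ifs_unique_fixed_point:
  assumes "similarity_ifs I f \<rho>" "i \<in> I"
  shows "\<exists>!x. x \<in> {0..1} \<and> f i x = x"
proof -
  from assms obtain \<xi> where "\<xi> < 1" "0 < \<rho> i" "\<rho> i \<le> \<xi>"
    unfolding similarity_ifs_def by blast
  moreover from assms have "f i ` {0..1} \<subseteq> {0..1}"
    and "\<And>x y. x \<in> {0..1} \<Longrightarrow> y \<in> {0..1} \<Longrightarrow> dist (f i x) (f i y) \<le> \<rho> i * dist x y"
    unfolding similarity_ifs_def dist_real_def by (blast, simp)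
  ultimately have "\<exists>!x\<in>{0..1}. f i x = x"
    using Banach_fix[of "{0..1::real}" "\<rho> i" "f i"] by (simp add: compact_imp_complete)
  then show ?thesis by blast
qed

definition dim_range :: "real \<Rightarrow> real \<Rightarrow> real \<Rightarrow> real \<Rightarrow> real set" where
  "dim_range h s t \<alpha> =
     (if t \<le> h then {h}
      else {max h s .. h + (t - h) * (\<alpha> - h) * s / (\<alpha> * t - h * s)})"

end

theory Submission imports Defs "HOL-Real_Asymp.Real_Asymp"
begin

text \<open>
  All maps are of the form \<open>f i y = c i + \<rho> i * y\<close> with images that do not overlap. For such
  systems at most three cylinders longer than \<open>r\<close> meet a ball of radius \<open>r\<close>, so the bounded
  neighbourhood condition is automatic, and one is free to choose the fixed point set \<open>F\<close>.

  If the numbers \<open>\<rho> i powr h\<close> add up to \<open>1\<close>, then \<open>h\<close> is the Hausdorff dimension of the attractor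
  \<open>\<Lambda>\<close>. Write \<open>\<psi> y\<close> for the binary logarithm of the number of balls of radius \<open>2 powr - y\<close> that
  are needed to cover \<open>F\<close>. A cylinder of length \<open>2 powr - (X - y)\<close> contains a copy of \<open>F\<close> that looks
  at scale \<open>2 powr - X\<close> as \<open>F\<close> does at scale \<open>2 powr - y\<close>, and there are about
  \<open>2 powr (h * (X - y))\<close> such cylinders. Up to errors that are negligible compared to \<open>X\<close>, the
  logarithmic covering number of \<open>\<Lambda>\<close> at scale \<open>2 powr - X\<close> is therefore
  \<open>h * X + (MAX y \<le> X. \<psi> y - h * y)\<close>. The upper bound is \<open>log_cover_attractor_le\<close>; the lower bound
  is \<open>log_cover_attractor_ge\<close>, for images that are pairwise disjoint. If \<open>t \<le> h\<close> or \<open>s = t\<close>, this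
  determines the lower box dimension of \<open>\<Lambda>\<close>. In the remaining case it has to be arranged
  through the shape of \<open>\<psi>\<close>.

  Cut each interval \<open>[2 powr - a, 2 powr (1 - a)]\<close> into tiles of equal length \<open>2 powr - b a\<close> and let
  each tile contain one point of \<open>F\<close>. The block with index \<open>a\<close> contributes \<open>min (b a) y - a\<close> to \<open>\<psi> y\<close>:
  nothing up to \<open>y = a\<close>, then a line of slope \<open>1\<close>, constant from \<open>y = b a\<close> on; and \<open>\<psi> y\<close> is essentially
  the maximum of these contributions. If \<open>b a\<close> is close to \<open>a / (1 - s)\<close> for all \<open>a\<close>, then \<open>\<psi> y\<close> is
  close to \<open>s * y\<close>. For the members \<open>\<alpha> n\<close> of a sparse sequence, \<open>b (\<alpha> n)\<close> is close to
  \<open>\<alpha> n / (1 - t)\<close> instead, which produces a peak of height \<open>t * y\<close> at \<open>y = b (\<alpha> n)\<close>. These peaks give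
  \<open>F\<close> the upper box dimension \<open>t\<close>, and the troughs between them give it the lower box dimension \<open>s\<close>.

  After the peak at \<open>y = b (\<alpha> n)\<close> the maximum of \<open>\<psi> y - h * y\<close> keeps the value \<open>(t - h) * b (\<alpha> n)\<close>
  until the line \<open>y - \<alpha> (n + 1)\<close> of the next special block, lowered by \<open>h * y\<close>, reaches this value.
  At this crossing the covering exponent of \<open>\<Lambda>\<close> is smallest. If \<open>\<alpha> (n + 1)\<close> is about
  \<open>(t - h) * (1 - \<beta>) / (\<beta> - h)\<close> times \<open>b (\<alpha> n)\<close>, the exponent there is \<open>\<beta>\<close>, and the hypothesis that
  \<open>\<beta>\<close> is at most the right end point of \<open>dim_range h s t 1\<close> says exactly that the special blocks are so far
  apart that \<open>\<psi>\<close> comes down to \<open>s * y\<close> in between. If \<open>\<alpha> (n + 1) / b (\<alpha> n)\<close> tends to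
  infinity, the result is \<open>\<beta> = h\<close>, provided that \<open>s \<le> h\<close>.

  For \<open>h < 1\<close> the tiles contain very short images, and finitely many further maps of equal ratio, with
  images in \<open>[1/2, 1]\<close>, bring the sum of the \<open>\<rho> i powr h\<close> to \<open>1\<close> without affecting the dimensions of
  \<open>F\<close>. For \<open>h = 1\<close> the tiles themselves are the images. Then \<open>{0<..1}\<close> is invariant,
  which leaves \<open>1\<close> as the only possible value of all dimensions of \<open>\<Lambda>\<close>.
\<close>

section \<open>Covering numbers and box dimensions of sets of reals\<close>

lemma finite_ball_cover:
  fixes A :: "real set"
  assumes "bounded A" "r > 0"
  shows "\<exists>C. finite C \<and> A \<subseteq> (\<Union>x\<in>C. ball x r)"
proof -
  have "compact (closure A)" using assms(1) by (simp add: compact_closure)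
  then obtain C where "finite C" "closure A \<subseteq> (\<Union>x\<in>C. ball x r)"
    using assms(2) compact_eq_totally_bounded[of "closure A"] by blast
  then show ?thesis using closure_subset by blast
qed

lemma covering_number_attained:
  fixes A :: "real set"
  assumes "bounded A" "r > 0"
  obtains C where "finite C" "A \<subseteq> (\<Union>x\<in>C. ball x r)" "card C = covering_number A r"
proof -
  have "{card C |C. finite C \<and> A \<subseteq> (\<Union>x\<in>C. ball x r)} \<noteq> {}"
    using finite_ball_cover[OF assms] by blast
  from Inf_nat_def1[OF this] show ?thesis
    using that unfolding covering_number_def by force
qed

lemma covering_number_le_card:
  assumes "finite C" "A \<subseteq> (\<Union>x\<in>C. ball x r)"
  shows "covering_number A r \<le> card C"
  unfolding covering_number_def using assms by (intro wellorder_Inf_le1 CollectI exI[of _ C] conjI refl)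

lemma covering_number_mono:
  fixes A :: "real set"
  assumes "A \<subseteq> B" "bounded B" "0 < r" "r \<le> r'"
  shows "covering_number A r' \<le> covering_number B r"
proof -
  obtain C where C: "finite C" "B \<subseteq> (\<Union>x\<in>C. ball x r)" "card C = covering_number B r"
    by (rule covering_number_attained[OF assms(2,3)])
  have "A \<subseteq> (\<Union>x\<in>C. ball x r')"
  proof
    fix y assume "y \<in> A"
    with C(2) assms(1) obtain x where "x \<in> C" "dist x y < r" by (auto simp: subset_eq)
    with assms(4) have "x \<in> C" "dist x y < r'" by simp_all
    then show "y \<in> (\<Union>x\<in>C. ball x r')" by auto
  qed
  from covering_number_le_card[OF C(1) this] C(3) show ?thesis by simp
qed

lemma covering_number_Un:
  fixes A B :: "real set"
  assumes "bounded A" "bounded B" "0 < r"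
  shows "covering_number (A \<union> B) r \<le> covering_number A r + covering_number B r"
proof -
  obtain C where C: "finite C" "A \<subseteq> (\<Union>x\<in>C. ball x r)" "card C = covering_number A r"
    by (rule covering_number_attained[OF assms(1,3)])
  obtain D where D: "finite D" "B \<subseteq> (\<Union>x\<in>D. ball x r)" "card D = covering_number B r"
    by (rule covering_number_attained[OF assms(2,3)])
  have "A \<union> B \<subseteq> (\<Union>x\<in>C \<union> D. ball x r)" using C(2) D(2) by blast
  from covering_number_le_card[OF _ this] C(1) D(1)
  have "covering_number (A \<union> B) r \<le> card (C \<union> D)" by simp
  also have "\<dots> \<le> card C + card D" by (rule card_Un_le)
  finally show ?thesis using C(3) D(3) by simp
qed

lemma covering_number_UN:
  fixes A :: "'i \<Rightarrow> real set"
  assumes "finite S" "\<And>i. i \<in> S \<Longrightarrow> bounded (A i)" "0 < r"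
  shows "covering_number (\<Union>i\<in>S. A i) r \<le> (\<Sum>i\<in>S. covering_number (A i) r)"
  using assms(1,2)
proof (induction S)
  case empty
  show ?case using covering_number_le_card[of "{}" "{}" r] by simp
next
  case (insert i S)
  have "covering_number (\<Union>i\<in>insert i S. A i) r
      \<le> covering_number (A i) r + covering_number (\<Union>i\<in>S. A i) r"
    using covering_number_Un[of "A i" "\<Union>i\<in>S. A i" r] insert.prems insert.hyps assms(3) by auto
  with insert show ?case by simp
qed

lemma covering_number_finite_le_card: "finite A \<Longrightarrow> 0 < r \<Longrightarrow> covering_number A r \<le> card A"
  by (rule covering_number_le_card) auto

lemma covering_number_interval:
  fixes A :: "real set"
  assumes "A \<subseteq> {p..p + l}" "0 < r" "0 \<le> l"
  shows "real (covering_number A r) \<le> l / r + 1"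
proof -
  define m where "m = nat \<lfloor>l / r\<rfloor>"
  define C where "C = (\<lambda>k. p + real k * r) ` {..m}"
  have "A \<subseteq> (\<Union>x\<in>C. ball x r)"
  proof
    fix y assume "y \<in> A"
    then have y: "p \<le> y" "y \<le> p + l" using assms(1) by auto
    define k where "k = nat \<lfloor>(y - p) / r\<rfloor>"
    have k: "real k \<le> (y - p) / r" "(y - p) / r < real k + 1"
      using y assms(2) unfolding k_def by (simp_all add: floor_less_iff)
    have "k \<le> m" unfolding k_def m_def
      by (intro nat_mono floor_mono divide_right_mono) (use y assms in auto)
    moreover have "\<bar>p + real k * r - y\<bar> < r"
      using k assms(2) by (simp add: field_simps abs_if)
    ultimately show "y \<in> (\<Union>x\<in>C. ball x r)"
      unfolding C_def by (auto simp: dist_real_def)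
  qed
  then have "covering_number A r \<le> card C"
    by (intro covering_number_le_card) (simp_all add: C_def)
  also have "\<dots> \<le> m + 1" unfolding C_def using card_image_le[of "{..m}"] by simp
  finally have "real (covering_number A r) \<le> real m + 1" by linarith
  also have "real m \<le> l / r" unfolding m_def using assms by simp
  finally show ?thesis by simp
qed

definition separated :: "real \<Rightarrow> real set \<Rightarrow> bool" where
  "separated r Q \<longleftrightarrow> (\<forall>x\<in>Q. \<forall>y\<in>Q. x \<noteq> y \<longrightarrow> r \<le> \<bar>x - y\<bar>)"

text \<open>
  Two points at distance at least \<open>2 * x\<close> never lie in the same open ball of radius \<open>x\<close>; this
  is the only way in which covering numbers are bounded from below.
\<close>

lemma card_separated_le_covering_number:
  assumes "separated r Q" "Q \<subseteq> A" "bounded A" "0 < x" "2 * x \<le> r"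
  shows "finite Q" "card Q \<le> covering_number A x"
proof -
  obtain C where C: "finite C" "A \<subseteq> (\<Union>c\<in>C. ball c x)" "card C = covering_number A x"
    by (rule covering_number_attained[OF assms(3,4)])
  have "\<forall>q\<in>Q. \<exists>c. c \<in> C \<and> q \<in> ball c x" using C(2) assms(2) by blast
  then obtain g where g: "\<And>q. q \<in> Q \<Longrightarrow> g q \<in> C \<and> q \<in> ball (g q) x" by metis
  have inj: "inj_on g Q"
  proof (rule inj_onI, rule ccontr)
    fix p q assume *: "p \<in> Q" "q \<in> Q" "g p = g q" "p \<noteq> q"
    then have "r \<le> \<bar>p - q\<bar>" using assms(1) unfolding separated_def by blast
    moreover have "\<bar>g p - p\<bar> < x" "\<bar>g q - q\<bar> < x"
      using g[OF *(1)] g[OF *(2)] by (auto simp: dist_real_def)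
    ultimately show False using *(3) assms(5) by linarith
  qed
  have sub: "g ` Q \<subseteq> C" using g by blast
  show "finite Q" using inj_on_finite[OF inj sub C(1)] .
  show "card Q \<le> covering_number A x" using card_inj_on_le[OF inj sub C(1)] C(3) by simp
qed

lemma covering_number_ge_1:
  fixes A :: "real set"
  assumes "A \<noteq> {}" "bounded A" "0 < r"
  shows "1 \<le> covering_number A r"
proof -
  obtain a where "a \<in> A" using assms(1) by blast
  then show ?thesis
    using card_separated_le_covering_number(2)[of "2 * r" "{a}" A r] assms
    by (simp add: separated_def)
qed

text \<open>
  The covering exponent at scale \<open>2 powr - x\<close>. In these coordinates the box dimensions are the
  lower and upper limits of \<open>log_cover A x / x\<close> at infinity, multiplicative constants become
  additive, and changing the scale by a bounded factor shifts \<open>x\<close> by a bounded amount.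
\<close>

definition log_cover :: "real set \<Rightarrow> real \<Rightarrow> real" where
  "log_cover A x = log 2 (covering_number A (2 powr - x))"

lemma at_right_0_eq_filtermap_powr:
  "at_right (0::real) = filtermap (\<lambda>x. 2 powr - x) at_top"
proof (rule filtermap_fun_inverse[symmetric])
  show "filterlim (\<lambda>r. - log 2 r) at_top (at_right (0::real))" by real_asymp
  show "filterlim (\<lambda>x::real. 2 powr - x) (at_right 0) at_top" by real_asymp
  show "\<forall>\<^sub>F r in at_right (0::real). 2 powr - (- log 2 r) = r"
    using eventually_at_right_less[of "0::real"] by eventually_elim simp
qed

lemma box_dim_scale:
  "ereal (ln (real (covering_number A (2 powr - x))) / ln (1 / 2 powr - x)) = ereal (log_cover A x / x)"
proof -
  have "1 / 2 powr - x = 2 powr x" by (simp add: powr_minus_divide)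
  then show ?thesis by (simp add: log_cover_def log_def ln_powr)
qed

lemma inj_powr_minus: "inj (\<lambda>x::real. (2::real) powr - x)"
proof (rule injI)
  fix x y :: real assume "(2::real) powr - x = 2 powr - y"
  then have "log 2 ((2::real) powr - x) = log 2 (2 powr - y)" by (rule arg_cong)
  then show "x = y" by simp
qed

lemma lower_box_dim_eq: "lower_box_dim A = Liminf at_top (\<lambda>x. ereal (log_cover A x / x))"
  unfolding lower_box_dim_def at_right_0_eq_filtermap_powr
  by (subst Liminf_filtermap_eq[OF inj_powr_minus]) (simp only: box_dim_scale)

lemma upper_box_dim_eq: "upper_box_dim A = Limsup at_top (\<lambda>x. ereal (log_cover A x / x))"
  unfolding upper_box_dim_def at_right_0_eq_filtermap_powr
  by (subst Limsup_filtermap_eq[OF inj_powr_minus]) (simp only: box_dim_scale)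

lemma lower_le_upper_box_dim:
  fixes A :: "real set"
  shows "lower_box_dim A \<le> upper_box_dim A"
  unfolding lower_box_dim_eq upper_box_dim_eq by (intro Liminf_le_Limsup trivial_limit_at_top_linorder)

lemma log_cover_mono:
  assumes "A \<subseteq> B" "A \<noteq> {}" "bounded B" "x \<le> y"
  shows "log_cover A x \<le> log_cover B y"
proof -
  have "1 \<le> covering_number A (2 powr - x)"
    by (rule covering_number_ge_1) (use assms bounded_subset in auto)
  moreover have "covering_number A (2 powr - x) \<le> covering_number B (2 powr - y)"
    by (rule covering_number_mono) (use assms in auto)
  ultimately show ?thesis unfolding log_cover_def by simp
qed

lemma log_cover_nonneg: "A \<noteq> {} \<Longrightarrow> bounded A \<Longrightarrow> 0 \<le> log_cover A x"
  unfolding log_cover_def using covering_number_ge_1[of A "2 powr - x"] by simp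

lemma log_cover_le:
  assumes "A \<noteq> {}" "bounded A" "real (covering_number A (2 powr - x)) \<le> 2 powr E"
  shows "log_cover A x \<le> E"
proof -
  have "0 < real (covering_number A (2 powr - x))"
    using covering_number_ge_1[of A "2 powr - x"] assms by simp
  then have "log_cover A x \<le> log 2 (2 powr E)"
    unfolding log_cover_def using assms(3) by (subst log_le_cancel_iff) auto
  then show ?thesis by simp
qed

lemma log_cover_ge:
  assumes "2 powr E \<le> real (covering_number A (2 powr - x))"
  shows "E \<le> log_cover A x"
proof -
  have "log 2 (2 powr E) \<le> log_cover A x"
    unfolding log_cover_def using assms
    by (subst log_le_cancel_iff) (use less_le_trans[OF _ assms, of 0] in auto)
  then show ?thesis by simp
qed

lemma lower_box_dim_mono:
  fixes A :: "real set"
  assumes "A \<subseteq> B" "A \<noteq> {}" "bounded B"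
  shows "lower_box_dim A \<le> lower_box_dim B"
  unfolding lower_box_dim_eq
  by (intro Liminf_mono eventually_mono[OF eventually_gt_at_top[of 0]])
     (use log_cover_mono[OF assms] in \<open>simp add: divide_right_mono\<close>)

lemma ereal_less_real_dense:
  assumes "x < ereal b"
  obtains c where "x < ereal c" "c < b"
proof -
  obtain y where y: "x < y" "y < ereal b" using assms dense by blast
  then obtain c where "y = ereal c" by (cases y) auto
  with y that show ?thesis by simp
qed

lemma real_less_ereal_dense:
  assumes "ereal b < x"
  obtains c where "ereal c < x" "b < c"
proof -
  obtain y where y: "ereal b < y" "y < x" using assms dense by blast
  then obtain c where "y = ereal c" by (cases y) auto
  with y that show ?thesis by simp
qed

lemma lower_box_dim_leI:
  assumes "\<And>\<epsilon> X. 0 < \<epsilon> \<Longrightarrow> \<exists>x\<ge>X. log_cover A x \<le> (s + \<epsilon>) * x"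
  shows "lower_box_dim A \<le> ereal s"
proof (rule ccontr)
  assume "\<not> ?thesis"
  then have "ereal s < lower_box_dim A" by simp
  then obtain c where c: "ereal c < lower_box_dim A" "s < c"
    by (rule real_less_ereal_dense)
  have "\<forall>\<^sub>F x in at_top. c < log_cover A x / x"
    using less_LiminfD[OF c(1)[unfolded lower_box_dim_eq]] by simp
  then obtain X where X: "\<And>x. x \<ge> X \<Longrightarrow> c < log_cover A x / x"
    unfolding eventually_at_top_linorder by blast
  obtain x where x: "x \<ge> max X 1" "log_cover A x \<le> (s + (c - s)) * x"
    using assms[of "c - s" "max X 1"] c(2) by auto
  from x(1) have "c < log_cover A x / x" "0 < x" using X[of x] by auto
  then have "c * x < log_cover A x" by (simp only: pos_less_divide_eq)
  with x(2) show False by simp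
qed

lemma upper_box_dim_leI:
  assumes "\<And>\<epsilon>. 0 < \<epsilon> \<Longrightarrow> \<forall>\<^sub>F x in at_top. log_cover A x \<le> (t + \<epsilon>) * x"
  shows "upper_box_dim A \<le> ereal t"
proof -
  have "upper_box_dim A \<le> ereal t + ereal e" if "0 < e" for e
    unfolding upper_box_dim_eq plus_ereal.simps
  proof (rule Limsup_bounded)
    show "\<forall>\<^sub>F x in at_top. ereal (log_cover A x / x) \<le> ereal (t + e)"
      using assms[OF that] eventually_gt_at_top[of 0]
      by eventually_elim (simp only: ereal_less_eq pos_divide_le_eq)
  qed
  then show ?thesis by (rule ereal_le_epsilon2)
qed

text \<open>
  Lower bounds come from explicit separated sets at integer exponents. As \<open>log_cover\<close> is
  monotone, such a bound extends to all real exponents at the price of an additive constant.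
\<close>

lemma integer_scale_lower_bound:
  assumes "A \<noteq> {}" "bounded A" "0 \<le> u" "u * real n - K \<le> log_cover A (real n + 1)"
    and "real n + 1 \<le> x" "x \<le> real n + 2"
  shows "u * x - (K + 2 * u) \<le> log_cover A x"
proof -
  have "u * x \<le> u * (real n + 2)" using assms(3,6) by (rule mult_left_mono[rotated])
  then have "u * x - (K + 2 * u) \<le> u * real n - K" by (simp add: algebra_simps)
  also note assms(4)
  also have "log_cover A (real n + 1) \<le> log_cover A x"
    by (rule log_cover_mono) (use assms in auto)
  finally show ?thesis .
qed

text \<open>
  The shift from \<open>n\<close> to \<open>n + 1\<close> is the factor two between the separation of points and the
  radius of balls.
\<close>

lemma lower_box_dim_geI:
  assumes ne: "A \<noteq> {}" "bounded A" "0 \<le> s"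
    and *: "\<And>u. 0 < u \<Longrightarrow> u < s \<Longrightarrow> \<exists>K. \<forall>\<^sub>F n in sequentially. u * real n - K \<le> log_cover A (real n + 1)"
  shows "ereal s \<le> lower_box_dim A"
proof (rule ccontr)
  assume "\<not> ?thesis"
  then have "lower_box_dim A < ereal s" by simp
  then obtain c where c: "lower_box_dim A < ereal c" "c < s"
    by (rule ereal_less_real_dense)
  have "ereal 0 \<le> lower_box_dim A"
    unfolding lower_box_dim_eq
    by (intro Liminf_bounded eventually_mono[OF eventually_gt_at_top[of 0]])
       (use log_cover_nonneg[OF ne(1,2)] in simp)
  from le_less_trans[OF this c(1)] have "0 < c" by simp
  define u where "u = (c + s) / 2"
  have u: "0 < u" "u < s" "c < u" using c(2) \<open>0 < c\<close> unfolding u_def by auto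
  obtain K N where KN: "\<And>n. n \<ge> N \<Longrightarrow> u * real n - K \<le> log_cover A (real n + 1)"
    using *[OF u(1,2)] unfolding eventually_sequentially by blast
  have "\<forall>\<^sub>F x in at_top. ereal c \<le> ereal (log_cover A x / x)"
    using eventually_ge_at_top[of "max (real N + 2) ((K + 2 * u) / (u - c))"]
  proof eventually_elim
    case (elim x)
    define n where "n = nat \<lfloor>x\<rfloor> - 1"
    have x: "x \<ge> real N + 2" "(K + 2 * u) / (u - c) \<le> x" using elim by auto
    have n: "real n + 1 \<le> x" "x \<le> real n + 2" "n \<ge> N"
      using x(1) unfolding n_def by linarith+
    have "u * x - (K + 2 * u) \<le> log_cover A x"
      by (rule integer_scale_lower_bound[OF ne(1,2) _ KN[OF n(3)] n(1,2)]) (use u in simp)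
    moreover have "K + 2 * u \<le> x * (u - c)"
      using x(2) u(3) by (simp only: pos_divide_le_eq[of "u - c"] diff_gt_0_iff_gt)
    ultimately have "c * x \<le> log_cover A x" by (simp add: algebra_simps)
    then show ?case using x(1) by (simp add: pos_le_divide_eq)
  qed
  then have "ereal c \<le> lower_box_dim A"
    unfolding lower_box_dim_eq by (rule Liminf_bounded)
  with c(1) show False by simp
qed

lemma upper_box_dim_geI:
  assumes ne: "A \<noteq> {}" "bounded A" "0 \<le> t"
    and *: "\<And>u. 0 < u \<Longrightarrow> u < t \<Longrightarrow> \<exists>K. \<forall>N. \<exists>n\<ge>N. u * real n - K \<le> log_cover A (real n + 1)"
  shows "ereal t \<le> upper_box_dim A"
proof (rule ccontr)
  assume "\<not> ?thesis"
  then have "upper_box_dim A < ereal t" by simp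
  then obtain c where c: "upper_box_dim A < ereal c" "c < t"
    by (rule ereal_less_real_dense)
  have "ereal 0 \<le> lower_box_dim A"
    unfolding lower_box_dim_eq
    by (intro Liminf_bounded eventually_mono[OF eventually_gt_at_top[of 0]])
       (use log_cover_nonneg[OF ne(1,2)] in simp)
  then have "ereal 0 \<le> upper_box_dim A"
    using lower_le_upper_box_dim order_trans by blast
  from le_less_trans[OF this c(1)] have "0 < c" by simp
  define u where "u = (c + t) / 2"
  have u: "0 < u" "u < t" "c < u" using c(2) \<open>0 < c\<close> unfolding u_def by auto
  obtain K where K: "\<And>N. \<exists>n\<ge>N. u * real n - K \<le> log_cover A (real n + 1)"
    using *[OF u(1,2)] by blast
  have "\<forall>\<^sub>F x in at_top. log_cover A x / x < c"
    using Limsup_lessD[OF c(1)[unfolded upper_box_dim_eq]] by simp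
  then obtain X where X: "\<And>x. x \<ge> X \<Longrightarrow> log_cover A x / x < c"
    unfolding eventually_at_top_linorder by blast
  obtain n where n: "n \<ge> nat \<lceil>max X ((K + c) / (u - c))\<rceil>" "u * real n - K \<le> log_cover A (real n + 1)"
    using K by blast
  have "real n \<ge> X" "(K + c) / (u - c) \<le> real n" using n(1) by linarith+
  then have "K + c \<le> real n * (u - c)" "log_cover A (real n + 1) < c * (real n + 1)"
    using X[of "real n + 1"] u(3) by (simp_all add: pos_divide_le_eq pos_divide_less_eq)
  then show False using n(2) by (simp add: algebra_simps)
qed

section \<open>Affine systems with non-overlapping images\<close>

text \<open>
  Knaster and Tarski: the union of all subsets of \<open>{0..1}\<close> that are covered by their own
  images is invariant. It thus suffices to check one inclusion to place a set inside the
  attractor.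
\<close>

lemma post_fixed_subset_attractor:
  assumes maps: "\<And>i. i \<in> I \<Longrightarrow> f i ` {0..1} \<subseteq> {0..1}"
    and L: "L \<subseteq> {0..1}" "L \<subseteq> (\<Union>i\<in>I. f i ` L)"
  shows "L \<subseteq> attractor I f"
proof -
  define P where "P = {L. L \<subseteq> {0..1} \<and> L \<subseteq> (\<Union>i\<in>I. f i ` L)}"
  define U where "U = \<Union>P"
  have U: "U \<subseteq> {0..1}" "U \<subseteq> (\<Union>i\<in>I. f i ` U)"
    unfolding U_def P_def by blast+
  have "(\<Union>i\<in>I. f i ` U) \<subseteq> (\<Union>i\<in>I. f i ` (\<Union>i\<in>I. f i ` U))"
    using U(2) by (intro UN_mono image_mono order_refl)
  moreover have "(\<Union>i\<in>I. f i ` U) \<subseteq> {0..1}"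
  proof (rule UN_least)
    fix i assume "i \<in> I"
    then show "f i ` U \<subseteq> {0..1}" using image_mono[OF U(1), of "f i"] maps by blast
  qed
  ultimately have "(\<Union>i\<in>I. f i ` U) \<in> P" unfolding P_def by blast
  then have "U = (\<Union>i\<in>I. f i ` U)" using U(2) unfolding U_def by blast
  with U(1) have "U \<subseteq> attractor I f" by (rule attractor_greatest)
  moreover have "L \<subseteq> U" using L unfolding U_def P_def by blast
  ultimately show ?thesis by blast
qed

lemma word_map_simps [simp]:
  "word_map f [] = id" "word_map f (i # w) x = f i (word_map f w x)"
  by (simp_all add: word_map_def)

lemma word_ratio_simps [simp]:
  "word_ratio \<rho> [] = 1" "word_ratio \<rho> (i # w) = \<rho> i * word_ratio \<rho> w"
  by (simp_all add: word_ratio_def)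

text \<open>
  Images may touch at end points, because for \<open>h = 1\<close> they have to fill \<open>{0<..1}\<close>.
\<close>

locale affine_ifs =
  fixes I :: "nat set" and c \<rho> :: "nat \<Rightarrow> real" and \<xi> :: real
  assumes nonempty: "I \<noteq> {}"
    and left_ge_0: "i \<in> I \<Longrightarrow> 0 \<le> c i"
    and right_le_1: "i \<in> I \<Longrightarrow> c i + \<rho> i \<le> 1"
    and ratio_pos: "i \<in> I \<Longrightarrow> 0 < \<rho> i"
    and ratio_le: "i \<in> I \<Longrightarrow> \<rho> i \<le> \<xi>"
    and bound_less_1: "\<xi> < 1"
    and nonoverlapping: "i \<in> I \<Longrightarrow> j \<in> I \<Longrightarrow> i \<noteq> j \<Longrightarrow> c i + \<rho> i \<le> c j \<or> c j + \<rho> j \<le> c i"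
begin

definition f :: "nat \<Rightarrow> real \<Rightarrow> real" where
  "f i x = c i + \<rho> i * x"

abbreviation \<Lambda> :: "real set" where "\<Lambda> \<equiv> attractor I f"

abbreviation F :: "real set" where "F \<equiv> fixed_point_set I f"

definition fixpt :: "nat \<Rightarrow> real" where
  "fixpt i = c i / (1 - \<rho> i)"

lemma ratio_less_1: "i \<in> I \<Longrightarrow> \<rho> i < 1"
  using ratio_le[of i] bound_less_1 by linarith

lemma bound_pos: "0 < \<xi>"
proof -
  obtain i where "i \<in> I" using nonempty by blast
  then show ?thesis using ratio_pos[of i] ratio_le[of i] by linarith
qed

lemma f_image: "i \<in> I \<Longrightarrow> f i ` {0..1} = {c i..c i + \<rho> i}"
  using ratio_pos[of i] image_affinity_atLeastAtMost[of "\<rho> i" "c i" 0 1]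
  by (simp add: f_def[abs_def] add.commute)

lemma f_image_subset: "i \<in> I \<Longrightarrow> f i ` {0..1} \<subseteq> {0..1}"
  using f_image[of i] left_ge_0[of i] right_le_1[of i] by simp

lemma similarity: "similarity_ifs I f \<rho>"
  unfolding similarity_ifs_def
proof (intro conjI ballI exI[of _ \<xi>])
  fix i x y :: real and j assume "j \<in> I"
  then show "\<bar>f j x - f j y\<bar> = \<rho> j * \<bar>x - y\<bar>"
    using ratio_pos[of j] by (simp add: f_def abs_mult flip: right_diff_distrib)
qed (use nonempty f_image_subset ratio_pos ratio_le bound_less_1 in simp_all)

lemma fixpt_fixed: "i \<in> I \<Longrightarrow> f i (fixpt i) = fixpt i"
  using ratio_less_1[of i] by (simp add: f_def fixpt_def field_simps)

lemma fixpt_in_unit: "i \<in> I \<Longrightarrow> fixpt i \<in> {0..1}"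
  using ratio_less_1[of i] left_ge_0[of i] right_le_1[of i] by (simp add: fixpt_def field_simps)

lemma fixpt_in_image: "i \<in> I \<Longrightarrow> fixpt i \<in> {c i..c i + \<rho> i}"
  using imageI[OF fixpt_in_unit, of i "f i"] f_image[of i] fixpt_fixed[of i] by simp

lemma fixed_point_set_eq: "F = fixpt ` I"
proof (intro equalityI subsetI)
  fix x assume "x \<in> F"
  then obtain i where i: "i \<in> I" "f i x = x" unfolding fixed_point_set_def by blast
  then have "x = fixpt i" using ratio_less_1[of i] by (simp add: f_def fixpt_def field_simps)
  with i show "x \<in> fixpt ` I" by blast
next
  fix x assume "x \<in> fixpt ` I"
  then show "x \<in> F" unfolding fixed_point_set_def using fixpt_fixed fixpt_in_unit by blast
qed

lemma fixed_points_nonempty: "F \<noteq> {}"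
  using nonempty by (simp add: fixed_point_set_eq)

lemma fixed_points_in_unit: "F \<subseteq> {0..1}"
  by (auto simp: fixed_point_set_def)

lemma fixed_points_subset_attractor: "F \<subseteq> \<Lambda>"
proof (rule post_fixed_subset_attractor[OF f_image_subset fixed_points_in_unit])
  show "F \<subseteq> (\<Union>i\<in>I. f i ` F)"
  proof
    fix x assume "x \<in> F"
    then obtain i where "i \<in> I" "x = f i x" by (auto simp: fixed_point_set_def)
    with \<open>x \<in> F\<close> show "x \<in> (\<Union>i\<in>I. f i ` F)" by blast
  qed
qed

lemma bounded_fixed_points: "bounded F"
  by (rule bounded_subset[OF _ fixed_points_in_unit]) simp

lemma bounded_attractor: "bounded \<Lambda>"
  by (rule bounded_subset[OF _ attractor_invariant(1)]) simp

lemma attractor_nonempty: "\<Lambda> \<noteq> {}"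
  using fixed_points_nonempty fixed_points_subset_attractor by blast

definition left_end :: "nat list \<Rightarrow> real" where
  "left_end w = word_map f w 0"

lemma left_end_simps [simp]: "left_end [] = 0" "left_end (i # w) = c i + \<rho> i * left_end w"
  by (simp_all add: left_end_def f_def)

lemma word_map_affine: "word_map f w x = left_end w + word_ratio \<rho> w * x"
  by (induction w) (simp_all add: f_def algebra_simps)

lemma word_ratio_pos: "w \<in> lists I \<Longrightarrow> 0 < word_ratio \<rho> w"
  by (induction w) (auto intro: mult_pos_pos ratio_pos)

lemma word_image:
  assumes "w \<in> lists I"
  shows "word_map f w ` {0..1} = {left_end w..left_end w + word_ratio \<rho> w}"
  using word_ratio_pos[OF assms] image_affinity_atLeastAtMost[of "word_ratio \<rho> w" "left_end w" 0 1]
  by (simp add: word_map_affine[abs_def] add.commute)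

lemma word_interval_in_unit:
  "w \<in> lists I \<Longrightarrow> 0 \<le> left_end w \<and> left_end w + word_ratio \<rho> w \<le> 1"
proof (induction w)
  case (Cons i w)
  then have i: "i \<in> I" and IH: "0 \<le> left_end w" "left_end w + word_ratio \<rho> w \<le> 1" by auto
  have "\<rho> i * (left_end w + word_ratio \<rho> w) \<le> \<rho> i * 1"
    using IH(2) ratio_pos[OF i] by (intro mult_left_mono) auto
  moreover have "0 \<le> \<rho> i * left_end w" using IH(1) ratio_pos[OF i] by simp
  ultimately show ?case
    using left_ge_0[OF i] right_le_1[OF i] by (simp add: distrib_left)
qed simp

lemma word_interval_in_first:
  assumes "i \<in> I" "w \<in> lists I"
  shows "c i \<le> left_end (i # w)" "left_end (i # w) + word_ratio \<rho> (i # w) \<le> c i + \<rho> i"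
proof -
  have w: "0 \<le> left_end w" "left_end w + word_ratio \<rho> w \<le> 1"
    using word_interval_in_unit[OF assms(2)] by auto
  show "c i \<le> left_end (i # w)" using w(1) ratio_pos[OF assms(1)] by simp
  have "\<rho> i * (left_end w + word_ratio \<rho> w) \<le> \<rho> i * 1"
    using w(2) ratio_pos[OF assms(1)] by (intro mult_left_mono) auto
  then show "left_end (i # w) + word_ratio \<rho> (i # w) \<le> c i + \<rho> i" by (simp add: distrib_left)
qed

text \<open>
  Two incomparable words split at some position; after the removal of the common prefix the
  images lie in different first-level intervals.
\<close>

lemma incomparable_words_nonoverlapping:
  assumes "v \<in> lists I" "w \<in> lists I" "\<not> prefix v w" "\<not> prefix w v"
  shows "left_end v + word_ratio \<rho> v \<le> left_end w \<or> left_end w + word_ratio \<rho> w \<le> left_end v"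
  using assms
proof (induction v arbitrary: w rule: list.induct)
  case (Cons i v)
  then obtain j w' where w: "w = j # w'" by (cases w) auto
  have I: "i \<in> I" "j \<in> I" "v \<in> lists I" "w' \<in> lists I" using Cons.prems w by auto
  show ?case
  proof (cases "i = j")
    case True
    then have "left_end v + word_ratio \<rho> v \<le> left_end w' \<or> left_end w' + word_ratio \<rho> w' \<le> left_end v"
      using Cons.IH[OF I(3,4)] Cons.prems w by simp
    then show ?thesis
    proof
      assume "left_end v + word_ratio \<rho> v \<le> left_end w'"
      from mult_left_mono[OF this less_imp_le[OF ratio_pos[OF I(1)]]]
      show ?thesis using True w by (simp add: distrib_left)
    next
      assume "left_end w' + word_ratio \<rho> w' \<le> left_end v"
      from mult_left_mono[OF this less_imp_le[OF ratio_pos[OF I(1)]]]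
      show ?thesis using True w by (simp add: distrib_left)
    qed
  next
    case False
    show ?thesis
      using nonoverlapping[OF I(1,2) False] word_interval_in_first[OF I(1,3)]
        word_interval_in_first[OF I(2,4)] unfolding w by linarith
  qed
qed simp

text \<open>
  Among non-overlapping intervals that are longer than \<open>r\<close> and meet the ball, at most one has
  its left end point before \<open>x - r\<close>, because it contains points near \<open>x - r\<close>. The left end
  points of the others lie in an interval of length \<open>2 * r\<close> and are more than \<open>r\<close> apart, so
  there are at most two of them. The map \<open>g\<close> numbers these three places.
\<close>

lemma bounded_neighbourhood: "bounded_neighbourhood_condition I f \<rho>"
  unfolding bounded_neighbourhood_condition_def Let_def
proof (intro exI[of _ 3] allI impI ballI)
  fix W x r
  assume W: "W \<subseteq> lists I \<and> mutually_incomparable W" and r: "r \<in> {0<..<1::real}"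
  define N where "N = {w \<in> W. r < word_ratio \<rho> w \<and> word_map f w ` {0..1} \<inter> ball x r \<noteq> {}}"
  define g :: "nat list \<Rightarrow> int" where
    "g w = (if left_end w < x - r then 2 else \<lfloor>(left_end w - (x - r)) / r\<rfloor>)" for w
  have N: "w \<in> lists I" "r < word_ratio \<rho> w" "left_end w < x + r" "x - r < left_end w + word_ratio \<rho> w"
    if "w \<in> N" for w
  proof -
    show w: "w \<in> lists I" "r < word_ratio \<rho> w" using that W by (auto simp: N_def)
    show "left_end w < x + r" "x - r < left_end w + word_ratio \<rho> w"
      using that by (auto simp: N_def word_image[OF w(1)] dist_real_def)
  qed
  have "g ` N \<subseteq> {0, 1, 2}"
  proof
    fix k assume "k \<in> g ` N"
    then obtain w where w: "w \<in> N" "k = g w" by blast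
    show "k \<in> {0, 1, 2}"
    proof (cases "left_end w < x - r")
      case False
      then have "0 \<le> (left_end w - (x - r)) / r" "(left_end w - (x - r)) / r < 2"
        using N(3)[OF w(1)] r by (simp_all add: field_simps)
      then show ?thesis using False w(2) unfolding g_def by auto linarith
    qed (use w in \<open>simp add: g_def\<close>)
  qed
  moreover have "inj_on g N"
  proof (rule inj_onI, rule ccontr)
    fix v w assume vw: "v \<in> N" "w \<in> N" "g v = g w" "v \<noteq> w"
    then have "\<not> prefix v w" "\<not> prefix w v"
      using W unfolding N_def mutually_incomparable_def by auto
    then have d: "left_end v + word_ratio \<rho> v \<le> left_end w \<or> left_end w + word_ratio \<rho> w \<le> left_end v"
      using incomparable_words_nonoverlapping N(1)[OF vw(1)] N(1)[OF vw(2)] by blast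
    note v = N(2-4)[OF vw(1)] and w = N(2-4)[OF vw(2)]
    have not_2: "\<lfloor>(left_end u - (x - r)) / r\<rfloor> \<noteq> 2" if "u \<in> N" for u
    proof -
      have "(left_end u - (x - r)) / r < 2" using N(3)[OF that] r by (simp add: pos_divide_less_eq)
      then show ?thesis by linarith
    qed
    consider "left_end v < x - r" "left_end w < x - r" | "\<not> left_end v < x - r" "\<not> left_end w < x - r"
      using vw(3) not_2[OF vw(1)] not_2[OF vw(2)] unfolding g_def by (auto split: if_splits)
    then show False
    proof cases
      case 1
      then show ?thesis using d v w by linarith
    next
      case 2
      then have "\<lfloor>(left_end v - (x - r)) / r\<rfloor> = \<lfloor>(left_end w - (x - r)) / r\<rfloor>"
        using vw(3) unfolding g_def by simp
      then have "\<bar>(left_end v - (x - r)) / r - (left_end w - (x - r)) / r\<bar> < 1" by linarith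
      then have "\<bar>left_end v - left_end w\<bar> / r < 1"
        using r by (simp add: diff_divide_distrib[symmetric] abs_divide)
      then have "\<bar>left_end v - left_end w\<bar> < r" using r by (simp add: field_simps)
      then show ?thesis using d v w by linarith
    qed
  qed
  ultimately have "finite N" "card N \<le> card {0, 1, 2::int}"
    using inj_on_finite[of g N "{0, 1, 2}"] card_inj_on_le[of g N "{0, 1, 2}"] by blast+
  then show "finite {w \<in> W. r < word_ratio \<rho> w \<and> word_map f w ` {0..1} \<inter> ball x r \<noteq> {}} \<and>
      card {w \<in> W. r < word_ratio \<rho> w \<and> word_map f w ` {0..1} \<inter> ball x r \<noteq> {}} \<le> 3"
    unfolding N_def by simp
qed

end

section \<open>Upper bounds for the covering numbers of the attractor\<close>

text \<open>
  The condition on finite sums says that the series of the \<open>\<rho> i powr h\<close> is at most \<open>1\<close>, which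
  gives all upper bounds by \<open>h\<close>.
\<close>

locale affine_ifs_dim = affine_ifs +
  fixes h :: real
  assumes h_pos: "0 < h"
    and finite_ratio_sum_le_1: "finite T \<Longrightarrow> T \<subseteq> I \<Longrightarrow> (\<Sum>i\<in>T. \<rho> i powr h) \<le> 1"
begin

lemma finite_ratio_sum_le:
  assumes "finite T" "T \<subseteq> I" "h \<le> u"
  shows "(\<Sum>i\<in>T. \<rho> i powr u) \<le> \<xi> powr (u - h)"
proof -
  have "(\<Sum>i\<in>T. \<rho> i powr u) \<le> (\<Sum>i\<in>T. \<xi> powr (u - h) * \<rho> i powr h)"
  proof (rule sum_mono)
    fix i assume "i \<in> T"
    then have i: "i \<in> I" using assms(2) by blast
    have "\<rho> i powr u = \<rho> i powr (u - h) * \<rho> i powr h" by (simp flip: powr_add)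
    also have "\<dots> \<le> \<xi> powr (u - h) * \<rho> i powr h"
      using ratio_pos[OF i] ratio_le[OF i] assms(3) by (intro mult_right_mono powr_mono2) auto
    finally show "\<rho> i powr u \<le> \<xi> powr (u - h) * \<rho> i powr h" .
  qed
  also have "\<dots> = \<xi> powr (u - h) * (\<Sum>i\<in>T. \<rho> i powr h)" by (simp add: sum_distrib_left)
  also have "\<dots> \<le> \<xi> powr (u - h) * 1"
    using finite_ratio_sum_le_1[OF assms(1,2)] by (intro mult_left_mono) auto
  finally show ?thesis by simp
qed

lemma contraction_powr_less_1: "h < u \<Longrightarrow> \<xi> powr (u - h) < 1"
  using powr_less_mono'[of \<xi> 0 "u - h"] bound_pos bound_less_1 by simp

lemma finite_large_ratios:
  assumes "0 < x"
  shows "finite {i \<in> I. x < \<rho> i}"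
proof (rule ccontr)
  assume inf: "infinite {i \<in> I. x < \<rho> i}"
  define n where "n = nat \<lceil>1 / x powr h\<rceil> + 1"
  obtain T where T: "finite T" "card T = n" "T \<subseteq> {i \<in> I. x < \<rho> i}"
    using infinite_arbitrarily_large[OF inf] by blast
  have "real n * x powr h = (\<Sum>i\<in>T. x powr h)" using T(2) by simp
  also have "\<dots> \<le> (\<Sum>i\<in>T. \<rho> i powr h)"
    using T(3) assms h_pos by (intro sum_mono powr_mono2) auto
  also have "\<dots> \<le> 1" using finite_ratio_sum_le_1[OF T(1)] T(3) by blast
  finally have "real n \<le> 1 / x powr h" using assms by (simp add: pos_le_divide_eq)
  then show False unfolding n_def by linarith
qed

text \<open>
  Images longer than \<open>x\<close> are covered by rescaled covers of \<open>\<Lambda>\<close>. A shorter image lies within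
  distance \<open>x\<close> of its fixed point, so all of these together are covered once every ball of a
  cover of \<open>F\<close> is replaced by three neighbouring balls, which contain the concentric ball of
  twice the radius.
\<close>

lemma covering_number_attractor_recursion:
  assumes "0 < x"
  shows "covering_number \<Lambda> x \<le> (\<Sum>i | i \<in> I \<and> x < \<rho> i. covering_number \<Lambda> (x / \<rho> i)) + 3 * covering_number F x"
proof -
  define S where "S = {i \<in> I. x < \<rho> i}"
  have S: "finite S" unfolding S_def by (rule finite_large_ratios[OF assms])
  have "\<exists>D. finite D \<and> \<Lambda> \<subseteq> (\<Union>y\<in>D. ball y (x / \<rho> i)) \<and> card D = covering_number \<Lambda> (x / \<rho> i)"
    if "i \<in> I" for i
  proof -
    have "0 < x / \<rho> i" using assms ratio_pos[OF that] by simp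
    then obtain D where "finite D" "\<Lambda> \<subseteq> (\<Union>y\<in>D. ball y (x / \<rho> i))"
      "card D = covering_number \<Lambda> (x / \<rho> i)"
      by (rule covering_number_attained[OF bounded_attractor])
    then show ?thesis by (intro exI conjI)
  qed
  then obtain D where D: "\<And>i. i \<in> I \<Longrightarrow> finite (D i)"
    "\<And>i. i \<in> I \<Longrightarrow> \<Lambda> \<subseteq> (\<Union>y\<in>D i. ball y (x / \<rho> i))"
    "\<And>i. i \<in> I \<Longrightarrow> card (D i) = covering_number \<Lambda> (x / \<rho> i)" by metis
  obtain C where C: "finite C" "F \<subseteq> (\<Union>y\<in>C. ball y x)" "card C = covering_number F x"
    by (rule covering_number_attained[OF bounded_fixed_points assms])
  define E where "E = (\<Union>i\<in>S. f i ` D i) \<union> (C \<union> ((\<lambda>y. y - x) ` C \<union> (\<lambda>y. y + x) ` C))"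
  have "\<Lambda> \<subseteq> (\<Union>y\<in>E. ball y x)"
  proof
    fix z assume "z \<in> \<Lambda>"
    then have "z \<in> (\<Union>i\<in>I. f i ` \<Lambda>)" using attractor_invariant(2) by blast
    then obtain i y where i: "i \<in> I" and y: "y \<in> \<Lambda>" "z = f i y" by blast
    show "z \<in> (\<Union>y\<in>E. ball y x)"
    proof (cases "x < \<rho> i")
      case True
      obtain d where d: "d \<in> D i" "\<bar>d - y\<bar> < x / \<rho> i"
        using D(2)[OF i] y(1) by (auto simp: dist_real_def)
      then have "f i d \<in> E" using i True unfolding E_def S_def by blast
      moreover have "\<bar>f i d - z\<bar> < x"
      proof -
        have "\<bar>f i d - z\<bar> = \<rho> i * \<bar>d - y\<bar>"
          unfolding y(2) using ratio_pos[OF i] by (simp add: f_def abs_mult flip: right_diff_distrib)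
        also have "\<dots> < \<rho> i * (x / \<rho> i)" using d(2) ratio_pos[OF i] by (rule mult_strict_left_mono)
        finally show ?thesis using ratio_pos[OF i] by simp
      qed
      ultimately show ?thesis by (auto simp: dist_real_def)
    next
      case False
      have "y \<in> {0..1}" using y(1) attractor_invariant(1) by blast
      from imageI[OF this, of "f i"] have "z \<in> {c i..c i + \<rho> i}" using f_image[OF i] y(2) by simp
      with fixpt_in_image[OF i] False have zp: "\<bar>z - fixpt i\<bar> \<le> x" by (simp add: abs_le_iff)
      have "fixpt i \<in> F" using i by (simp add: fixed_point_set_eq)
      then obtain a where a: "a \<in> C" "\<bar>a - fixpt i\<bar> < x" using C(2) by (auto simp: dist_real_def)
      have "a \<in> E" "a - x \<in> E" "a + x \<in> E" using a(1) unfolding E_def by blast+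
      moreover have "\<bar>a - z\<bar> < x \<or> \<bar>a - x - z\<bar> < x \<or> \<bar>a + x - z\<bar> < x"
        using a(2) zp by linarith
      ultimately show ?thesis by (auto simp: dist_real_def)
    qed
  qed
  moreover have "finite E" using S D(1) C(1) unfolding E_def S_def by auto
  ultimately have "covering_number \<Lambda> x \<le> card E" by (intro covering_number_le_card)
  also have "\<dots> \<le> (\<Sum>i\<in>S. card (D i)) + 3 * card C"
  proof -
    have "card E \<le> card (\<Union>i\<in>S. f i ` D i) + (card C + (card ((\<lambda>y. y - x) ` C) + card ((\<lambda>y. y + x) ` C)))"
      unfolding E_def by (intro order_trans[OF card_Un_le] add_left_mono order_refl)
    moreover have "card (\<Union>i\<in>S. f i ` D i) \<le> (\<Sum>i\<in>S. card (f i ` D i))" by (rule card_UN_le[OF S])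
    moreover have "(\<Sum>i\<in>S. card (f i ` D i)) \<le> (\<Sum>i\<in>S. card (D i))"
      using D(1) unfolding S_def by (intro sum_mono card_image_le) auto
    moreover have "card ((\<lambda>y. y - x) ` C) \<le> card C" "card ((\<lambda>y. y + x) ` C) \<le> card C"
      by (rule card_image_le[OF C(1)])+
    ultimately show ?thesis by linarith
  qed
  also have "(\<Sum>i\<in>S. card (D i)) = (\<Sum>i\<in>S. covering_number \<Lambda> (x / \<rho> i))"
    using D(3) unfolding S_def by (intro sum.cong) auto
  finally show ?thesis using C(3) unfolding S_def by simp
qed

text \<open>
  Unfolding the recursion, with the series of the \<open>\<rho> i powr u\<close> at most
  \<open>\<theta> = \<xi> powr (u - h) < 1\<close>, gives a geometric series. The constant \<open>C = 3 / (1 - \<theta>)\<close> is the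
  solution of \<open>C * \<theta> + 3 = C\<close>, which is what the induction over the scale preserves.
\<close>

lemma covering_number_attractor_le:
  assumes u: "h < u" and x: "0 < x" "x \<le> 1"
    and M: "\<And>y. x \<le> y \<Longrightarrow> y \<le> 1 \<Longrightarrow> real (covering_number F y) \<le> M * y powr - u"
  shows "real (covering_number \<Lambda> x) \<le> 3 / (1 - \<xi> powr (u - h)) * M * x powr - u"
proof -
  define \<theta> where "\<theta> = \<xi> powr (u - h)"
  define C where "C = 3 / (1 - \<theta>)"
  have \<theta>: "0 < \<theta>" "\<theta> < 1"
    using contraction_powr_less_1[OF u] bound_pos unfolding \<theta>_def by auto
  have C: "C * \<theta> + 3 = C" "0 < C" using \<theta> unfolding C_def by (simp_all add: field_simps)
  have M0: "0 \<le> M" using order_trans[OF of_nat_0_le_iff M[OF x(2) order_refl]] by simp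
  have claim: "real (covering_number \<Lambda> z) \<le> C * M * z powr - u"
    if "\<xi> ^ n \<le> z" "x \<le> z" "z \<le> 1" for n z
    using that
  proof (induction n arbitrary: z)
    case (Suc n)
    define S where "S = {i \<in> I. z < \<rho> i}"
    have z: "0 < z" using Suc.prems(2) x(1) by simp
    have S: "finite S" unfolding S_def by (rule finite_large_ratios[OF z])
    have *: "real (covering_number \<Lambda> (z / \<rho> i)) \<le> C * M * z powr - u * \<rho> i powr u" if "i \<in> S" for i
    proof -
      have i: "i \<in> I" "z < \<rho> i" using that unfolding S_def by auto
      have "\<xi> ^ n * \<rho> i \<le> \<xi> ^ n * \<xi>" using ratio_le[OF i(1)] bound_pos by (intro mult_left_mono) auto
      also have "\<dots> \<le> z" using Suc.prems(1) by (simp add: mult.commute)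
      finally have 1: "\<xi> ^ n \<le> z / \<rho> i" using ratio_pos[OF i(1)] by (simp add: pos_le_divide_eq)
      have "x * \<rho> i \<le> z * 1"
        using Suc.prems(2) ratio_less_1[OF i(1)] ratio_pos[OF i(1)] x(1) by (intro mult_mono) auto
      then have 2: "x \<le> z / \<rho> i" using ratio_pos[OF i(1)] by (simp add: pos_le_divide_eq)
      have 3: "z / \<rho> i \<le> 1" using i ratio_pos[OF i(1)] by simp
      have "(z / \<rho> i) powr - u = z powr - u / \<rho> i powr - u"
        using z ratio_pos[OF i(1)] by (simp add: powr_divide)
      also have "\<dots> = z powr - u * \<rho> i powr u"
        by (simp only: powr_minus[of "\<rho> i"] divide_inverse inverse_inverse_eq)
      finally have "(z / \<rho> i) powr - u = z powr - u * \<rho> i powr u" .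
      with Suc.IH[OF 1 2 3] show ?thesis by (simp only: mult.assoc)
    qed
    have "real (covering_number \<Lambda> z) \<le> real ((\<Sum>i\<in>S. covering_number \<Lambda> (z / \<rho> i)) + 3 * covering_number F z)"
      using covering_number_attractor_recursion[OF z] unfolding S_def by (simp only: of_nat_le_iff)
    also have "\<dots> = (\<Sum>i\<in>S. real (covering_number \<Lambda> (z / \<rho> i))) + 3 * real (covering_number F z)"
      by simp
    also have "\<dots> \<le> (\<Sum>i\<in>S. C * M * z powr - u * \<rho> i powr u) + 3 * (M * z powr - u)"
      using * M[OF Suc.prems(2,3)] by (intro add_mono sum_mono mult_left_mono) auto
    also have "\<dots> = C * M * z powr - u * (\<Sum>i\<in>S. \<rho> i powr u) + 3 * (M * z powr - u)"
      by (simp add: sum_distrib_left)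
    also have "\<dots> \<le> C * M * z powr - u * \<theta> + 3 * (M * z powr - u)"
      using finite_ratio_sum_le[OF S, of u] u C(2) M0 unfolding \<theta>_def S_def
      by (intro add_right_mono mult_left_mono) auto
    also have "\<dots> = (C * \<theta> + 3) * M * z powr - u" by (simp add: algebra_simps)
    finally show ?case by (simp only: C(1))
  next
    case 0
    then have z: "z = 1" by simp
    have "{i \<in> I. 1 < \<rho> i} = {}" using ratio_less_1 by fastforce
    then have "covering_number \<Lambda> 1 \<le> 3 * covering_number F 1"
      using covering_number_attractor_recursion[of 1] by (simp only: sum.empty) simp
    then have "real (covering_number \<Lambda> 1) \<le> 3 * real (covering_number F 1)" by linarith
    also have "\<dots> \<le> 3 * M" using M[OF x(2) order_refl] by simp
    also have "\<dots> \<le> C * M"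
    proof (rule mult_right_mono[OF _ M0])
      have "0 < C * \<theta>" using C(2) \<theta>(1) by (rule mult_pos_pos)
      then show "3 \<le> C" using C(1) by linarith
    qed
    finally show ?case using z by simp
  qed
  obtain n where "\<xi> ^ n < x" using real_arch_pow_inv[OF x(1) bound_less_1] by blast
  then have "\<xi> ^ n \<le> x" by simp
  from claim[OF this order_refl x(2)] show ?thesis unfolding C_def \<theta>_def .
qed

text \<open>
  The same bound for exponents: a line of slope \<open>u > h\<close> above the covering exponents of \<open>F\<close> up
  to \<open>X\<close> is, up to a constant, an upper bound for the covering exponent of \<open>\<Lambda>\<close> at \<open>X\<close>.
\<close>

lemma log_cover_attractor_le:
  assumes u: "h < u" and X: "0 \<le> X"
    and L: "\<And>y. 0 \<le> y \<Longrightarrow> y \<le> X \<Longrightarrow> log_cover F y \<le> L + u * y"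
  shows "log_cover \<Lambda> X \<le> log 2 (3 / (1 - \<xi> powr (u - h))) + L + u * X"
proof -
  define C where "C = 3 / (1 - \<xi> powr (u - h))"
  have C: "0 < C" using contraction_powr_less_1[OF u] by (simp add: C_def)
  have "real (covering_number \<Lambda> (2 powr - X)) \<le> C * 2 powr L * (2 powr - X) powr - u"
    unfolding C_def
  proof (rule covering_number_attractor_le[OF u])
    show "(2::real) powr - X \<le> 1" using X powr_mono[of "- X" 0 2] by simp
    fix y :: real assume y: "2 powr - X \<le> y" "y \<le> 1"
    have y0: "0 < y" using y(1) by (rule less_le_trans[rotated]) simp
    define z where "z = - log 2 y"
    have yz: "y = 2 powr - z" using y0 by (simp add: z_def)
    have z: "0 \<le> z" using y(2) y0 by (simp add: z_def)
    have "log 2 (2 powr - X) \<le> log 2 y" using y(1) y0 by (subst log_le_cancel_iff) auto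
    then have "z \<le> X" by (simp add: z_def)
    from L[OF z this] have "log_cover F z \<le> L + u * z" .
    moreover have "0 < covering_number F (2 powr - z)"
      using covering_number_ge_1[OF fixed_points_nonempty bounded_fixed_points, of "2 powr - z"] by simp
    ultimately have "real (covering_number F (2 powr - z)) \<le> 2 powr (L + u * z)"
      unfolding log_cover_def by (simp add: log_le_iff)
    also have "\<dots> = 2 powr L * y powr - u" by (simp add: yz powr_powr powr_add mult.commute)
    finally show "real (covering_number F y) \<le> 2 powr L * y powr - u" unfolding yz .
  qed simp
  also have "\<dots> = 2 powr (log 2 C + L + u * X)"
    using C by (simp add: powr_add powr_powr mult.commute)
  finally show ?thesis unfolding C_def by (rule log_cover_le[OF attractor_nonempty bounded_attractor])
qed

lemma upper_box_dim_attractor_le: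
  assumes "h \<le> t" "\<And>u. t < u \<Longrightarrow> \<exists>L. \<forall>x\<ge>0. log_cover F x \<le> L + u * x"
  shows "upper_box_dim \<Lambda> \<le> ereal t"
proof (rule upper_box_dim_leI)
  fix \<epsilon> :: real assume \<epsilon>: "0 < \<epsilon>"
  define u where "u = t + \<epsilon> / 2"
  have u: "h < u" "t < u" using assms(1) \<epsilon> unfolding u_def by auto
  obtain L where L: "\<And>x. x \<ge> 0 \<Longrightarrow> log_cover F x \<le> L + u * x"
    using assms(2)[OF u(2)] by auto
  define C where "C = log 2 (3 / (1 - \<xi> powr (u - h)))"
  have "\<forall>\<^sub>F x in at_top. C + L + u * x \<le> (t + \<epsilon>) * x"
    using \<epsilon> unfolding u_def by real_asymp
  then show "\<forall>\<^sub>F x in at_top. log_cover \<Lambda> x \<le> (t + \<epsilon>) * x"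
    using eventually_ge_at_top[of 0]
  proof eventually_elim
    case (elim x)
    have "log_cover \<Lambda> x \<le> C + L + u * x"
      unfolding C_def by (rule log_cover_attractor_le[OF u(1) elim(2) L])
    with elim(1) show ?case by simp
  qed
qed

end

section \<open>Upper bounds for the Hausdorff dimension of the attractor\<close>

lemma hausdorff_dim_leI:
  assumes "0 \<le> h" "\<And>u. h < u \<Longrightarrow> hausdorff_measure u A = 0"
  shows "hausdorff_dim A \<le> ereal h"
proof (rule ereal_le_epsilon2)
  fix e :: real assume "0 < e"
  then have "hausdorff_measure (h + e) A = 0" using assms(2) by simp
  then have "hausdorff_dim A \<le> ereal (h + e)"
    unfolding hausdorff_dim_def using assms(1) \<open>0 < e\<close> by (intro Inf_lower) auto
  then show "hausdorff_dim A \<le> ereal h + ereal e" by simp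
qed

lemma hausdorff_dim_geI:
  assumes "\<And>u. 0 \<le> u \<Longrightarrow> u < h \<Longrightarrow> hausdorff_measure u A \<noteq> 0"
  shows "ereal h \<le> hausdorff_dim A"
  unfolding hausdorff_dim_def
proof (rule Inf_greatest)
  fix x assume "x \<in> {ereal s |s. 0 \<le> s \<and> hausdorff_measure s A = 0}"
  then obtain s where s: "x = ereal s" "0 \<le> s" "hausdorff_measure s A = 0" by blast
  then have "h \<le> s" using assms[of s] by fastforce
  then show "ereal h \<le> x" using s(1) by simp
qed

lemma diam_pow_pos_exponent: "u \<noteq> 0 \<Longrightarrow> diam_pow u U = ennreal (diameter U powr u)"
  by (simp add: diam_pow_def)

text \<open>
  For sets of diameter at most \<open>1\<close> the weight \<open>diam_pow u\<close> dominates \<open>diam_pow v\<close> if \<open>u \<le> v\<close>,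
  also under the convention for exponent \<open>0\<close>. Hence a mass bound for one positive exponent \<open>v\<close>
  serves all smaller exponents.
\<close>

lemma hausdorff_measure_neq_0I:
  assumes "0 < v" "u \<le> v" "0 < \<eta>"
    and cover: "\<And>U. U \<in> countable_covers 1 A \<Longrightarrow> ennreal \<eta> \<le> (\<Sum>n. ennreal (diameter (U n) powr v))"
  shows "hausdorff_measure u A \<noteq> 0"
proof -
  have "ennreal \<eta> \<le> (\<Sum>n. diam_pow u (U n))" if U: "U \<in> countable_covers 1 A" for U
  proof -
    have "ennreal (diameter (U n) powr v) \<le> diam_pow u (U n)" for n
    proof -
      have d: "0 \<le> diameter (U n)" "diameter (U n) \<le> 1"
        using U diameter_ge_0 unfolding countable_covers_def by auto
      have 1: "diameter (U n) powr v \<le> diameter (U n) powr u"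
        using powr_mono'[OF assms(2) d] by simp
      have 2: "diameter (U n) powr v \<le> 1"
        using powr_mono2[of v "diameter (U n)" 1] d assms(1) by simp
      show ?thesis
        using 1 2 assms(1) unfolding diam_pow_def by (auto intro!: ennreal_leI)
    qed
    then have "(\<Sum>n. ennreal (diameter (U n) powr v)) \<le> (\<Sum>n. diam_pow u (U n))"
      by (intro suminf_le) auto
    with cover[OF U] show ?thesis by (rule order_trans)
  qed
  then have "ennreal \<eta> \<le> hausdorff_premeasure u 1 A"
    unfolding hausdorff_premeasure_def by (intro INF_greatest)
  also have "\<dots> \<le> hausdorff_measure u A"
    unfolding hausdorff_measure_def by (intro SUP_upper) simp
  finally show ?thesis using assms(3) by auto
qed

context affine_ifs_dim
begin

lemma diameter_f_image_le:
  assumes "i \<in> I" "bounded U"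
  shows "diameter (f i ` U) \<le> \<rho> i * diameter U"
proof (rule diameter_le)
  show "f i ` U \<noteq> {} \<or> 0 \<le> \<rho> i * diameter U"
    using ratio_pos[OF assms(1)] diameter_ge_0[OF assms(2)] by simp
  fix x y assume "x \<in> f i ` U" "y \<in> f i ` U"
  then obtain a b where ab: "a \<in> U" "b \<in> U" "x = f i a" "y = f i b" by blast
  have "norm (x - y) = \<rho> i * dist a b"
    unfolding ab(3,4) f_def using ratio_pos[OF assms(1)]
    by (simp add: dist_real_def abs_mult flip: right_diff_distrib)
  also have "\<dots> \<le> \<rho> i * diameter U"
    using diameter_bounded_bound[OF assms(2) ab(1,2)] ratio_pos[OF assms(1)] by simp
  finally show "norm (x - y) \<le> \<rho> i * diameter U" .
qed

text \<open>
  The cylinders of level \<open>n\<close>, built by applying all maps to a cover of the previous level and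
  enumerating the result through \<open>prod_decode\<close>. Each step multiplies the total weight by at
  most \<open>\<xi> powr (u - h)\<close>.
\<close>

lemma level_cover:
  assumes "h < u"
  shows "\<exists>U\<in>countable_covers (\<xi> ^ n) \<Lambda>. (\<Sum>k. diam_pow u (U k)) \<le> ennreal ((\<xi> powr (u - h)) ^ n)"
proof (induction n)
  case 0
  define U :: "nat \<Rightarrow> real set" where "U k = (if k = 0 then {0..1} else {})" for k
  have "\<Lambda> \<subseteq> U 0" using attractor_invariant(1) by (simp add: U_def)
  then have "U \<in> countable_covers (\<xi> ^ 0) \<Lambda>"
    unfolding countable_covers_def by (auto simp: U_def)
  moreover have "(\<Sum>k. diam_pow u (U k)) = (\<Sum>k\<in>{0}. diam_pow u (U k))"
    by (rule suminf_finite) (auto simp: U_def diam_pow_def)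
  moreover have "diam_pow u (U 0) = 1"
    using assms h_pos by (simp add: U_def diam_pow_pos_exponent)
  ultimately show ?case by (intro bexI[of _ U]) auto
next
  case (Suc n)
  define \<theta> where "\<theta> = \<xi> powr (u - h)"
  have u: "u \<noteq> 0" using assms h_pos by simp
  obtain U where U: "U \<in> countable_covers (\<xi> ^ n) \<Lambda>" "(\<Sum>k. diam_pow u (U k)) \<le> ennreal (\<theta> ^ n)"
    using Suc.IH unfolding \<theta>_def by blast
  then have Ub: "\<Lambda> \<subseteq> (\<Union>k. U k)" "\<And>k. bounded (U k)" "\<And>k. diameter (U k) \<le> \<xi> ^ n"
    unfolding countable_covers_def by auto
  define G :: "nat \<times> nat \<Rightarrow> real set" where "G = (\<lambda>(i, k). if i \<in> I then f i ` U k else {})"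
  have bounded_image: "bounded (f i ` U k)" for i k
    using bounded_translation[OF bounded_scaling[OF Ub(2)], of "c i" "\<rho> i" k]
    by (simp add: f_def[abs_def] image_image)
  have G: "bounded (G p) \<and> diameter (G p) \<le> \<xi> ^ Suc n" for p
  proof (cases p)
    case (Pair i k)
    show ?thesis
    proof (cases "i \<in> I")
      case True
      have "diameter (f i ` U k) \<le> \<rho> i * diameter (U k)"
        by (rule diameter_f_image_le[OF True Ub(2)])
      also have "\<dots> \<le> \<xi> * \<xi> ^ n"
        using ratio_le[OF True] ratio_pos[OF True] Ub(3)[of k] diameter_ge_0[OF Ub(2), of k] bound_pos
        by (intro mult_mono) auto
      finally show ?thesis using bounded_image True by (simp add: Pair G_def)
    qed (use bound_pos in \<open>simp add: Pair G_def\<close>)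
  qed
  have "\<Lambda> \<subseteq> (\<Union>m. G (prod_decode m))"
  proof
    fix x assume "x \<in> \<Lambda>"
    then have "x \<in> (\<Union>i\<in>I. f i ` \<Lambda>)" using attractor_invariant(2) by blast
    then obtain i y where iy: "i \<in> I" "y \<in> \<Lambda>" "x = f i y" by blast
    then obtain k where "y \<in> U k" using Ub(1) by blast
    then have "x \<in> G (prod_decode (prod_encode (i, k)))" using iy by (simp add: G_def)
    then show "x \<in> (\<Union>m. G (prod_decode m))" by blast
  qed
  then have "(\<lambda>m. G (prod_decode m)) \<in> countable_covers (\<xi> ^ Suc n) \<Lambda>"
    unfolding countable_covers_def using G by blast
  moreover have "(\<Sum>m. diam_pow u (G (prod_decode m))) \<le> ennreal (\<theta> ^ Suc n)"
  proof -
    define w where "w i = (if i \<in> I then \<rho> i powr u else 0)" for i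
    have "(\<Sum>m. diam_pow u (G (prod_decode m))) = (\<Sum>i. \<Sum>k. diam_pow u (G (i, k)))"
      by (rule suminf_ennreal_2dimen) simp
    also have "\<dots> \<le> (\<Sum>i. \<Sum>k. ennreal (w i) * diam_pow u (U k))"
    proof (intro suminf_le summableI)
      fix i k
      show "diam_pow u (G (i, k)) \<le> ennreal (w i) * diam_pow u (U k)"
      proof (cases "i \<in> I")
        case True
        have "diameter (f i ` U k) powr u \<le> (\<rho> i * diameter (U k)) powr u"
          using diameter_f_image_le[OF True Ub(2)] diameter_ge_0[OF bounded_image] assms h_pos
          by (intro powr_mono2) auto
        also have "\<dots> = \<rho> i powr u * diameter (U k) powr u"
          using ratio_pos[OF True] diameter_ge_0[OF Ub(2)] by (simp add: powr_mult)
        finally show ?thesis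
          using True u by (simp add: G_def w_def diam_pow_pos_exponent ennreal_leI flip: ennreal_mult)
      qed (simp add: G_def w_def diam_pow_def)
    qed
    also have "\<dots> = (\<Sum>i. ennreal (w i)) * (\<Sum>k. diam_pow u (U k))" by simp
    also have "\<dots> \<le> ennreal \<theta> * ennreal (\<theta> ^ n)"
    proof (rule mult_mono[OF _ U(2)])
      show "(\<Sum>i. ennreal (w i)) \<le> ennreal \<theta>"
      proof (rule suminf_le_const)
        fix m
        have "(\<Sum>i<m. ennreal (w i)) = ennreal (\<Sum>i<m. w i)"
          by (rule sum_ennreal) (simp add: w_def)
        also have "(\<Sum>i<m. w i) = (\<Sum>i\<in>{..<m} \<inter> I. \<rho> i powr u)"
          unfolding w_def by (simp add: sum.inter_restrict)
        also have "ennreal \<dots> \<le> ennreal \<theta>"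
          using finite_ratio_sum_le[of "{..<m} \<inter> I" u] assms unfolding \<theta>_def by (intro ennreal_leI) auto
        finally show "(\<Sum>i<m. ennreal (w i)) \<le> ennreal \<theta>" .
      qed simp
    qed simp_all
    also have "\<dots> = ennreal (\<theta> ^ Suc n)" by (simp add: \<theta>_def flip: ennreal_mult)
    finally show ?thesis .
  qed
  ultimately show ?case unfolding \<theta>_def by (intro bexI)
qed

lemma hausdorff_dim_attractor_le: "hausdorff_dim \<Lambda> \<le> ereal h"
proof (rule hausdorff_dim_leI)
  show "0 \<le> h" using h_pos by simp
  fix u assume u: "h < u"
  define \<theta> where "\<theta> = \<xi> powr (u - h)"
  have \<theta>: "0 < \<theta>" "\<theta> < 1" using contraction_powr_less_1[OF u] bound_pos unfolding \<theta>_def by auto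
  have "hausdorff_premeasure u \<delta> \<Lambda> \<le> 0" if \<delta>: "0 < \<delta>" for \<delta>
  proof (rule LIMSEQ_le_const)
    have "(\<lambda>n. ennreal (\<theta> ^ n)) \<longlonglongrightarrow> ennreal 0"
      using \<theta> by (intro tendsto_ennrealI LIMSEQ_realpow_zero) auto
    then show "(\<lambda>n. ennreal (\<theta> ^ n)) \<longlonglongrightarrow> 0" by simp
    obtain N where N: "\<xi> ^ N < \<delta>" using real_arch_pow_inv[OF \<delta> bound_less_1] by blast
    have "hausdorff_premeasure u \<delta> \<Lambda> \<le> ennreal (\<theta> ^ n)" if "n \<ge> N" for n
    proof -
      obtain U where U: "U \<in> countable_covers (\<xi> ^ n) \<Lambda>" "(\<Sum>k. diam_pow u (U k)) \<le> ennreal (\<theta> ^ n)"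
        using level_cover[OF u] unfolding \<theta>_def by blast
      have "\<xi> ^ n \<le> \<xi> ^ N" using that bound_pos bound_less_1 by (intro power_decreasing) auto
      with N have "\<xi> ^ n \<le> \<delta>" by simp
      with U(1) have "U \<in> countable_covers \<delta> \<Lambda>"
        unfolding countable_covers_def by (blast intro: order_trans)
      then have "hausdorff_premeasure u \<delta> \<Lambda> \<le> (\<Sum>k. diam_pow u (U k))"
        unfolding hausdorff_premeasure_def by (rule INF_lower)
      with U(2) show ?thesis by (rule order_trans[rotated])
    qed
    then show "\<exists>N. \<forall>n\<ge>N. hausdorff_premeasure u \<delta> \<Lambda> \<le> ennreal (\<theta> ^ n)" by blast
  qed
  then show "hausdorff_measure u \<Lambda> = 0"
    unfolding hausdorff_measure_def by (simp add: SUP_eq_const)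
qed

end

section \<open>Finite subsystems whose images are separated by gaps\<close>

text \<open>
  A finite subsystem whose first-level images keep a distance \<open>\<delta>\<close> and whose similarity
  dimension is at least \<open>u\<close>. It witnesses lower bounds with exponent \<open>u\<close>.
\<close>

locale gap_subsystem = affine_ifs +
  fixes T :: "nat set" and \<delta> u :: real
  assumes T: "finite T" "T \<subseteq> I"
    and gap_pos: "0 < \<delta>"
    and gap: "i \<in> T \<Longrightarrow> j \<in> T \<Longrightarrow> i \<noteq> j \<Longrightarrow> c i + \<rho> i + \<delta> \<le> c j \<or> c j + \<rho> j + \<delta> \<le> c i"
    and exponent_pos: "0 < u"
    and sum_ge_1: "1 \<le> (\<Sum>i\<in>T. \<rho> i powr u)"
begin

lemma T_in_I: "i \<in> T \<Longrightarrow> i \<in> I"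
  using T(2) by blast

lemma T_nonempty: "T \<noteq> {}"
  using sum_ge_1 by auto

lemma gap_between_images:
  assumes "i \<in> T" "j \<in> T" "i \<noteq> j" "x \<in> {0..1}" "y \<in> {0..1}"
  shows "\<delta> \<le> \<bar>f i x - f j y\<bar>"
proof -
  have "f i x \<in> {c i..c i + \<rho> i}" "f j y \<in> {c j..c j + \<rho> j}"
    using imageI[OF assms(4), of "f i"] imageI[OF assms(5), of "f j"]
      f_image[OF T_in_I[OF assms(1)]] f_image[OF T_in_I[OF assms(2)]] by auto
  then show ?thesis using gap[OF assms(1-3)] by auto
qed

lemma f_diff: "f i x - f i y = \<rho> i * (x - y)"
  by (simp add: f_def right_diff_distrib)

lemma f_attractor_subset: "i \<in> I \<Longrightarrow> f i ` \<Lambda> \<subseteq> \<Lambda>"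
  using equalityD2[OF attractor_invariant(2)[of I f]] by blast

text \<open>
  Rescaled separated sets in different images do not interfere as long as the scale is below
  the gap.
\<close>

lemma separated_union:
  assumes x: "0 < x" "x \<le> \<delta>"
    and Q: "\<And>i. i \<in> T \<Longrightarrow> Q i \<subseteq> \<Lambda> \<and> finite (Q i) \<and> separated (x / \<rho> i) (Q i)"
  defines "P \<equiv> \<Union>i\<in>T. f i ` Q i"
  shows "P \<subseteq> \<Lambda>" "finite P" "separated x P" "card P = (\<Sum>i\<in>T. card (Q i))"
proof -
  have unit: "q \<in> {0..1}" if "i \<in> T" "q \<in> Q i" for i q
    using Q[OF that(1)] that(2) attractor_invariant(1) by blast
  show "P \<subseteq> \<Lambda>" using Q f_attractor_subset T_in_I unfolding P_def by blast
  show "finite P" using Q T(1) unfolding P_def by blast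
  show "separated x P"
    unfolding separated_def
  proof (intro ballI impI)
    fix a b assume "a \<in> P" "b \<in> P" "a \<noteq> b"
    then obtain i j p q where ij: "i \<in> T" "p \<in> Q i" "a = f i p" "j \<in> T" "q \<in> Q j" "b = f j q"
      unfolding P_def by blast
    show "x \<le> \<bar>a - b\<bar>"
    proof (cases "i = j")
      case True
      then have "p \<noteq> q" using ij \<open>a \<noteq> b\<close> by auto
      then have "x / \<rho> i \<le> \<bar>p - q\<bar>" using Q[OF ij(1)] ij True unfolding separated_def by blast
      then have "x \<le> \<rho> i * \<bar>p - q\<bar>"
        using ratio_pos[OF T_in_I[OF ij(1)]] by (simp add: pos_divide_le_eq mult.commute)
      also have "\<dots> = \<bar>a - b\<bar>"
        using ij True ratio_pos[OF T_in_I[OF ij(1)]] by (simp add: f_diff abs_mult)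
      finally show ?thesis .
    next
      case False
      then show ?thesis
        using gap_between_images[OF ij(1,4) False unit[OF ij(1,2)] unit[OF ij(4,5)]] x(2) ij(3,6) by simp
    qed
  qed
  have "card P = (\<Sum>i\<in>T. card (f i ` Q i))"
    unfolding P_def
  proof (rule card_UN_disjoint[OF T(1)])
    show "\<forall>i\<in>T. finite (f i ` Q i)" using Q by blast
    show "\<forall>i\<in>T. \<forall>j\<in>T. i \<noteq> j \<longrightarrow> f i ` Q i \<inter> f j ` Q j = {}"
    proof (intro ballI impI, rule ccontr)
      fix i j assume ij: "i \<in> T" "j \<in> T" "i \<noteq> j" "f i ` Q i \<inter> f j ` Q j \<noteq> {}"
      then obtain p q where pq: "p \<in> Q i" "q \<in> Q j" "f i p = f j q" by blast
      have "\<delta> \<le> \<bar>f i p - f j q\<bar>"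
        by (rule gap_between_images[OF ij(1-3) unit[OF ij(1) pq(1)] unit[OF ij(2) pq(2)]])
      with pq(3) gap_pos show False by simp
    qed
  qed
  also have "\<dots> = (\<Sum>i\<in>T. card (Q i))"
  proof (rule sum.cong[OF refl])
    fix i assume "i \<in> T"
    then have "0 < \<rho> i" using ratio_pos T_in_I by blast
    then have "inj_on (f i) (Q i)" by (auto simp: inj_on_def f_def)
    then show "card (f i ` Q i) = card (Q i)" by (rule card_image)
  qed
  finally show "card P = (\<Sum>i\<in>T. card (Q i))" .
qed

text \<open>
  Copies of one separated set, spread over all cylinders of the subsystem. The induction
  descends in the scale: as long as \<open>z\<close> is at least \<open>r\<close> times the smallest ratio, the set \<open>Q\<close>
  itself is large enough; below this range the images of the sets obtained for the scales
  \<open>z / \<rho> i\<close> are united, and \<open>1 \<le> (\<Sum>i\<in>T. \<rho> i powr u)\<close> shows that the bound is not lost.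
\<close>

lemma separated_sets_grow:
  assumes Q: "Q \<subseteq> \<Lambda>" "finite Q" "separated r Q" and r: "0 < r" "r \<le> \<delta>" and x: "0 < x" "x \<le> r"
  shows "\<exists>P\<subseteq>\<Lambda>. separated x P \<and> Min (\<rho> ` T) powr u * (r / x) powr u * real (card Q) \<le> real (card P)"
proof -
  define m where "m = Min (\<rho> ` T)"
  have m: "0 < m" "\<And>i. i \<in> T \<Longrightarrow> m \<le> \<rho> i"
    using T(1) T_nonempty ratio_pos T_in_I unfolding m_def by auto
  have claim: "\<exists>P\<subseteq>\<Lambda>. finite P \<and> separated z P \<and> m powr u * (r / z) powr u * real (card Q) \<le> real (card P)"
    if "r * \<xi> ^ n \<le> z" "z \<le> r" for n z
    using that
  proof (induction n arbitrary: z)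
    case (Suc n)
    have z0: "0 < z" using less_le_trans[OF mult_pos_pos[OF r(1) zero_less_power[OF bound_pos]] Suc.prems(1)] .
    show ?case
    proof (cases "r * m \<le> z")
      case True
      have "m * (r / z) \<le> 1" using True z0 by (simp add: field_simps)
      then have "(m * (r / z)) powr u \<le> 1"
        using powr_mono2[of u "m * (r / z)" 1] exponent_pos m(1) z0 r(1) by simp
      moreover have "(m * (r / z)) powr u = m powr u * (r / z) powr u"
        by (rule powr_mult)
      ultimately have "m powr u * (r / z) powr u \<le> 1" by (simp only:)
      then have "m powr u * (r / z) powr u * real (card Q) \<le> 1 * real (card Q)"
        by (rule mult_right_mono) simp
      moreover have "separated z Q" using Q(3) Suc.prems(2) unfolding separated_def by force
      ultimately show ?thesis using Q(1,2) by (intro exI[of _ Q]) simp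
    next
      case False
      have "\<exists>P\<subseteq>\<Lambda>. finite P \<and> separated (z / \<rho> i) P
          \<and> m powr u * (r / (z / \<rho> i)) powr u * real (card Q) \<le> real (card P)" if i: "i \<in> T" for i
      proof (rule Suc.IH)
        note pos = ratio_pos[OF T_in_I[OF i]]
        have "r * \<xi> ^ n * \<rho> i \<le> r * \<xi> ^ n * \<xi>"
          using ratio_le[OF T_in_I[OF i]] r(1) bound_pos by (intro mult_left_mono) auto
        also have "\<dots> \<le> z" using Suc.prems(1) by (simp add: ac_simps)
        finally show "r * \<xi> ^ n \<le> z / \<rho> i" using pos by (simp add: pos_le_divide_eq)
        have "z \<le> r * m" using False by simp
        also have "\<dots> \<le> r * \<rho> i" using m(2)[OF i] r(1) by simp
        finally show "z / \<rho> i \<le> r" using pos by (simp add: pos_divide_le_eq)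
      qed
      then obtain P where P: "\<And>i. i \<in> T \<Longrightarrow> P i \<subseteq> \<Lambda> \<and> finite (P i) \<and> separated (z / \<rho> i) (P i)"
        "\<And>i. i \<in> T \<Longrightarrow> m powr u * (r / (z / \<rho> i)) powr u * real (card Q) \<le> real (card (P i))"
        by metis
      have z\<delta>: "z \<le> \<delta>" using Suc.prems(2) r(2) by simp
      note U = separated_union[OF z0 z\<delta> P(1)]
      define k where "k = m powr u * (r / z) powr u * real (card Q)"
      have "k * 1 \<le> k * (\<Sum>i\<in>T. \<rho> i powr u)" using sum_ge_1 by (intro mult_left_mono) (auto simp: k_def)
      also have "\<dots> = (\<Sum>i\<in>T. m powr u * (r / (z / \<rho> i)) powr u * real (card Q))"
        unfolding sum_distrib_left
      proof (rule sum.cong[OF refl])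
        fix i assume "i \<in> T"
        then have "0 < \<rho> i" using ratio_pos T_in_I by blast
        have "r / (z / \<rho> i) = (r / z) * \<rho> i" by simp
        then have "(r / (z / \<rho> i)) powr u = (r / z) powr u * \<rho> i powr u"
          using z0 r(1) \<open>0 < \<rho> i\<close> by (simp only: powr_mult)
        then show "k * \<rho> i powr u = m powr u * (r / (z / \<rho> i)) powr u * real (card Q)"
          unfolding k_def by (simp only: mult_ac)
      qed
      also have "\<dots> \<le> (\<Sum>i\<in>T. real (card (P i)))" by (rule sum_mono[OF P(2)])
      also have "\<dots> = real (card (\<Union>i\<in>T. f i ` P i))" using U(4) by simp
      finally show ?thesis using U(1-3) unfolding k_def by (intro exI[of _ "\<Union>i\<in>T. f i ` P i"]) simp
    qed
  next
    case 0
    then have z: "z = r" by simp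
    obtain i where "i \<in> T" using T_nonempty by blast
    then have "m < 1" using m(2)[of i] ratio_less_1[OF T_in_I, of i] by simp
    then have "m powr u \<le> 1" using powr_mono2[of u m 1] m(1) exponent_pos by simp
    then have "m powr u * real (card Q) \<le> 1 * real (card Q)" by (rule mult_right_mono) simp
    then show ?case using Q z r(1) by (intro exI[of _ Q]) simp
  qed
  obtain n where "\<xi> ^ n < x / r"
    using real_arch_pow_inv[of "x / r" \<xi>] x(1) r(1) bound_less_1 by auto
  then have "r * \<xi> ^ n \<le> x" using r(1) by (simp add: field_simps)
  from claim[OF this x(2)] obtain P where P: "P \<subseteq> \<Lambda> \<and> finite P \<and> separated x P
    \<and> m powr u * (r / x) powr u * real (card Q) \<le> real (card P)" ..
  show ?thesis
    unfolding m_def[symmetric]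
    by (rule exI[of _ P]) (intro conjI P[THEN conjunct1] P[THEN conjunct2, THEN conjunct2, THEN conjunct1]
      P[THEN conjunct2, THEN conjunct2, THEN conjunct2])
qed

lemma covering_number_attractor_ge:
  assumes Q: "Q \<subseteq> \<Lambda>" "finite Q" "separated r Q" and r: "0 < r" "r \<le> \<delta>" and x: "0 < x" "x \<le> r"
  shows "Min (\<rho> ` T) powr u * (r / x) powr u * real (card Q) \<le> real (covering_number \<Lambda> (x / 2))"
proof -
  obtain P where "P \<subseteq> \<Lambda> \<and> separated x P
    \<and> Min (\<rho> ` T) powr u * (r / x) powr u * real (card Q) \<le> real (card P)"
    using separated_sets_grow[OF assms] ..
  then have P: "P \<subseteq> \<Lambda>" "separated x P"
    "Min (\<rho> ` T) powr u * (r / x) powr u * real (card Q) \<le> real (card P)" by simp_all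
  have "card P \<le> covering_number \<Lambda> (x / 2)"
    using card_separated_le_covering_number(2)[OF P(2,1) bounded_attractor, of "x / 2"] x(1) by simp
  with P(3) show ?thesis by linarith
qed

definition K :: "real set" where "K = attractor T f"

lemma K_unit: "K \<subseteq> {0..1}"
  unfolding K_def by (rule attractor_invariant(1))

lemma K_invariant: "K = (\<Union>i\<in>T. f i ` K)"
  unfolding K_def by (rule attractor_invariant(2))

lemma K_subset_attractor: "K \<subseteq> \<Lambda>"
proof (rule post_fixed_subset_attractor[OF f_image_subset K_unit])
  show "K \<subseteq> (\<Union>i\<in>I. f i ` K)" using equalityD1[OF K_invariant] T(2) by blast
qed

lemma K_nonempty: "K \<noteq> {}"
proof -
  obtain i where i: "i \<in> T" using T_nonempty by blast
  have "{fixpt i} \<subseteq> attractor T f"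
  proof (rule post_fixed_subset_attractor)
    show "{fixpt i} \<subseteq> {0..1}" using fixpt_in_unit[OF T_in_I[OF i]] by simp
    have "fixpt i = f i (fixpt i)" using fixpt_fixed[OF T_in_I[OF i]] by simp
    then show "{fixpt i} \<subseteq> (\<Union>i'\<in>T. f i' ` {fixpt i})" using i by blast
  qed (rule f_image_subset[OF T_in_I])
  then show ?thesis unfolding K_def by blast
qed

lemma compact_K: "compact K"
proof -
  have bounded: "bounded K" by (rule bounded_subset[OF _ K_unit]) simp
  have comp: "compact (\<Union>i\<in>T. f i ` closure K)"
  proof (intro compact_UN T(1) compact_continuous_image)
    show "continuous_on (closure K) (f i)" for i
      unfolding f_def[abs_def] by (intro continuous_intros)
    show "compact (closure K)" using bounded by (simp add: compact_closure)
  qed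
  have "K \<subseteq> (\<Union>i\<in>T. f i ` closure K)"
  proof
    fix y assume "y \<in> K"
    then obtain i where "i \<in> T" "y \<in> f i ` K" using equalityD1[OF K_invariant] by blast
    then show "y \<in> (\<Union>i\<in>T. f i ` closure K)" using closure_subset[of K] by blast
  qed
  then have sub: "closure K \<subseteq> (\<Union>i\<in>T. f i ` closure K)"
    using comp by (intro closure_minimal compact_imp_closed)
  have unit: "closure K \<subseteq> {0..1}" using K_unit by (intro closure_minimal) auto
  have "closure K \<subseteq> K"
    unfolding K_def[symmetric] using post_fixed_subset_attractor[OF f_image_subset[OF T_in_I] unit sub]
    unfolding K_def[symmetric] .
  then have "closed K" using closure_subset_eq by blast
  with bounded show ?thesis by (simp add: compact_eq_bounded_closed)
qed

text \<open>
  The mass distribution principle without a measure, by induction on the number of balls. If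
  some ball has radius at least \<open>\<delta> / 2\<close>, one term suffices. Otherwise each ball meets at most
  one first-level piece of \<open>K\<close>, so the balls split into disjoint families, one for each piece,
  all of them smaller because there are at least two pieces. Each family, rescaled to a cover
  of \<open>K\<close>, satisfies the bound by induction, and \<open>1 \<le> (\<Sum>i\<in>T. \<rho> i powr u)\<close> adds the pieces up.
\<close>

lemma finite_cover_mass:
  assumes "finite S" "\<And>j. j \<in> S \<Longrightarrow> 0 < d j" "K \<subseteq> (\<Union>j\<in>S. ball (x j) (d j))"
  shows "(\<delta> / 2) powr u \<le> (\<Sum>j\<in>S. d j powr u)"
  using assms
proof (induction "card S" arbitrary: S x d rule: less_induct)
  case less
  show ?case
  proof (cases "\<exists>j\<in>S. \<delta> / 2 \<le> d j")
    case True
    then obtain j where j: "j \<in> S" "\<delta> / 2 \<le> d j" by blast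
    have "(\<delta> / 2) powr u \<le> d j powr u" using j(2) gap_pos exponent_pos by (intro powr_mono2) auto
    also have "\<dots> \<le> (\<Sum>j\<in>S. d j powr u)" using less.prems(1) j(1) by (intro member_le_sum) auto
    finally show ?thesis .
  next
    case False
    define S' where "S' i = {j \<in> S. ball (x j) (d j) \<inter> f i ` K \<noteq> {}}" for i
    have sub: "S' i \<subseteq> S" for i unfolding S'_def by blast
    have disj: "S' i \<inter> S' k = {}" if ik: "i \<in> T" "k \<in> T" "i \<noteq> k" for i k
    proof (rule ccontr)
      assume "S' i \<inter> S' k \<noteq> {}"
      then obtain j p q where j: "j \<in> S" "p \<in> K" "q \<in> K" "f i p \<in> ball (x j) (d j)" "f k q \<in> ball (x j) (d j)"
        unfolding S'_def by blast
      have "\<delta> \<le> \<bar>f i p - f k q\<bar>" using gap_between_images[OF ik] j(2,3) K_unit by blast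
      moreover have "\<bar>x j - f i p\<bar> < d j" "\<bar>x j - f k q\<bar> < d j" using j(4,5) by (auto simp: dist_real_def)
      moreover have "d j < \<delta> / 2" using False j(1) by (meson not_le)
      ultimately show False by linarith
    qed
    have cov: "f i ` K \<subseteq> (\<Union>j\<in>S' i. ball (x j) (d j))" if "i \<in> T" for i
    proof
      fix y assume y: "y \<in> f i ` K"
      then have "y \<in> K" using equalityD2[OF K_invariant] that by blast
      then obtain j where "j \<in> S" "y \<in> ball (x j) (d j)" using less.prems(3) by blast
      with y show "y \<in> (\<Union>j\<in>S' i. ball (x j) (d j))" unfolding S'_def by blast
    qed
    have ne: "S' i \<noteq> {}" if "i \<in> T" for i
      using cov[OF that] K_nonempty by auto
    have two: "\<exists>k\<in>T. k \<noteq> i" if "i \<in> T" for i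
    proof (rule ccontr)
      assume "\<not> ?thesis"
      then have "T = {i}" using that by blast
      then have "1 \<le> \<rho> i powr u" using sum_ge_1 by simp
      moreover have "\<rho> i powr u < 1"
        using powr_less_mono2[of u "\<rho> i" 1] exponent_pos ratio_pos[OF T_in_I[OF that]]
          ratio_less_1[OF T_in_I[OF that]] by simp
      ultimately show False by simp
    qed
    have part: "\<rho> i powr u * (\<delta> / 2) powr u \<le> (\<Sum>j\<in>S' i. d j powr u)" if i: "i \<in> T" for i
    proof -
      note pos = ratio_pos[OF T_in_I[OF i]]
      obtain k where k: "k \<in> T" "k \<noteq> i" using two[OF i] by blast
      then obtain j where "j \<in> S' k" using ne by blast
      then have "S' i \<subset> S" using disj[OF i k(1)] k(2) sub by blast
      then have card: "card (S' i) < card S" by (rule psubset_card_mono[OF less.prems(1)])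
      have "(\<delta> / 2) powr u \<le> (\<Sum>j\<in>S' i. (d j / \<rho> i) powr u)"
      proof (rule less.hyps[OF card])
        show "finite (S' i)" using finite_subset[OF sub less.prems(1)] .
        show "0 < d j / \<rho> i" if "j \<in> S' i" for j
          by (rule divide_pos_pos[OF less.prems(2) pos]) (use that sub in blast)
        show "K \<subseteq> (\<Union>j\<in>S' i. ball ((x j - c i) / \<rho> i) (d j / \<rho> i))"
        proof
          fix y assume "y \<in> K"
          then obtain j where j: "j \<in> S' i" "\<bar>x j - f i y\<bar> < d j"
            using cov[OF i] by (auto simp: dist_real_def)
          have "\<bar>(x j - c i) / \<rho> i - y\<bar> = \<bar>x j - f i y\<bar> / \<rho> i"
            using pos by (simp add: f_def field_simps abs_if)
          also have "\<dots> < d j / \<rho> i" using j(2) pos by (rule divide_strict_right_mono)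
          finally show "y \<in> (\<Union>j\<in>S' i. ball ((x j - c i) / \<rho> i) (d j / \<rho> i))"
            using j(1) by (auto simp: dist_real_def)
        qed
      qed
      also have "\<dots> = (\<Sum>j\<in>S' i. d j powr u) / \<rho> i powr u"
        unfolding sum_divide_distrib
      proof (rule sum.cong[OF refl])
        fix j assume "j \<in> S' i"
        then have "0 < d j" using less.prems(2) sub by blast
        then show "(d j / \<rho> i) powr u = d j powr u / \<rho> i powr u" using pos by (simp add: powr_divide)
      qed
      finally show ?thesis using pos by (simp add: pos_le_divide_eq mult.commute)
    qed
    have "1 * (\<delta> / 2) powr u \<le> (\<Sum>i\<in>T. \<rho> i powr u) * (\<delta> / 2) powr u"
      using sum_ge_1 by (rule mult_right_mono) simp
    also have "\<dots> \<le> (\<Sum>i\<in>T. \<Sum>j\<in>S' i. d j powr u)"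
      unfolding sum_distrib_right by (rule sum_mono[OF part])
    also have "\<dots> = (\<Sum>j\<in>(\<Union>i\<in>T. S' i). d j powr u)"
      using finite_subset[OF sub less.prems(1)] disj
      by (intro sum.UNION_disjoint[symmetric] T(1)) auto
    also have "\<dots> \<le> (\<Sum>j\<in>S. d j powr u)"
      using sub by (intro sum_mono2 less.prems(1)) auto
    finally show ?thesis by simp
  qed
qed

text \<open>
  By compactness of \<open>K\<close>, after each member of the cover is enlarged to an open ball at a total
  cost of \<open>e\<close>.
\<close>

lemma countable_cover_mass:
  assumes "U \<in> countable_covers 1 \<Lambda>"
  shows "ennreal ((\<delta> / 2) powr u) \<le> (\<Sum>n. ennreal (diameter (U n) powr u))"
proof (rule ennreal_le_epsilon)
  fix e :: real assume e: "0 < e"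
  have U: "\<Lambda> \<subseteq> (\<Union>n. U n)" "\<And>n. bounded (U n)" using assms unfolding countable_covers_def by auto
  \<comment> \<open>The radius is chosen through its \<open>u\<close>-th power, so that the excess is exactly \<open>e * (1 / 2) ^ Suc n\<close>.\<close>
  define d where "d n = (diameter (U n) powr u + e * (1 / 2) ^ Suc n) powr (1 / u)" for n
  have e': "0 < e * (1 / 2) ^ Suc n" for n using e by simp
  have d_pow: "d n powr u = diameter (U n) powr u + e * (1 / 2) ^ Suc n" for n
  proof -
    have "0 \<le> diameter (U n) powr u + e * (1 / 2) ^ Suc n" using e'[of n] by (intro add_nonneg_nonneg) auto
    then show ?thesis using exponent_pos unfolding d_def by (simp add: powr_powr)
  qed
  have d: "diameter (U n) < d n" "0 < d n" for n
  proof -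
    have *: "diameter (U n) = (diameter (U n) powr u) powr (1 / u)"
      using exponent_pos diameter_ge_0[OF U(2)] by (simp add: powr_powr)
    also have "\<dots> < d n"
      unfolding d_def using exponent_pos e'[of n] by (intro powr_less_mono2) auto
    finally show "diameter (U n) < d n" .
    then show "0 < d n" using diameter_ge_0[OF U(2), of n] by linarith
  qed
  define x where "x n = (SOME y. y \<in> U n)" for n
  have ball: "U n \<subseteq> ball (x n) (d n)" for n
  proof
    fix y assume y: "y \<in> U n"
    then have "x n \<in> U n" unfolding x_def by (rule someI)
    from diameter_bounded_bound[OF U(2) this y] d(1)[of n] show "y \<in> ball (x n) (d n)" by simp
  qed
  have "(\<Union>n. U n) \<subseteq> (\<Union>n\<in>UNIV. ball (x n) (d n))" by (rule UN_mono[OF order_refl ball])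
  with K_subset_attractor U(1) have "K \<subseteq> (\<Union>n\<in>UNIV. ball (x n) (d n))" by (meson order_trans)
  then obtain S where S: "finite S" "K \<subseteq> (\<Union>n\<in>S. ball (x n) (d n))"
    using compactE_image[OF compact_K, of UNIV "\<lambda>n. ball (x n) (d n)"] by auto
  have "(\<delta> / 2) powr u \<le> (\<Sum>j\<in>S. d j powr u)"
    by (rule finite_cover_mass[OF S(1) d(2) S(2)])
  also have "\<dots> = (\<Sum>j\<in>S. diameter (U j) powr u) + (\<Sum>j\<in>S. e * (1 / 2) ^ Suc j)"
    by (simp add: d_pow sum.distrib)
  also have "(\<Sum>j\<in>S. e * (1 / 2) ^ Suc j) \<le> e"
  proof -
    have "(\<lambda>j. e * (1 / 2) ^ Suc j) sums (e * 1)"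
      by (rule sums_mult[OF power_half_series])
    then show ?thesis using sum_le_suminf[of "\<lambda>j. e * (1 / 2) ^ Suc j" S] S(1) e
      by (simp add: sums_iff)
  qed
  finally have *: "(\<delta> / 2) powr u \<le> (\<Sum>j\<in>S. diameter (U j) powr u) + e" by simp
  have part: "(\<Sum>j\<in>S. ennreal (diameter (U j) powr u)) \<le> (\<Sum>n. ennreal (diameter (U n) powr u))"
    by (rule sum_le_suminf) (use S(1) in auto)
  have "ennreal ((\<delta> / 2) powr u) \<le> ennreal ((\<Sum>j\<in>S. diameter (U j) powr u) + e)"
    using * by (rule ennreal_leI)
  also have "\<dots> = (\<Sum>j\<in>S. ennreal (diameter (U j) powr u)) + ennreal e"
    using e by (simp add: ennreal_plus sum_nonneg sum_ennreal)
  also have "\<dots> \<le> (\<Sum>n. ennreal (diameter (U n) powr u)) + ennreal e"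
    by (rule add_right_mono[OF part])
  finally show "ennreal ((\<delta> / 2) powr u) \<le> (\<Sum>n. ennreal (diameter (U n) powr u)) + ennreal e" .
qed

end

section \<open>Lower bounds for the dimensions of the attractor\<close>

text \<open>
  Disjoint images make gaps available in every finite subsystem, and the exact value of the
  series makes subsystems of all dimensions below \<open>h\<close> available.
\<close>

locale separated_affine_ifs = affine_ifs_dim +
  assumes ratio_sum: "((\<lambda>i. \<rho> i powr h) has_sum 1) I"
    and strictly_apart: "i \<in> I \<Longrightarrow> j \<in> I \<Longrightarrow> i \<noteq> j \<Longrightarrow> c i + \<rho> i < c j \<or> c j + \<rho> j < c i"
begin

text \<open>
  A finite part of the series that exceeds \<open>\<xi> powr (h - u) < 1\<close> becomes at least \<open>1\<close> when the
  exponent is lowered from \<open>h\<close> to \<open>u\<close>.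
\<close>

lemma finite_subsystem:
  assumes "u < h"
  obtains T where "finite T" "T \<subseteq> I" "1 \<le> (\<Sum>i\<in>T. \<rho> i powr u)"
proof -
  define q where "q = \<xi> powr (h - u)"
  have q: "0 < q" "q < 1"
    using bound_pos bound_less_1 assms powr_less_mono'[of \<xi> 0 "h - u"] by (simp_all add: q_def)
  have "\<forall>\<^sub>F T in finite_subsets_at_top I. q < (\<Sum>i\<in>T. \<rho> i powr h)"
    using ratio_sum q(2) unfolding has_sum_def by (rule order_tendstoD(1))
  then obtain T where T: "finite T" "T \<subseteq> I" "q < (\<Sum>i\<in>T. \<rho> i powr h)"
    unfolding eventually_finite_subsets_at_top by blast
  have "q * 1 < q * (\<Sum>i\<in>T. \<rho> i powr u)"
  proof -
    note T(3)
    also have "(\<Sum>i\<in>T. \<rho> i powr h) \<le> (\<Sum>i\<in>T. q * \<rho> i powr u)"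
    proof (rule sum_mono)
      fix i assume "i \<in> T"
      then have i: "i \<in> I" using T(2) by blast
      have "\<rho> i powr h = \<rho> i powr (h - u) * \<rho> i powr u" by (simp flip: powr_add)
      also have "\<dots> \<le> q * \<rho> i powr u"
        unfolding q_def
        using ratio_pos[OF i] ratio_le[OF i] assms by (intro mult_right_mono powr_mono2) auto
      finally show "\<rho> i powr h \<le> q * \<rho> i powr u" .
    qed
    finally show ?thesis by (simp add: sum_distrib_left)
  qed
  then have "1 \<le> (\<Sum>i\<in>T. \<rho> i powr u)" using q(1) by simp
  with T(1,2) that show ?thesis by blast
qed

lemma gap_subsystem_exists:
  assumes "0 < u" "u < h"
  shows "\<exists>T \<delta>. gap_subsystem I c \<rho> \<xi> T \<delta> u"
proof -
  obtain T where T: "finite T" "T \<subseteq> I" "1 \<le> (\<Sum>i\<in>T. \<rho> i powr u)"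
    by (rule finite_subsystem[OF assms(2)])
  define g where "g = (\<lambda>(i, j). max (c j - (c i + \<rho> i)) (c i - (c j + \<rho> j)))"
  define P where "P = {p \<in> T \<times> T. fst p \<noteq> snd p}"
  define \<delta> where "\<delta> = Min (insert 1 (g ` P))"
  have P: "finite P" using T(1) unfolding P_def by simp
  have "0 < g p" if "p \<in> P" for p
  proof -
    obtain i j where p: "p = (i, j)" by (cases p)
    with that have "i \<in> I" "j \<in> I" "i \<noteq> j" using T(2) unfolding P_def by auto
    from strictly_apart[OF this] show ?thesis unfolding p g_def by auto
  qed
  then have pos: "0 < \<delta>" unfolding \<delta>_def using P by (subst Min_gr_iff) auto
  have "c i + \<rho> i + \<delta> \<le> c j \<or> c j + \<rho> j + \<delta> \<le> c i" if "i \<in> T" "j \<in> T" "i \<noteq> j" for i j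
  proof -
    have "(i, j) \<in> P" using that unfolding P_def by simp
    then have "\<delta> \<le> g (i, j)" unfolding \<delta>_def using P by (intro Min_le) auto
    then show ?thesis unfolding g_def by auto
  qed
  then have "gap_subsystem I c \<rho> \<xi> T \<delta> u"
    using T assms(1) pos by unfold_locales
  then show ?thesis by (intro exI)
qed

lemma hausdorff_dim_attractor: "hausdorff_dim \<Lambda> = ereal h"
proof (rule antisym[OF hausdorff_dim_attractor_le hausdorff_dim_geI])
  fix u assume "0 \<le> u" "u < h"
  define v where "v = (u + h) / 2"
  have v: "0 < v" "u \<le> v" "v < h" using \<open>0 \<le> u\<close> \<open>u < h\<close> unfolding v_def by auto
  obtain T \<delta> where "gap_subsystem I c \<rho> \<xi> T \<delta> v" using gap_subsystem_exists[OF v(1,3)] by (elim exE)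
  then interpret G: gap_subsystem I c \<rho> \<xi> T \<delta> v .
  have "0 < (\<delta> / 2) powr v" using G.gap_pos by simp
  then show "hausdorff_measure u \<Lambda> \<noteq> 0"
    by (rule hausdorff_measure_neq_0I[OF v(1,2) _ G.countable_cover_mass])
qed

text \<open>
  The counterpart of \<open>log_cover_attractor_le\<close>: from scale \<open>y\<close> on, any separated set at scale
  \<open>y\<close> makes the covering exponent of \<open>\<Lambda>\<close> grow with slope almost \<open>h\<close>.
\<close>

lemma log_cover_attractor_ge:
  assumes "0 < u" "u < h"
  shows "\<exists>K y0. \<forall>Q y z. Q \<subseteq> \<Lambda> \<and> finite Q \<and> Q \<noteq> {} \<and> separated (2 powr - y) Q \<and> y0 \<le> y \<and> y \<le> z
    \<longrightarrow> log 2 (card Q) + u * (z - y) - K \<le> log_cover \<Lambda> (z + 1)"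
proof -
  obtain T \<delta> where "gap_subsystem I c \<rho> \<xi> T \<delta> u" using gap_subsystem_exists[OF assms] by (elim exE)
  then interpret G: gap_subsystem I c \<rho> \<xi> T \<delta> u .
  define m where "m = Min (\<rho> ` T)"
  have m: "0 < m" unfolding m_def using G.T(1) G.T_nonempty ratio_pos G.T_in_I by (subst Min_gr_iff) auto
  have "log 2 (card Q) + u * (z - y) - (- u * log 2 m) \<le> log_cover \<Lambda> (z + 1)"
    if Q: "Q \<subseteq> \<Lambda>" "finite Q" "Q \<noteq> {}" "separated (2 powr - y) Q" and yz: "- log 2 \<delta> \<le> y" "y \<le> z" for Q y z
  proof (rule log_cover_ge)
    have card: "0 < real (card Q)" using Q(2,3) by (simp add: card_gt_0_iff)
    have r: "2 powr - y \<le> \<delta>"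
    proof -
      have "2 powr - y \<le> 2 powr (log 2 \<delta>)" using yz(1) by (intro powr_mono) auto
      then show ?thesis using G.gap_pos by simp
    qed
    have half: "2 powr - z / 2 = 2 powr - (z + 1)"
      using powr_add[of 2 "- z" "- 1"] by (simp add: powr_minus)
    have "2 powr (log 2 (card Q) + u * (z - y) - (- u * log 2 m))
        = m powr u * (2 powr - y / 2 powr - z) powr u * real (card Q)"
    proof -
      have "2 powr - y / 2 powr - z = 2 powr (z - y)" by (simp flip: powr_diff)
      moreover have "2 powr (log 2 (card Q) + u * (z - y) - (- u * log 2 m))
          = 2 powr (log 2 (card Q)) * 2 powr (u * (z - y)) * 2 powr (u * log 2 m)"
        by (simp flip: powr_add)
      moreover have "2 powr (u * log 2 m) = m powr u" using m by (simp add: powr_powr[symmetric] mult.commute[of u])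
      ultimately show ?thesis using card by (simp add: powr_powr mult_ac)
    qed
    also have "\<dots> \<le> real (covering_number \<Lambda> (2 powr - z / 2))"
      unfolding m_def
      by (rule G.covering_number_attractor_ge[OF Q(1,2,4) _ r]) (use yz(2) in auto)
    finally show "2 powr (log 2 (card Q) + u * (z - y) - (- u * log 2 m))
        \<le> real (covering_number \<Lambda> (2 powr - (z + 1)))" unfolding half .
  qed
  then show ?thesis by (intro exI[of _ "- u * log 2 m"] exI[of _ "- log 2 \<delta>"] allI impI) simp
qed

lemma lower_box_dim_attractor_ge: "ereal h \<le> lower_box_dim \<Lambda>"
proof (rule lower_box_dim_geI[OF attractor_nonempty bounded_attractor])
  show "0 \<le> h" using h_pos by simp
  fix u assume u: "0 < u" "u < h"
  obtain K y0 where K: "\<forall>Q y z. Q \<subseteq> \<Lambda> \<and> finite Q \<and> Q \<noteq> {} \<and> separated (2 powr - y) Q \<and> y0 \<le> y \<and> y \<le> z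
    \<longrightarrow> log 2 (card Q) + u * (z - y) - K \<le> log_cover \<Lambda> (z + 1)"
    using log_cover_attractor_ge[OF u] by (elim exE)
  obtain a where a: "a \<in> \<Lambda>" using attractor_nonempty by blast
  have "\<forall>\<^sub>F n in sequentially. u * real n - (K + u * y0) \<le> log_cover \<Lambda> (real n + 1)"
    using eventually_ge_at_top[of "nat \<lceil>y0\<rceil>"]
  proof eventually_elim
    case (elim n)
    then have "y0 \<le> real n" by linarith
    then have "log 2 (card {a}) + u * (real n - y0) - K \<le> log_cover \<Lambda> (real n + 1)"
      using a by (intro K[rule_format]) (auto simp: separated_def)
    then show ?case by (simp add: algebra_simps)
  qed
  then show "\<exists>K. \<forall>\<^sub>F n in sequentially. u * real n - K \<le> log_cover \<Lambda> (real n + 1)" by (rule exI)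
qed

end

text \<open>
  Lebesgue measure: a set of diameter \<open>d\<close> lies in an interval of length \<open>2 * d\<close>.
\<close>

lemma hausdorff_dim_ge_1:
  fixes A :: "real set"
  assumes "{0<..1} \<subseteq> A"
  shows "ereal 1 \<le> hausdorff_dim A"
proof (rule hausdorff_dim_geI)
  fix u :: real assume u: "0 \<le> u" "u < 1"
  show "hausdorff_measure u A \<noteq> 0"
  proof (rule hausdorff_measure_neq_0I[of 1 u "1 / 2"])
    fix U assume U: "U \<in> countable_covers 1 A"
    then have b: "A \<subseteq> (\<Union>n. U n)" "\<And>n. bounded (U n)" unfolding countable_covers_def by auto
    define x where "x n = (SOME y. y \<in> U n)" for n
    have sub: "U n \<subseteq> {x n - diameter (U n)..x n + diameter (U n)}" for n
    proof
      fix y assume y: "y \<in> U n"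
      then have "x n \<in> U n" unfolding x_def by (rule someI)
      from diameter_bounded_bound[OF b(2) this y]
      show "y \<in> {x n - diameter (U n)..x n + diameter (U n)}" by (auto simp: dist_real_def)
    qed
    have "ennreal 1 = emeasure lborel {0<..1::real}" by simp
    also have "\<dots> \<le> emeasure lborel (\<Union>n. {x n - diameter (U n)..x n + diameter (U n)})"
    proof (rule emeasure_mono)
      have "(\<Union>n. U n) \<subseteq> (\<Union>n. {x n - diameter (U n)..x n + diameter (U n)})"
        by (rule UN_mono[OF order_refl sub])
      with assms b(1) show "{0<..1} \<subseteq> (\<Union>n. {x n - diameter (U n)..x n + diameter (U n)})"
        by (meson order_trans)
    qed auto
    also have "\<dots> \<le> (\<Sum>n. emeasure lborel {x n - diameter (U n)..x n + diameter (U n)})"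
      by (rule emeasure_subadditive_countably) auto
    also have "\<dots> = (\<Sum>n. ennreal 2 * ennreal (diameter (U n) powr 1))"
    proof (rule suminf_cong)
      fix n
      have d: "0 \<le> diameter (U n)" by (rule diameter_ge_0[OF b(2)])
      then have "emeasure lborel {x n - diameter (U n)..x n + diameter (U n)} = ennreal (2 * diameter (U n))"
        by simp
      also have "\<dots> = ennreal 2 * ennreal (diameter (U n))" using d by (intro ennreal_mult) auto
      finally show "emeasure lborel {x n - diameter (U n)..x n + diameter (U n)}
          = ennreal 2 * ennreal (diameter (U n) powr 1)" using d by simp
    qed
    also have "\<dots> = ennreal 2 * (\<Sum>n. ennreal (diameter (U n) powr 1))" by simp
    finally have "ennreal (1 / 2) * ennreal 1 \<le> ennreal (1 / 2) * (ennreal 2 * (\<Sum>n. ennreal (diameter (U n) powr 1)))"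
      by (rule mult_left_mono) simp
    also have "\<dots> = (\<Sum>n. ennreal (diameter (U n) powr 1))"
      by (simp only: mult.assoc[symmetric] ennreal_mult[symmetric]) simp
    finally show "ennreal (1 / 2) \<le> (\<Sum>n. ennreal (diameter (U n) powr 1))" by simp
  qed (use u in auto)
qed

lemma lower_box_dim_ge_1:
  fixes A :: "real set"
  assumes A: "{0<..1} \<subseteq> A" "bounded A"
  shows "ereal 1 \<le> lower_box_dim A"
proof (rule lower_box_dim_geI)
  have "(1::real) \<in> A" by (rule subsetD[OF A(1)]) simp
  then show "A \<noteq> {}" by blast
  show "bounded A" by (rule A(2))
  fix u :: real assume u: "0 < u" "u < 1"
  have "u * real n - 0 \<le> log_cover A (real n + 1)" for n
  proof -
    define r :: real where "r = 2 powr - (real n + 1)"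
    have r: "0 < r" "2 * r = 2 powr - real n"
      using powr_add[of 2 "- real n" "- 1"] by (simp_all add: r_def powr_minus)
    obtain C where C: "finite C" "A \<subseteq> (\<Union>x\<in>C. ball x r)" "card C = covering_number A r"
      by (rule covering_number_attained[OF A(2) r(1)])
    have "ennreal 1 = emeasure lborel {0<..1::real}" by simp
    also have "\<dots> \<le> emeasure lborel (\<Union>x\<in>C. ball x r)"
      by (rule emeasure_mono[OF order_trans[OF A(1) C(2)]]) (simp add: borel_open open_UN)
    also have "\<dots> \<le> (\<Sum>x\<in>C. emeasure lborel (ball x r))"
      by (rule emeasure_subadditive_finite[OF C(1)]) auto
    also have "\<dots> = (\<Sum>x\<in>C. ennreal (2 * r))"
      using r(1) by (intro sum.cong) (simp_all add: ball_eq_greaterThanLessThan)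
    also have "\<dots> = ennreal (\<Sum>x\<in>C. 2 * r)" using r(1) by (intro sum_ennreal) simp
    also have "(\<Sum>x\<in>C. 2 * r) = real (card C) * 2 powr - real n" using r(2) by simp
    finally have "1 \<le> real (card C) * 2 powr - real n" by (subst (asm) ennreal_le_iff) simp_all
    then have "2 powr real n \<le> real (card C)" by (simp add: powr_minus field_simps)
    then have "real n \<le> log_cover A (real n + 1)"
      using C(3) unfolding r_def by (intro log_cover_ge) simp
    moreover have "u * real n \<le> 1 * real n" using u by (intro mult_right_mono) auto
    ultimately show ?thesis by simp
  qed
  then show "\<exists>K. \<forall>\<^sub>F n in sequentially. u * real n - K \<le> log_cover A (real n + 1)"
    by (intro exI[of _ 0]) simp
qed simp

section \<open>Fixed point sets with prescribed box dimensions\<close>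

lemma log_linear_le:
  assumes "0 < C" "0 < \<delta>"
  shows "\<exists>L. \<forall>z\<ge>0. log 2 (C * (z + 1)) \<le> \<delta> * z + L"
proof -
  \<comment> \<open>The constant for which \<open>ln (e * (z + 1)) \<le> e * (z + 1)\<close> becomes a line of slope \<open>\<delta>\<close> for the binary logarithm.\<close>
  define e where "e = \<delta> * ln 2"
  have e: "0 < e" using assms(2) by (simp add: e_def)
  have "log 2 (C * (z + 1)) \<le> \<delta> * z + (\<delta> - log 2 e + log 2 C)" if "0 \<le> z" for z
  proof -
    have "ln (e * (z + 1)) \<le> e * (z + 1) - 1" using e that by (intro ln_le_minus_one) simp
    then have "ln (e * (z + 1)) / ln 2 \<le> (e * (z + 1)) / ln 2" by (intro divide_right_mono) auto
    then have "log 2 (e * (z + 1)) \<le> \<delta> * (z + 1)" by (simp add: log_def e_def)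
    moreover have "log 2 (e * (z + 1)) = log 2 e + log 2 (z + 1)"
      "log 2 (C * (z + 1)) = log 2 C + log 2 (z + 1)"
      using e assms(1) that by (simp_all add: log_mult)
    ultimately show ?thesis by (simp add: distrib_left)
  qed
  then show ?thesis by blast
qed

text \<open>
  Block \<open>a\<close> consists of \<open>2 ^ (b a - a)\<close> tiles of length \<open>2 powr - b a\<close>. Its relative height
  \<open>(b a - a) / b a\<close> is about \<open>\<tau> a\<close>, which is close to \<open>t\<close> on the range of \<open>\<alpha>\<close> and close to \<open>s\<close>
  elsewhere. The factor \<open>a / (a + 1)\<close> keeps \<open>\<tau> a\<close> below \<open>1\<close> even if \<open>s\<close> or \<open>t\<close> equals \<open>1\<close>.
  Indices start at \<open>2\<close>, so that \<open>[1/2, 1]\<close> remains free for other maps.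
\<close>

locale profile =
  fixes s t :: real and \<alpha> :: "nat \<Rightarrow> nat"
  assumes s_nonneg: "0 \<le> s" and s_le_t: "s \<le> t" and t_le_1: "t \<le> 1"
    and strict_mono_\<alpha>: "strict_mono \<alpha>" and \<alpha>_ge_2: "2 \<le> \<alpha> 0"
begin

definition \<tau> :: "nat \<Rightarrow> real" where
  "\<tau> a = (if a \<in> range \<alpha> then t else s) * (real a / (real a + 1))"

definition b :: "nat \<Rightarrow> nat" where
  "b a = nat \<lfloor>real a / (1 - \<tau> a)\<rfloor>"

lemma \<alpha>_ge: "2 \<le> \<alpha> n" "n \<le> \<alpha> n"
proof -
  have "\<alpha> 0 \<le> \<alpha> n" using strict_mono_\<alpha> by (simp add: strict_mono_less_eq)
  then show "2 \<le> \<alpha> n" using \<alpha>_ge_2 by simp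
  show "n \<le> \<alpha> n" using strict_mono_\<alpha> by (rule strict_mono_imp_increasing)
qed

lemma frac_bounds: "0 \<le> real a / (real a + 1)" "real a / (real a + 1) < 1"
  by (simp_all add: divide_simps)

lemma \<tau>_nonneg: "0 \<le> \<tau> a"
  unfolding \<tau>_def using s_nonneg s_le_t frac_bounds(1)[of a] by (intro mult_nonneg_nonneg) auto

lemma \<tau>_less_1: "\<tau> a < 1"
proof -
  have "\<tau> a \<le> 1 * (real a / (real a + 1))"
    unfolding \<tau>_def using s_le_t t_le_1 frac_bounds(1)[of a] by (intro mult_right_mono) auto
  then show ?thesis using frac_bounds(2)[of a] by linarith
qed

lemma \<tau>_le_t: "\<tau> a \<le> t"
proof -
  have "\<tau> a \<le> t * 1"
    unfolding \<tau>_def using s_nonneg s_le_t frac_bounds[of a] by (intro mult_mono) auto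
  then show ?thesis by simp
qed

lemma \<tau>_le_s: "a \<notin> range \<alpha> \<Longrightarrow> \<tau> a \<le> s"
  unfolding \<tau>_def using s_nonneg frac_bounds[of a] mult_left_mono[of "real a / (real a + 1)" 1 s] by simp

lemma \<tau>_ge_s: "s * (real a / (real a + 1)) \<le> \<tau> a"
  unfolding \<tau>_def using s_le_t frac_bounds(1)[of a] by (intro mult_right_mono) auto

lemma \<tau>_special: "\<tau> (\<alpha> n) = t * (real (\<alpha> n) / (real (\<alpha> n) + 1))"
  by (simp add: \<tau>_def)

lemma frac_ge:
  assumes "u < v" "u / (v - u) \<le> real a"
  shows "u \<le> v * (real a / (real a + 1))"
proof -
  have "u \<le> real a * (v - u)" using assms by (simp add: pos_divide_le_eq)
  then have "u * (real a + 1) \<le> v * real a" by (simp add: algebra_simps)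
  then show ?thesis by (simp add: pos_le_divide_eq)
qed

lemma b_bounds:
  "real (b a) * (1 - \<tau> a) \<le> real a" "real a < (real (b a) + 1) * (1 - \<tau> a)" "a \<le> b a"
proof -
  define q where "q = real a / (1 - \<tau> a)"
  have p: "0 < 1 - \<tau> a" using \<tau>_less_1[of a] by simp
  have q: "0 \<le> q" using p unfolding q_def by simp
  have bq: "real (b a) \<le> q" "q < real (b a) + 1"
    using q unfolding b_def q_def[symmetric] by linarith+
  show "real (b a) * (1 - \<tau> a) \<le> real a" using bq(1) p unfolding q_def by (simp add: pos_le_divide_eq)
  show "real a < (real (b a) + 1) * (1 - \<tau> a)" using bq(2) p unfolding q_def by (simp add: pos_divide_less_eq)
  have "real a * (1 - \<tau> a) \<le> real a * 1" using \<tau>_nonneg[of a] by (intro mult_left_mono) auto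
  then have "real a \<le> q" using p unfolding q_def by (simp add: pos_le_divide_eq)
  then show "a \<le> b a" unfolding b_def q_def[symmetric] by linarith
qed

lemma excess_le:
  shows "min (real (b a)) z - real a \<le> \<tau> a * min (real (b a)) z"
proof -
  have "min (real (b a)) z * (1 - \<tau> a) \<le> real (b a) * (1 - \<tau> a)"
    using \<tau>_less_1[of a] by (intro mult_right_mono) auto
  also note b_bounds(1)[of a]
  finally show ?thesis by (simp add: algebra_simps)
qed

lemma excess_le_t:
  assumes "0 \<le> z"
  shows "min (real (b a)) z - real a \<le> t * min (real (b a)) z"
  using excess_le[of a z] mult_right_mono[OF \<tau>_le_t[of a], of "min (real (b a)) z"] assms by simp

lemma b_special_mono:
  assumes "m \<le> n"
  shows "b (\<alpha> m) \<le> b (\<alpha> n)"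
proof -
  have a: "real (\<alpha> m) \<le> real (\<alpha> n)" using strict_mono_\<alpha> assms by (simp add: strict_mono_less_eq)
  then have "real (\<alpha> m) / (real (\<alpha> m) + 1) \<le> real (\<alpha> n) / (real (\<alpha> n) + 1)"
    by (simp add: divide_simps) (simp add: algebra_simps)
  then have "\<tau> (\<alpha> m) \<le> \<tau> (\<alpha> n)"
    unfolding \<tau>_special using s_nonneg s_le_t by (intro mult_left_mono) auto
  then have "real (\<alpha> m) / (1 - \<tau> (\<alpha> m)) \<le> real (\<alpha> n) / (1 - \<tau> (\<alpha> n))"
    using a \<tau>_less_1[of "\<alpha> n"] by (intro frac_le) auto
  then show ?thesis unfolding b_def by (intro nat_mono floor_mono)
qed

text \<open>
  The quantity on the left is the contribution of block \<open>a\<close> to the covering exponent. Ordinary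
  blocks stay below \<open>s * z\<close>; special blocks up to number \<open>n\<close> stay below slope \<open>t\<close> and no
  longer grow after \<open>b (\<alpha> n)\<close>; later special blocks start at \<open>\<alpha> (Suc n)\<close> or after it and have
  slope \<open>1\<close>.
\<close>

lemma trough:
  assumes "0 \<le> z"
  shows "min (real (b a)) z - real a
    \<le> max (s * z) (max (t * min z (real (b (\<alpha> n)))) (z - real (\<alpha> (Suc n))))"
proof (cases "a \<in> range \<alpha>")
  case False
  have "min (real (b a)) z - real a \<le> \<tau> a * min (real (b a)) z" by (rule excess_le)
  also have "\<dots> \<le> s * z" using \<tau>_le_s[OF False] assms s_nonneg by (intro mult_mono) auto
  finally show ?thesis by simp
next
  case True
  then obtain k where k: "a = \<alpha> k" by blast
  show ?thesis
  proof (cases "k \<le> n")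
    case True
    have "min (real (b a)) z - real a \<le> t * min (real (b a)) z" by (rule excess_le_t[OF assms])
    also have "\<dots> \<le> t * min z (real (b (\<alpha> n)))"
      using b_special_mono[OF True] s_nonneg s_le_t unfolding k by (intro mult_left_mono) auto
    finally show ?thesis by simp
  next
    case False
    then have "\<alpha> (Suc n) \<le> a" unfolding k using strict_mono_\<alpha> by (simp add: strict_mono_less_eq)
    then show ?thesis by simp
  qed
qed

end

text \<open>
  One point in each tile, and finitely many further points \<open>B\<close>. The counting depends only on
  the tiles that contain the points.
\<close>

locale transversal = profile +
  fixes A B :: "real set" and x :: "nat \<Rightarrow> nat \<Rightarrow> real"
  assumes A_eq: "A = {x a j |a j. 2 \<le> a \<and> j < 2 ^ (b a - a)} \<union> B"
    and finite_B: "finite B"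
    and A_unit: "A \<subseteq> {0..1}"
    and x_in_tile: "2 \<le> a \<Longrightarrow> j < 2 ^ (b a - a) \<Longrightarrow> x a j \<in>
      {2 powr - real a + real j * 2 powr - real (b a)..2 powr - real a + (real j + 1) * 2 powr - real (b a)}"
begin

lemma bounded_A: "bounded A"
  by (rule bounded_subset[OF _ A_unit]) simp

lemma A_nonempty: "A \<noteq> {}"
proof -
  have "x 2 0 \<in> A" unfolding A_eq by (intro UnI1 CollectI exI[of _ 2] exI[of _ 0]) simp
  then show ?thesis by blast
qed

lemma tile_subset:
  assumes "2 \<le> a" "j < 2 ^ (b a - a)"
  shows "x a j \<in> {2 powr - real a..2 powr - real a + 2 powr - real a}"
proof -
  have "real (j + 1) \<le> real (2 ^ (b a - a))" using assms(2) by (subst of_nat_le_iff) simp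
  then have "(real j + 1) * 2 powr - real (b a) \<le> 2 ^ (b a - a) * 2 powr - real (b a)"
    by (intro mult_right_mono) auto
  also have "\<dots> = 2 powr - real a"
    using b_bounds(3)[of a] by (simp add: powr_realpow[symmetric] powr_add[symmetric] of_nat_diff)
  finally have "(real j + 1) * 2 powr - real (b a) \<le> 2 powr - real a" .
  moreover have "0 \<le> real j * 2 powr - real (b a)" by simp
  ultimately show ?thesis using x_in_tile[OF assms] unfolding atLeastAtMost_iff by linarith
qed

text \<open>
  At scale \<open>2 powr - z\<close> the blocks with \<open>z \<le> a\<close> lie together in an interval of twice this
  length. There are at most \<open>z\<close> other blocks, and each of them needs about
  \<open>2 powr (min (b a) z - a)\<close> balls: one for each point if \<open>b a \<le> z\<close>, and as many as the
  interval spanned by the block otherwise. The polynomial factor \<open>z + 1\<close> is harmless.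
\<close>

lemma log_cover_upper:
  assumes z: "0 \<le> z" and E: "0 \<le> E" "\<And>a. 2 \<le> a \<Longrightarrow> real a < z \<Longrightarrow> min (real (b a)) z - real a \<le> E"
  shows "log_cover A z \<le> E + log 2 ((real (card B) + 5) * (z + 1))"
proof -
  define r where "r = 2 powr - z"
  have r: "0 < r" unfolding r_def by simp
  define G where "G a = {x a j |j. j < 2 ^ (b a - a)}" for a
  define S where "S = {a. 2 \<le> a \<and> real a < z}"
  define R where "R = {x a j |a j. 2 \<le> a \<and> z \<le> real a \<and> j < 2 ^ (b a - a)}"
  have S_sub: "S \<subseteq> {2..<nat \<lceil>z\<rceil>}" unfolding S_def by (auto, linarith)
  have S: "finite S" by (rule finite_subset[OF S_sub]) simp
  have "card S \<le> nat \<lceil>z\<rceil> - 2" using card_mono[OF _ S_sub] by simp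
  then have card_S: "real (card S) \<le> z" using z by linarith
  have A_split: "A = (\<Union>a\<in>S. G a) \<union> (R \<union> B)"
    unfolding A_eq G_def S_def R_def by (auto simp: not_less) (metis not_less)
  have sub: "G a \<subseteq> A" if "a \<in> S" for a using that unfolding A_split by blast
  have block: "real (covering_number (G a) r) \<le> 2 * 2 powr E" if a: "a \<in> S" for a
  proof (cases "real (b a) \<le> z")
    case True
    have G: "G a = x a ` {..<2 ^ (b a - a)}" unfolding G_def by auto
    have "covering_number (G a) r \<le> card (G a)"
      by (rule covering_number_finite_le_card[OF _ r]) (simp add: G)
    also have "\<dots> \<le> 2 ^ (b a - a)" unfolding G using card_image_le[of "{..<2 ^ (b a - a)}" "x a"] by simp
    finally have "real (covering_number (G a) r) \<le> real (2 ^ (b a - a))" by (rule of_nat_mono)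
    also have "\<dots> = 2 powr (real (b a) - real a)"
      using b_bounds(3)[of a] by (simp add: powr_realpow[symmetric] of_nat_diff)
    also have "\<dots> \<le> 2 powr E"
      using E(2)[of a] a True unfolding S_def by (intro powr_mono) auto
    also have "\<dots> \<le> 2 * 2 powr E" by simp
    finally show ?thesis .
  next
    case False
    have "G a \<subseteq> {2 powr - real a..2 powr - real a + 2 powr - real a}"
    proof
      fix y assume "y \<in> G a"
      then obtain j where "j < 2 ^ (b a - a)" "y = x a j" unfolding G_def by blast
      then show "y \<in> {2 powr - real a..2 powr - real a + 2 powr - real a}"
        using tile_subset a unfolding S_def by simp
    qed
    then have "real (covering_number (G a) r) \<le> 2 powr - real a / r + 1"
      by (rule covering_number_interval[OF _ r]) simp
    also have "2 powr - real a / r = 2 powr (z - real a)" unfolding r_def by (simp flip: powr_diff)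
    also have "\<dots> \<le> 2 powr E"
      using E(2)[of a] a False unfolding S_def by (intro powr_mono) auto
    also have "1 \<le> 2 powr E" using E(1) by (intro ge_one_powr_ge_zero) auto
    finally show ?thesis by simp
  qed
  have rest: "real (covering_number R r) \<le> 3"
  proof -
    have "R \<subseteq> {0..0 + 2 * r}"
    proof
      fix y assume "y \<in> R"
      then obtain a j where aj: "2 \<le> a" "z \<le> real a" "j < 2 ^ (b a - a)" "y = x a j" unfolding R_def by blast
      have "2 powr - real a \<le> r" unfolding r_def using aj(2) by (intro powr_mono) auto
      moreover have "0 < 2 powr - real a" by simp
      ultimately show "y \<in> {0..0 + 2 * r}" using tile_subset[OF aj(1,3)] unfolding aj(4) atLeastAtMost_iff by linarith
    qed
    then have "real (covering_number R r) \<le> 2 * r / r + 1"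
      by (rule covering_number_interval[OF _ r]) (use r in simp)
    then show ?thesis using r by simp
  qed
  have bounded: "bounded (\<Union>a\<in>S. G a)" "bounded R" "bounded B" "\<And>a. a \<in> S \<Longrightarrow> bounded (G a)"
    using bounded_subset[OF bounded_A] sub unfolding A_split by blast+
  have "covering_number A r \<le> covering_number (\<Union>a\<in>S. G a) r + (covering_number R r + covering_number B r)"
    unfolding A_split
    by (intro order_trans[OF covering_number_Un] add_left_mono covering_number_Un bounded bounded_Un[THEN iffD2] conjI r)
  also have "\<dots> \<le> (\<Sum>a\<in>S. covering_number (G a) r) + (covering_number R r + card B)"
    by (intro add_mono covering_number_UN[OF S bounded(4) r] covering_number_finite_le_card[OF finite_B r] order_refl)
  finally have "real (covering_number A r) \<le> real ((\<Sum>a\<in>S. covering_number (G a) r) + (covering_number R r + card B))"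
    by (rule of_nat_mono)
  also have "\<dots> = (\<Sum>a\<in>S. real (covering_number (G a) r)) + real (covering_number R r) + real (card B)" by simp
  also have "\<dots> \<le> (\<Sum>a\<in>S. 2 * 2 powr E) + 3 + real (card B)"
    using block rest by (intro add_right_mono add_mono sum_mono) auto
  also have "\<dots> \<le> z * (2 * 2 powr E) + (3 + real (card B)) * 1"
    using card_S by (simp add: mult_right_mono)
  also have "\<dots> \<le> z * (2 * 2 powr E) + (3 + real (card B)) * 2 powr E"
    using E(1) by (intro add_left_mono mult_left_mono ge_one_powr_ge_zero) auto
  also have "\<dots> \<le> (real (card B) + 5) * (z + 1) * 2 powr E"
  proof -
    have "z * 2 + (3 + real (card B)) \<le> (real (card B) + 5) * (z + 1)"
      using z by (simp add: algebra_simps)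
    from mult_right_mono[OF this, of "2 powr E"] show ?thesis by (simp add: algebra_simps)
  qed
  also have "\<dots> = 2 powr (E + log 2 ((real (card B) + 5) * (z + 1)))"
    using z by (simp add: powr_add)
  finally show ?thesis unfolding r_def by (rule log_cover_le[OF A_nonempty bounded_A])
qed

lemma log_cover_upper_linear:
  assumes "0 < \<delta>"
  shows "\<exists>L. \<forall>z\<ge>0. \<forall>E\<ge>0. (\<forall>a\<ge>2. real a < z \<longrightarrow> min (real (b a)) z - real a \<le> E) \<longrightarrow> log_cover A z \<le> E + \<delta> * z + L"
proof -
  have pos: "0 < real (card B) + 5" by simp
  obtain L where L: "\<forall>z\<ge>0. log 2 ((real (card B) + 5) * (z + 1)) \<le> \<delta> * z + L"
    using log_linear_le[OF pos assms] by (elim exE)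
  show ?thesis
  proof (intro exI[of _ L] allI impI)
    fix z E :: real
    assume "0 \<le> z" "0 \<le> E" "\<forall>a\<ge>2. real a < z \<longrightarrow> min (real (b a)) z - real a \<le> E"
    then show "log_cover A z \<le> E + \<delta> * z + L" using log_cover_upper[of z E] L[rule_format, of z] by force
  qed
qed

text \<open>
  The points of a block may be arbitrarily close to each other across the border of two tiles.
  Taking only every \<open>k\<close>-th tile, for \<open>k = 2 ^ (b a - n + 1)\<close>, leaves at least
  \<open>k - 1 \<ge> 2 ^ (b a - n)\<close> tiles between chosen points.
\<close>

lemma separated_subset:
  assumes a: "2 \<le> a" "a < n" "n \<le> b a"
  shows "\<exists>Q\<subseteq>A. finite Q \<and> separated (2 powr - real n) Q \<and> card Q = 2 ^ (n - a - 1)"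
proof -
  define k :: nat where "k = 2 ^ (b a - n + 1)"
  define N :: nat where "N = 2 ^ (n - a - 1)"
  have Nk: "N * k = 2 ^ (b a - a)" unfolding N_def k_def using a by (simp flip: power_add power_Suc)
  have idx: "i * k < 2 ^ (b a - a)" if "i < N" for i
    unfolding Nk[symmetric] using that by (simp add: k_def)
  define w where "w = 2 powr - real (b a)"
  have w: "0 < w" unfolding w_def by simp
  have far: "x a (i * k) + 2 powr - real n \<le> x a (j * k)" if ij: "i < j" "j < N" for i j
  proof -
    have "x a (i * k) \<le> 2 powr - real a + (real (i * k) + 1) * w"
      using x_in_tile[OF a(1) idx[of i]] ij unfolding w_def by simp
    moreover have "2 powr - real a + real (j * k) * w \<le> x a (j * k)"
      using x_in_tile[OF a(1) idx[OF ij(2)]] unfolding w_def by simp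
    moreover have "2 powr - real n = real (2 ^ (b a - n)) * w"
      unfolding w_def using a(3) by (simp add: powr_realpow[symmetric] powr_add[symmetric] of_nat_diff)
    moreover have "(real (i * k) + 1 + real (2 ^ (b a - n))) * w \<le> real (j * k) * w"
    proof (rule mult_right_mono)
      have "i * k + k \<le> j * k" using ij(1) mult_le_mono1[of "Suc i" j k] by simp
      moreover have "1 + 2 ^ (b a - n) \<le> k" unfolding k_def by simp
      ultimately have "i * k + 1 + 2 ^ (b a - n) \<le> j * k" by linarith
      then show "real (i * k) + 1 + real (2 ^ (b a - n)) \<le> real (j * k)" by linarith
    qed (use w in simp)
    ultimately show ?thesis by (simp add: distrib_right)
  qed
  define Q where "Q = (\<lambda>i. x a (i * k)) ` {..<N}"
  have pos: "0 < 2 powr - real n" by simp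
  have inj: "inj_on (\<lambda>i. x a (i * k)) {..<N}"
  proof (rule inj_onI, rule ccontr)
    fix i j assume "i \<in> {..<N}" "j \<in> {..<N}" "x a (i * k) = x a (j * k)" "i \<noteq> j"
    then show False using far[of i j] far[of j i] pos by (cases "i < j") auto
  qed
  have "Q \<subseteq> A" unfolding Q_def A_eq using a(1) idx by blast
  moreover have "separated (2 powr - real n) Q"
    unfolding separated_def
  proof (intro ballI impI)
    fix p q assume "p \<in> Q" "q \<in> Q" "p \<noteq> q"
    then obtain i j where ij: "i < N" "j < N" "p = x a (i * k)" "q = x a (j * k)" "i \<noteq> j"
      unfolding Q_def by auto
    then show "2 powr - real n \<le> \<bar>p - q\<bar>"
      using far[of i j] far[of j i] by (cases "i < j") auto
  qed
  moreover have "card Q = 2 ^ (n - a - 1)" unfolding Q_def card_image[OF inj] by (simp add: N_def)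
  moreover have "finite Q" unfolding Q_def by simp
  ultimately show ?thesis by (intro exI conjI)
qed

lemma log_cover_lower:
  assumes a: "2 \<le> a" "a < n" "n \<le> b a"
  shows "real n - real a - 1 \<le> log_cover A (real n + 1)"
proof (rule log_cover_ge)
  obtain Q where Q: "Q \<subseteq> A" "separated (2 powr - real n) Q" "card Q = 2 ^ (n - a - 1)"
    using separated_subset[OF a] by (elim exE conjE)
  have "real n - real a - 1 = real (n - a - 1)" using a(2) by linarith
  then have "2 powr (real n - real a - 1) = 2 powr real (n - a - 1)" by (rule arg_cong)
  also have "\<dots> = real (card Q)" using Q(3) by (simp add: powr_realpow)
  also have "\<dots> \<le> real (covering_number A (2 powr - (real n + 1)))"
    using card_separated_le_covering_number(2)[OF Q(2,1) bounded_A, of "2 powr - (real n + 1)"]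
      powr_add[of 2 "- real n" "- 1"] by (simp add: powr_minus)
  finally show "2 powr (real n - real a - 1) \<le> real (covering_number A (2 powr - (real n + 1)))" .
qed

lemma log_cover_le_t:
  assumes "t < u"
  shows "\<exists>L. \<forall>z\<ge>0. log_cover A z \<le> L + u * z"
proof -
  obtain L where L: "\<forall>z\<ge>0. \<forall>E\<ge>0. (\<forall>a\<ge>2. real a < z \<longrightarrow> min (real (b a)) z - real a \<le> E) \<longrightarrow> log_cover A z \<le> E + (u - t) * z + L"
    using log_cover_upper_linear[of "u - t"] assms by auto
  have "log_cover A z \<le> L + u * z" if z: "0 \<le> z" for z
  proof -
    have "min (real (b a)) z - real a \<le> t * z" for a
    proof -
      have "t * min (real (b a)) z \<le> t * z" using s_nonneg s_le_t by (intro mult_left_mono) auto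
      with excess_le_t[OF z, of a] show ?thesis by linarith
    qed
    moreover have "0 \<le> t * z" using s_nonneg s_le_t z by simp
    ultimately have "log_cover A z \<le> t * z + (u - t) * z + L" using L z by blast
    then show ?thesis by (simp add: algebra_simps)
  qed
  then show ?thesis by blast
qed

lemma upper_box_dim_le_t: "upper_box_dim A \<le> ereal t"
proof (rule upper_box_dim_leI)
  fix \<epsilon> :: real assume \<epsilon>: "0 < \<epsilon>"
  then obtain L where L: "\<forall>z\<ge>0. log_cover A z \<le> L + (t + \<epsilon> / 2) * z"
    using log_cover_le_t[of "t + \<epsilon> / 2"] by auto
  have "\<forall>\<^sub>F z in at_top. L + (t + \<epsilon> / 2) * z \<le> (t + \<epsilon>) * z" using \<epsilon> by real_asymp
  then show "\<forall>\<^sub>F z in at_top. log_cover A z \<le> (t + \<epsilon>) * z"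
    using eventually_ge_at_top[of 0]
  proof eventually_elim
    case (elim z)
    with L show ?case by fastforce
  qed
qed

text \<open>
  The height of the peak of a special block, up to the rounding in \<open>b\<close>.
\<close>

lemma special_excess:
  assumes "0 \<le> u" "u < t" "u / (t - u) \<le> real (\<alpha> k)"
  shows "u * real (b (\<alpha> k)) - 1 \<le> real (b (\<alpha> k)) - real (\<alpha> k)"
proof -
  define y where "y = real (b (\<alpha> k))"
  have u: "u \<le> \<tau> (\<alpha> k)" unfolding \<tau>_special by (rule frac_ge[OF assms(2,3)])
  have "real (\<alpha> k) < (y + 1) * (1 - \<tau> (\<alpha> k))" unfolding y_def by (rule b_bounds(2))
  also have "\<dots> \<le> (y + 1) * (1 - u)" using u unfolding y_def by (intro mult_left_mono) auto
  finally have "real (\<alpha> k) < (y + 1) * (1 - u)" .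
  then have "u * y - 1 \<le> y - real (\<alpha> k)" using assms(1) by (simp add: algebra_simps)
  then show ?thesis unfolding y_def .
qed

lemma b_special_ge: "k \<le> b (\<alpha> k)"
  using \<alpha>_ge(2)[of k] b_bounds(3)[of "\<alpha> k"] by simp

lemma upper_box_dim_A: "upper_box_dim A = ereal t"
proof (rule antisym[OF upper_box_dim_le_t upper_box_dim_geI[OF A_nonempty bounded_A]])
  show "0 \<le> t" using s_nonneg s_le_t by simp
  fix u assume u: "0 < u" "u < t"
  have "\<exists>n\<ge>N. u * real n - 2 \<le> log_cover A (real n + 1)" for N
  proof -
    \<comment> \<open>The first bound makes \<open>\<tau> (\<alpha> k)\<close> at least \<open>u\<close>; the second makes the block non-trivial.\<close>
    define k where "k = max N (max (nat \<lceil>u / (t - u)\<rceil>) (nat \<lceil>1 / u\<rceil> + 1))"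
    define n where "n = b (\<alpha> k)"
    have k: "N \<le> k" "u / (t - u) \<le> real k" "1 / u < real k" unfolding k_def by linarith+
    have "u / (t - u) \<le> real (\<alpha> k)" using k(2) \<alpha>_ge(2)[of k] by linarith
    then have ex: "u * real n - 1 \<le> real n - real (\<alpha> k)"
      unfolding n_def using u by (intro special_excess) auto
    have kn: "k \<le> n" unfolding n_def by (rule b_special_ge)
    then have "1 / u < real n" using k(3) by linarith
    then have "1 < u * real n" using u(1) by (simp add: divide_less_eq mult.commute)
    then have "\<alpha> k < n" using ex by linarith
    then have "real n - real (\<alpha> k) - 1 \<le> log_cover A (real n + 1)"
      by (rule log_cover_lower[OF \<alpha>_ge(1)]) (simp add: n_def)
    with ex have "u * real n - 2 \<le> log_cover A (real n + 1)" by linarith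
    with k(1) kn show ?thesis by (intro exI[of _ n]) simp
  qed
  then show "\<exists>K. \<forall>N. \<exists>n\<ge>N. u * real n - K \<le> log_cover A (real n + 1)" by blast
qed

text \<open>
  For given \<open>n\<close> the block \<open>a\<close> just above \<open>(1 - u) * n\<close> is still growing at \<open>n\<close> and has height
  \<open>n - a\<close>, about \<open>u * n\<close>.
\<close>

lemma lower_box_dim_ge_s: "ereal s \<le> lower_box_dim A"
proof (rule lower_box_dim_geI[OF A_nonempty bounded_A s_nonneg])
  fix u assume u: "0 < u" "u < s"
  then have u1: "u < 1" using s_le_t t_le_1 by simp
  have "u * real n - 2 \<le> log_cover A (real n + 1)"
    if n: "n \<ge> nat \<lceil>max (2 / u) (max (2 / (1 - u)) (u / (s - u) / (1 - u)))\<rceil>" for n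
  proof -
    have "2 / u \<le> real n" "2 / (1 - u) \<le> real n" "u / (s - u) / (1 - u) \<le> real n"
      using n by linarith+
    then have "2 \<le> real n * u" "2 \<le> real n * (1 - u)" "u / (s - u) \<le> real n * (1 - u)"
      using u(1) u1 by (simp_all only: pos_divide_le_eq diff_gt_0_iff_gt)
    then have n': "2 \<le> u * real n" "2 \<le> (1 - u) * real n" "u / (s - u) \<le> (1 - u) * real n"
      by (simp_all only: mult.commute)
    define a where "a = nat \<lceil>(1 - u) * real n\<rceil>"
    have a: "(1 - u) * real n \<le> real a" "real a < (1 - u) * real n + 1"
      using n'(2) unfolding a_def by linarith+
    have a2: "2 \<le> a" using a(1) n'(2) by linarith
    have "real a < real n" using a(2) n'(1) by (simp add: algebra_simps)
    then have an: "a < n" by simp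
    have "u / (s - u) \<le> real a" using a(1) n'(3) by linarith
    from order_trans[OF frac_ge[OF u(2) this] \<tau>_ge_s] have "u \<le> \<tau> a" .
    then have "(1 - \<tau> a) * real n \<le> (1 - u) * real n" by (intro mult_right_mono) auto
    with a(1) have "real n * (1 - \<tau> a) \<le> real a" by (simp add: mult.commute)
    then have "real n \<le> real a / (1 - \<tau> a)" using \<tau>_less_1[of a] by (simp add: pos_le_divide_eq)
    then have "n \<le> b a" unfolding b_def by linarith
    from log_cover_lower[OF a2 an this] a(2) show ?thesis by (simp add: algebra_simps)
  qed
  then have "\<forall>\<^sub>F n in sequentially. u * real n - 2 \<le> log_cover A (real n + 1)"
    unfolding eventually_sequentially by blast
  then show "\<exists>K. \<forall>\<^sub>F n in sequentially. u * real n - K \<le> log_cover A (real n + 1)" by (rule exI)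
qed

text \<open>
  The line \<open>z - \<alpha> (Suc n)\<close> crosses \<open>s * z\<close> at \<open>X = \<alpha> (Suc n) / (1 - s)\<close>. If the previous peak,
  of height at most \<open>t * b (\<alpha> n)\<close>, is not higher than \<open>s * X\<close> up to \<open>\<epsilon> * X\<close>, then nothing
  exceeds slope \<open>s\<close> at \<open>X\<close> by more than that. For \<open>s = t\<close> the upper box dimension settles the
  matter.
\<close>

lemma lower_box_dim_A:
  assumes troughs: "\<And>\<epsilon> N. 0 < \<epsilon> \<Longrightarrow> s < t \<Longrightarrow>
    \<exists>n\<ge>N. t * real (b (\<alpha> n)) \<le> (s + \<epsilon>) * (real (\<alpha> (Suc n)) / (1 - s))"
  shows "lower_box_dim A = ereal s"
proof (rule antisym[OF _ lower_box_dim_ge_s])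
  show "lower_box_dim A \<le> ereal s"
  proof (cases "s = t")
    case True
    then show ?thesis using lower_le_upper_box_dim[of A] upper_box_dim_A by simp
  next
    case False
    then have st: "s < t" using s_le_t by simp
    then have s1: "s < 1" using t_le_1 by simp
    show ?thesis
    proof (rule lower_box_dim_leI)
      fix \<epsilon> X0 :: real assume \<epsilon>: "0 < \<epsilon>"
      obtain L where L: "\<forall>z\<ge>0. \<forall>E\<ge>0. (\<forall>a\<ge>2. real a < z \<longrightarrow> min (real (b a)) z - real a \<le> E) \<longrightarrow> log_cover A z \<le> E + (\<epsilon> / 4) * z + L"
        using log_cover_upper_linear[of "\<epsilon> / 4"] \<epsilon> by auto
      obtain n where n: "n \<ge> nat \<lceil>max X0 (4 * L / \<epsilon>)\<rceil>"
        "t * real (b (\<alpha> n)) \<le> (s + \<epsilon> / 4) * (real (\<alpha> (Suc n)) / (1 - s))"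
        using troughs[of "\<epsilon> / 4" "nat \<lceil>max X0 (4 * L / \<epsilon>)\<rceil>"] \<epsilon> st by auto
      define X where "X = real (\<alpha> (Suc n)) / (1 - s)"
      have \<alpha>X: "real (\<alpha> (Suc n)) = (1 - s) * X" using s1 by (simp add: X_def)
      have "real n \<le> real (\<alpha> (Suc n))" using \<alpha>_ge(2)[of "Suc n"] by simp
      also have "\<dots> \<le> X" using s1 s_nonneg unfolding X_def by (simp add: pos_le_divide_eq mult_left_le)
      finally have X: "X0 \<le> X" "4 * L / \<epsilon> \<le> X" "0 \<le> X" using n(1) by linarith+
      have "min (real (b a)) X - real a \<le> (s + \<epsilon> / 4) * X" for a
      proof -
        have "s * X \<le> (s + \<epsilon> / 4) * X" using X(3) \<epsilon> by (intro mult_right_mono) auto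
        moreover have "X - real (\<alpha> (Suc n)) = s * X" unfolding \<alpha>X by (simp add: algebra_simps)
        moreover have "t * min X (real (b (\<alpha> n))) \<le> t * real (b (\<alpha> n))"
          using s_nonneg s_le_t by (intro mult_left_mono) auto
        ultimately show ?thesis
          using trough[OF X(3), of a n] n(2) unfolding X_def[symmetric] by linarith
      qed
      moreover have "0 \<le> (s + \<epsilon> / 4) * X" using X(3) \<epsilon> s_nonneg by simp
      ultimately have "log_cover A X \<le> (s + \<epsilon> / 4) * X + (\<epsilon> / 4) * X + L" using L X(3) by blast
      moreover have "L \<le> \<epsilon> / 4 * X" using X(2) \<epsilon> by (simp add: pos_divide_le_eq mult.commute)
      moreover have "0 \<le> \<epsilon> / 4 * X" using X(3) \<epsilon> by simp
      ultimately have "log_cover A X \<le> (s + \<epsilon>) * X" by (simp add: algebra_simps)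
      with X(1) show "\<exists>x\<ge>X0. log_cover A x \<le> (s + \<epsilon>) * x" by blast
    qed
  qed
qed

end

section \<open>The lower box dimension of the attractor\<close>

locale profile_ifs =
  separated_affine_ifs I c \<rho> \<xi> h + transversal s t \<alpha> "fixed_point_set I (affine_ifs.f c \<rho>)" B x
  for I c \<rho> \<xi> h s t \<alpha> B x
begin

lemma upper_box_dim_attractor_le_max:
  assumes "h \<le> t'" "t \<le> t'"
  shows "upper_box_dim \<Lambda> \<le> ereal t'"
  by (rule upper_box_dim_attractor_le[OF assms(1) log_cover_le_t]) (use assms(2) in simp)

lemma lower_box_dim_attractor_if_t_le_h:
  assumes "t \<le> h"
  shows "lower_box_dim \<Lambda> = ereal h"
  using lower_box_dim_attractor_ge lower_le_upper_box_dim[of \<Lambda>]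
    upper_box_dim_attractor_le_max[OF order_refl assms] by (meson antisym order_trans)

lemma lower_box_dim_fixed_points_le: "ereal s \<le> lower_box_dim \<Lambda>"
  using lower_box_dim_ge_s
    lower_box_dim_mono[OF fixed_points_subset_attractor fixed_points_nonempty bounded_attractor]
  by (rule order_trans)

lemma lower_box_dim_attractor_if_s_eq_t:
  assumes "h \<le> t" "s = t"
  shows "lower_box_dim \<Lambda> = ereal t"
  using lower_box_dim_fixed_points_le lower_le_upper_box_dim[of \<Lambda>]
    upper_box_dim_attractor_le_max[OF assms(1) order_refl] unfolding assms(2) by (meson antisym order_trans)

text \<open>
  The solution \<open>X\<close> of \<open>X - \<alpha> (Suc n) - h * X = (t - h) * b (\<alpha> n)\<close>, where the block that starts
  at \<open>\<alpha> (Suc n)\<close> takes over from the peak at \<open>b (\<alpha> n)\<close>.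
\<close>

definition crossing :: "nat \<Rightarrow> real" where
  "crossing n = ((t - h) * real (b (\<alpha> n)) + real (\<alpha> (Suc n))) / (1 - h)"

lemma crossing_eq: "h < 1 \<Longrightarrow> (1 - h) * crossing n = (t - h) * real (b (\<alpha> n)) + real (\<alpha> (Suc n))"
  unfolding crossing_def by simp

lemma crossing_ge:
  assumes "h < 1" "h \<le> t"
  shows "real (\<alpha> (Suc n)) \<le> crossing n"
proof -
  have "real (\<alpha> (Suc n)) * (1 - h) \<le> real (\<alpha> (Suc n)) * 1" using h_pos by (intro mult_left_mono) auto
  also have "\<dots> \<le> (t - h) * real (b (\<alpha> n)) + real (\<alpha> (Suc n))" using assms(2) by simp
  finally show ?thesis unfolding crossing_def using assms(1) by (simp add: pos_le_divide_eq)
qed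

text \<open>
  At a crossing \<open>X\<close> the maximum of \<open>\<psi> y - h * y\<close> over \<open>y \<le> X\<close> is at most \<open>(\<beta> - h + \<epsilon>) * X\<close>: by
  \<open>trough\<close> there are only three sources, and the two special ones are both bounded by
  \<open>(t - h) * b (\<alpha> n)\<close>.
\<close>

lemma lower_box_dim_attractor_le:
  assumes h: "h < 1" "h \<le> t" and \<beta>: "h \<le> \<beta>" "s \<le> \<beta>"
    and crossings: "\<And>\<epsilon> N. 0 < \<epsilon> \<Longrightarrow> \<exists>n\<ge>N. (t - h) * real (b (\<alpha> n)) \<le> (\<beta> - h + \<epsilon>) * crossing n"
  shows "lower_box_dim \<Lambda> \<le> ereal \<beta>"
proof (rule lower_box_dim_leI)
  fix \<epsilon> X0 :: real assume \<epsilon>: "0 < \<epsilon>"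
  define \<delta> where "\<delta> = \<epsilon> / 4"
  have \<delta>: "0 < \<delta>" using \<epsilon> by (simp add: \<delta>_def)
  obtain L where L: "\<forall>z\<ge>0. \<forall>E\<ge>0. (\<forall>a\<ge>2. real a < z \<longrightarrow> min (real (b a)) z - real a \<le> E) \<longrightarrow> log_cover F z \<le> E + \<delta> * z + L"
    using log_cover_upper_linear[OF \<delta>] by (elim exE)
  define C where "C = log 2 (3 / (1 - \<xi> powr (h + \<delta> - h)))"
  obtain n where n: "n \<ge> nat \<lceil>max X0 ((C + L) / \<delta>)\<rceil>" "(t - h) * real (b (\<alpha> n)) \<le> (\<beta> - h + \<delta>) * crossing n"
    using crossings[OF \<delta>] by blast
  define X where "X = crossing n"
  have X: "X0 \<le> X" "(C + L) / \<delta> \<le> X" "0 \<le> X"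
    using crossing_ge[OF h, of n] \<alpha>_ge(2)[of "Suc n"] n(1) unfolding X_def by linarith+
  define M where "M = (\<beta> - h + \<delta>) * X"
  have M: "0 \<le> M" "(\<beta> - h) * X \<le> M"
    using X(3) \<delta> \<beta>(1) unfolding M_def by (auto intro: mult_right_mono)
  have "log_cover \<Lambda> X \<le> C + (M + L) + (h + \<delta>) * X"
    unfolding C_def
  proof (rule log_cover_attractor_le)
    fix y assume y: "0 \<le> y" "y \<le> X"
    have "min (real (b a)) y - real a \<le> h * y + M" for a
    proof -
      have "(s - h) * y \<le> (\<beta> - h) * y" using \<beta>(2) y(1) by (intro mult_right_mono) auto
      also have "\<dots> \<le> (\<beta> - h) * X" using y(2) \<beta>(1) by (intro mult_left_mono) auto
      finally have 1: "s * y \<le> h * y + M" using M(2) by (simp add: algebra_simps)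
      have "(t - h) * min y (real (b (\<alpha> n))) \<le> (t - h) * real (b (\<alpha> n))"
        using h(2) by (intro mult_left_mono) auto
      moreover have "h * min y (real (b (\<alpha> n))) \<le> h * y" using h_pos by (intro mult_left_mono) auto
      ultimately have 2: "t * min y (real (b (\<alpha> n))) \<le> h * y + M"
        using n(2) unfolding M_def X_def by (simp add: algebra_simps)
      have "(1 - h) * y \<le> (1 - h) * X" using y(2) h(1) by (intro mult_left_mono) auto
      also have "\<dots> = (t - h) * real (b (\<alpha> n)) + real (\<alpha> (Suc n))"
        unfolding X_def by (rule crossing_eq[OF h(1)])
      finally have 3: "y - real (\<alpha> (Suc n)) \<le> h * y + M"
        using n(2) unfolding M_def X_def by (simp add: algebra_simps)
      show ?thesis using trough[OF y(1), of a n] 1 2 3 by linarith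
    qed
    moreover have "0 \<le> h * y + M" using y(1) h_pos M(1) by simp
    ultimately have "log_cover F y \<le> (h * y + M) + \<delta> * y + L" using L y(1) by blast
    then show "log_cover F y \<le> (M + L) + (h + \<delta>) * y" by (simp add: algebra_simps)
  qed (use X(3) \<delta> in auto)
  also have "\<dots> = (\<beta> + 2 * \<delta>) * X + (C + L)" unfolding M_def by (simp add: algebra_simps)
  also have "C + L \<le> \<delta> * X" using X(2) \<delta> by (simp add: pos_divide_le_eq mult.commute)
  also have "(\<beta> + 2 * \<delta>) * X + \<delta> * X = (\<beta> + 3 * \<delta>) * X" by (simp add: algebra_simps)
  also have "\<dots> \<le> (\<beta> + \<epsilon>) * X" using X(3) \<epsilon> unfolding \<delta>_def by (intro mult_right_mono) auto
  finally show "\<exists>x\<ge>X0. log_cover \<Lambda> x \<le> (\<beta> + \<epsilon>) * x" using X(1) by (intro exI[of _ X]) simp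
qed

lemma peak_before:
  assumes "b (\<alpha> N) \<le> n"
  obtains k where "N \<le> k" "b (\<alpha> k) \<le> n" "n < b (\<alpha> (Suc k))"
proof -
  have ex: "n < b (\<alpha> (Suc n))" using b_special_ge[of "Suc n"] by simp
  define m where "m = (LEAST m. n < b (\<alpha> m))"
  have m: "n < b (\<alpha> m)" unfolding m_def by (rule LeastI[of "\<lambda>m. n < b (\<alpha> m)", OF ex])
  have "N < m" using b_special_mono[of m N] m assms by (cases "m \<le> N") auto
  then obtain k where k: "m = Suc k" "N \<le> k" by (cases m) auto
  have "b (\<alpha> k) \<le> n" using not_less_Least[of k "\<lambda>m. n < b (\<alpha> m)"] k(1) unfolding m_def[symmetric] by simp
  with k m show ?thesis by (intro that[of k]) auto
qed

text \<open>
  Let the scale \<open>n\<close> lie between the peaks of the special blocks \<open>k\<close> and \<open>k + 1\<close>, and let \<open>d\<close>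
  be the value of \<open>y - \<alpha> (k + 1) - h * y\<close> at \<open>y = n\<close>. Before the crossing, where
  \<open>d < (t - h) * b (\<alpha> k)\<close>, the copies of the peak at \<open>b (\<alpha> k)\<close> provide enough separated
  points, and after it the growing block \<open>k + 1\<close> itself does. In both cases the growth
  condition turns the comparison of \<open>d\<close> with \<open>(t - h) * b (\<alpha> k)\<close> into a bound by
  \<open>(\<beta> - h) * n - K1\<close>, which is attained at the crossing.
\<close>

lemma lower_box_dim_attractor_ge_intermediate:
  assumes h: "h < 1" "h < t" and \<beta>: "h < \<beta>" "\<beta> < 1"
    and growth: "\<forall>n\<ge>n0. (\<beta> - h) * (real (\<alpha> (Suc n)) - 1) \<le> (t - h) * (1 - \<beta>) * real (b (\<alpha> n))"
  shows "ereal \<beta> \<le> lower_box_dim \<Lambda>"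
proof (rule lower_box_dim_geI[OF attractor_nonempty bounded_attractor])
  show "0 \<le> \<beta>" using \<beta> h_pos by simp
  fix v assume v: "0 < v" "v < \<beta>"
  define \<epsilon> where "\<epsilon> = \<beta> - v"
  have \<epsilon>: "0 < \<epsilon>" using v by (simp add: \<epsilon>_def)
  define u where "u = max (h / 2) (h - \<epsilon> / 2)"
  have u: "0 < u" "u < h" "h - \<epsilon> / 2 \<le> u" using h_pos \<epsilon> unfolding u_def by auto
  define w where "w = max h (t - \<epsilon> / 2)"
  have w: "0 < w" "w < t" "t - \<epsilon> / 2 \<le> w" using h_pos \<epsilon> h(2) unfolding w_def by auto
  obtain K y0 where K: "\<forall>Q y z. Q \<subseteq> \<Lambda> \<and> finite Q \<and> Q \<noteq> {} \<and> separated (2 powr - y) Q \<and> y0 \<le> y \<and> y \<le> z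
    \<longrightarrow> log 2 (card Q) + u * (z - y) - K \<le> log_cover \<Lambda> (z + 1)"
    using log_cover_attractor_ge[OF u(1,2)] by (elim exE)
  \<comment> \<open>The loss caused by the rounding of \<open>\<alpha> (Suc k)\<close> in the growth condition.\<close>
  define K1 where "K1 = (\<beta> - h) / (1 - h)"
  have K1: "K1 * (1 - h) = \<beta> - h" using h(1) unfolding K1_def by simp
  define N where "N = max n0 (max (nat \<lceil>y0\<rceil>) (max (nat \<lceil>w / (t - w)\<rceil>) (nat \<lceil>1 / w\<rceil> + 1)))"
  have "v * real n - (K1 + \<bar>K\<bar> + 2) \<le> log_cover \<Lambda> (real n + 1)" if "n \<ge> max 1 (b (\<alpha> N))" for n
  proof -
    have "b (\<alpha> N) \<le> n" using that by simp
    then obtain k where k: "N \<le> k" "b (\<alpha> k) \<le> n" "n < b (\<alpha> (Suc k))" by (rule peak_before)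
    have n1: "1 \<le> n" using that by simp
    define y where "y = real (b (\<alpha> k))"
    define a where "a = real (\<alpha> (Suc k))"
    have "n0 \<le> k" using k(1) unfolding N_def by simp
    then have grow: "(\<beta> - h) * (a - 1) \<le> (t - h) * (1 - \<beta>) * y"
      using growth unfolding a_def y_def by blast
    define d where "d = (1 - h) * real n - a"
    show ?thesis
    proof (cases "(t - h) * y \<le> d")
      case True
      have "0 \<le> (t - h) * y" using h(2) unfolding y_def by simp
      then have "a \<le> (1 - h) * real n" using True unfolding d_def by linarith
      moreover have "(1 - h) * real n < 1 * real n"
        using h_pos n1 by (intro mult_strict_right_mono) auto
      ultimately have an: "\<alpha> (Suc k) < n" unfolding a_def by linarith
      have "(1 - \<beta>) * ((t - h) * y) \<le> (1 - \<beta>) * d" using True \<beta>(2) by (intro mult_left_mono) auto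
      with grow have "(\<beta> - h) * (a - 1) \<le> (1 - \<beta>) * d" by (simp add: mult_ac)
      then have "(\<beta> - h) * ((1 - h) * real n - 1) \<le> (1 - h) * d"
        unfolding d_def by (simp add: algebra_simps)
      then have "(1 - h) * ((\<beta> - h) * real n - K1) \<le> (1 - h) * d"
        using K1 by (simp add: algebra_simps)
      then have "(\<beta> - h) * real n - K1 \<le> d" using h(1) by simp
      then have "\<beta> * real n - K1 - 1 \<le> real n - a - 1" unfolding d_def by (simp add: algebra_simps)
      also have "\<dots> \<le> log_cover F (real n + 1)"
        unfolding a_def by (rule log_cover_lower[OF \<alpha>_ge(1) an]) (use k(3) in simp)
      also have "\<dots> \<le> log_cover \<Lambda> (real n + 1)"
        by (rule log_cover_mono[OF fixed_points_subset_attractor fixed_points_nonempty bounded_attractor order_refl])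
      finally have "\<beta> * real n - K1 - 1 \<le> log_cover \<Lambda> (real n + 1)" .
      moreover have "v * real n \<le> \<beta> * real n" using v(2) by (intro mult_right_mono) auto
      ultimately show ?thesis by linarith
    next
      case False
      have kN: "y0 \<le> real k" "w / (t - w) \<le> real k" "1 / w < real k"
        using k(1) unfolding N_def by linarith+
      have ky: "real k \<le> y" unfolding y_def using b_special_ge[of k] by simp
      have "w / (t - w) \<le> real (\<alpha> k)" using kN(2) \<alpha>_ge(2)[of k] by linarith
      then have ex: "w * y - 1 \<le> y - real (\<alpha> k)"
        unfolding y_def using w by (intro special_excess) auto
      have "1 / w < y" using kN(3) ky by linarith
      then have "1 < w * y" using w(1) by (simp add: pos_divide_less_eq mult.commute)
      with ex have ab: "\<alpha> k < b (\<alpha> k)" unfolding y_def by linarith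
      obtain Q where Q: "Q \<subseteq> F" "finite Q" "separated (2 powr - y) Q" "card Q = 2 ^ (b (\<alpha> k) - \<alpha> k - 1)"
        using separated_subset[OF \<alpha>_ge(1) ab order_refl] unfolding y_def by (elim exE conjE)
      have Q\<Lambda>: "Q \<subseteq> \<Lambda>" using Q(1) fixed_points_subset_attractor by (rule order_trans)
      have "Q \<noteq> {}" using Q(4) by auto
      then have "log 2 (card Q) + u * (real n - y) - K \<le> log_cover \<Lambda> (real n + 1)"
        using K Q\<Lambda> Q(2,3) kN(1) ky k(2) unfolding y_def by auto
      moreover have "log 2 (card Q) = y - real (\<alpha> k) - 1"
        using Q(4) ab unfolding y_def by (simp add: log_nat_power of_nat_diff)
      ultimately have 1: "w * y - 2 + u * (real n - y) - K \<le> log_cover \<Lambda> (real n + 1)"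
        using ex by linarith
      have yn: "y \<le> real n" "0 \<le> y" using k(2) unfolding y_def by auto
      have "(h - \<epsilon> / 2) * (real n - y) \<le> u * (real n - y)" using u(3) yn by (intro mult_right_mono) auto
      moreover have "(t - \<epsilon> / 2) * y \<le> w * y" using w(3) yn by (intro mult_right_mono) auto
      ultimately have 2: "h * real n + (t - h) * y - \<epsilon> / 2 * real n \<le> w * y + u * (real n - y)"
        by (simp add: algebra_simps diff_divide_distrib)
      have "(1 - h) * real n \<le> (t - h) * y + a" using False unfolding d_def by simp
      then have "(\<beta> - h) * ((1 - h) * real n) \<le> (\<beta> - h) * ((t - h) * y + a)"
        using \<beta>(1) by (intro mult_left_mono) auto
      with grow have "(1 - h) * ((\<beta> - h) * real n - K1) \<le> (1 - h) * ((t - h) * y)"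
        using K1 by (simp add: algebra_simps)
      then have 3: "(\<beta> - h) * real n - K1 \<le> (t - h) * y" using h(1) by simp
      have "v * real n + \<epsilon> / 2 * real n \<le> \<beta> * real n"
        unfolding \<epsilon>_def using v(2) by (simp add: field_simps mult_right_mono)
      with 1 2 3 show ?thesis by (simp add: algebra_simps)
    qed
  qed
  then have "\<forall>\<^sub>F n in sequentially. v * real n - (K1 + \<bar>K\<bar> + 2) \<le> log_cover \<Lambda> (real n + 1)"
    unfolding eventually_sequentially by blast
  then show "\<exists>K. \<forall>\<^sub>F n in sequentially. v * real n - K \<le> log_cover \<Lambda> (real n + 1)" by (rule exI)
qed

end

section \<open>Dyadic tiles and the system of full dimension\<close>

context profile
begin

definition small_tiles :: "(nat \<times> nat) set" where
  "small_tiles = (SIGMA a:{2..}. {..<2 ^ (b a - a)})"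

text \<open>
  Pairs \<open>(a, j)\<close> with \<open>2 \<le> a\<close> number the dyadic tiles in \<open>(0, 1/2]\<close>; the pairs with \<open>a = 0\<close>
  number \<open>m\<close> tiles that divide \<open>[1/2, 1]\<close> evenly.
\<close>

definition tiles :: "nat \<Rightarrow> (nat \<times> nat) set" where
  "tiles m = {0} \<times> {..<m} \<union> small_tiles"

definition tile_left :: "nat \<Rightarrow> nat \<times> nat \<Rightarrow> real" where
  "tile_left m = (\<lambda>(a, j). if a = 0 then 1 / 2 + real j / (2 * real m)
     else 2 powr - real a + real j * 2 powr - real (b a))"

definition tile_width :: "nat \<Rightarrow> nat \<times> nat \<Rightarrow> real" where
  "tile_width m = (\<lambda>(a, j). if a = 0 then 1 / (2 * real m) else 2 powr - real (b a))"

definition tile_right :: "nat \<Rightarrow> nat \<times> nat \<Rightarrow> real" where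
  "tile_right m p = tile_left m p + tile_width m p"

lemma tile_right_pair:
  "tile_right m (a, j) = (if a = 0 then 1 / 2 + (real j + 1) / (2 * real m)
     else 2 powr - real a + (real j + 1) * 2 powr - real (b a))"
  by (simp add: tile_right_def tile_left_def tile_width_def add_divide_distrib distrib_right)

lemma block_width: "2 ^ (b a - a) * 2 powr - real (b a) = 2 powr - real a"
  using b_bounds(3)[of a] by (simp add: powr_realpow[symmetric] powr_add[symmetric] of_nat_diff)

lemma tile_width_pos: "0 < m \<Longrightarrow> 0 < tile_width m p"
  by (cases p) (simp add: tile_width_def)

lemma small_tile_bounds:
  assumes "2 \<le> a" "(a, j) \<in> tiles m"
  shows "2 powr - real a \<le> tile_left m (a, j)" "tile_right m (a, j) \<le> 2 powr - (real a - 1)" "tile_right m (a, j) \<le> 1 / 2"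
proof -
  have j: "j < 2 ^ (b a - a)" using assms unfolding tiles_def small_tiles_def by auto
  show "2 powr - real a \<le> tile_left m (a, j)" using assms(1) by (simp add: tile_left_def)
  have "real (j + 1) \<le> real (2 ^ (b a - a))" using j by (subst of_nat_le_iff) simp
  then have "(real j + 1) * 2 powr - real (b a) \<le> 2 ^ (b a - a) * 2 powr - real (b a)"
    by (intro mult_right_mono) auto
  then have "(real j + 1) * 2 powr - real (b a) \<le> 2 powr - real a" by (simp only: block_width)
  moreover have two: "2 powr - (real a - 1) = 2 powr - real a + 2 powr - real a"
    using powr_add[of 2 "- real a" 1] by simp
  ultimately show le: "tile_right m (a, j) \<le> 2 powr - (real a - 1)"
    using assms(1) by (simp add: tile_right_pair)
  also have "\<dots> \<le> 2 powr (- 1)" using assms(1) by (intro powr_mono) auto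
  finally show "tile_right m (a, j) \<le> 1 / 2" by (simp add: powr_minus)
qed

lemma tile_width_le:
  assumes "0 < m" "p \<in> tiles m"
  shows "tile_width m p \<le> 1 / 2"
proof -
  obtain a j where p: "p = (a, j)" by (cases p)
  show ?thesis
  proof (cases "a = 0")
    case True
    then show ?thesis using assms(1) by (simp add: p tile_width_def divide_simps)
  next
    case False
    then have a: "2 \<le> a" using assms(2) unfolding p tiles_def small_tiles_def by auto
    have "0 < 2 powr - real a" by simp
    then show ?thesis
      using small_tile_bounds[OF a assms(2)[unfolded p]] unfolding p tile_right_def by linarith
  qed
qed

lemma big_tile_bounds:
  assumes "(0, j) \<in> tiles m"
  shows "1 / 2 \<le> tile_left m (0, j)" "tile_right m (0, j) \<le> 1"
proof -
  have j: "j < m" using assms unfolding tiles_def small_tiles_def by auto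
  then have "real j + 1 \<le> real m" by linarith
  then have "(real j + 1) / (2 * real m) \<le> 1 / 2" using j by (simp add: field_simps)
  moreover have "tile_right m (0, j) = 1 / 2 + (real j + 1) / (2 * real m)" by (simp add: tile_right_pair)
  ultimately show "tile_right m (0, j) \<le> 1" by linarith
qed (simp add: tile_left_def)

lemma tiles_cases:
  assumes "p \<in> tiles m"
  obtains j where "p = (0, j)" "j < m" | a j where "p = (a, j)" "2 \<le> a" "j < 2 ^ (b a - a)"
  using assms unfolding tiles_def small_tiles_def by auto

lemma tiles_nonoverlapping_aux:
  assumes "(a, i) \<in> tiles m" "(a', j) \<in> tiles m" "a < a' \<or> a = a' \<and> j < i"
  shows "tile_right m (a', j) \<le> tile_left m (a, i)"
proof (cases "a = a'")
  case True
  then have ji: "real j + 1 \<le> real i" using assms(3) by simp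
  show ?thesis
  proof (cases "a = 0")
    case a0: True
    have "(real j + 1) / (2 * real m) \<le> real i / (2 * real m)" using ji by (intro divide_right_mono) auto
    then show ?thesis using True a0 by (simp add: tile_right_pair tile_left_def)
  next
    case False
    have "(real j + 1) * 2 powr - real (b a) \<le> real i * 2 powr - real (b a)"
      using ji by (intro mult_right_mono) auto
    then show ?thesis using True False by (simp add: tile_right_pair tile_left_def)
  qed
next
  case False
  then have a': "2 \<le> a'" "a < a'" using assms(2,3) unfolding tiles_def small_tiles_def by auto
  show ?thesis
  proof (cases "a = 0")
    case True
    show ?thesis
      using small_tile_bounds(3)[OF a'(1) assms(2)] big_tile_bounds(1)[of i m] assms(1) True by simp
  next
    case False
    then have a: "2 \<le> a" using assms(1) unfolding tiles_def small_tiles_def by auto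
    have "2 powr - (real a' - 1) \<le> (2::real) powr - real a" using a'(2) by (intro powr_mono) auto
    then show ?thesis
      using small_tile_bounds(2)[OF a'(1) assms(2)] small_tile_bounds(1)[OF a assms(1)] by linarith
  qed
qed

lemma tiles_nonoverlapping:
  assumes "p \<in> tiles m" "q \<in> tiles m" "p \<noteq> q"
  shows "tile_right m p \<le> tile_left m q \<or> tile_right m q \<le> tile_left m p"
proof -
  obtain a i a' j where p: "p = (a, i)" "q = (a', j)" by (cases p, cases q)
  then have "a < a' \<or> a = a' \<and> j < i \<or> a' < a \<or> a' = a \<and> i < j" using assms(3) by auto
  then show ?thesis
    using tiles_nonoverlapping_aux assms(1,2) unfolding p by blast
qed

lemma half_power_sum: "(\<Sum>a\<in>{2..<2 + n}. (1 / 2 :: real) ^ a) = 1 / 2 - (1 / 2) ^ (n + 1)"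
  by (induction n) (simp_all add: field_simps)

text \<open>
  The tiles of block \<open>a\<close> have total length \<open>2 powr - a\<close>, and these lengths add up to \<open>1 / 2\<close>.
\<close>

lemma small_tiles_weight:
  assumes T: "finite T" "T \<subseteq> small_tiles"
    and w: "\<And>a j. 2 \<le> a \<Longrightarrow> 0 \<le> w (a, j) \<and> w (a, j) \<le> 2 powr - real (b a)"
  shows "sum w T \<le> 1 / 2"
proof -
  define N where "N = Max (insert 0 (fst ` T))"
  have sub: "T \<subseteq> (SIGMA a:{2..<2 + N}. {..<2 ^ (b a - a)})"
  proof
    fix p assume p: "p \<in> T"
    then have "fst p \<le> N" unfolding N_def using T(1) by (intro Max_ge) auto
    then show "p \<in> (SIGMA a:{2..<2 + N}. {..<2 ^ (b a - a)})" using p T(2) unfolding small_tiles_def by auto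
  qed
  have "sum w T \<le> sum w (SIGMA a:{2..<2 + N}. {..<2 ^ (b a - a)})"
    using w sub by (intro sum_mono2) auto
  also have "\<dots> = (\<Sum>a\<in>{2..<2 + N}. \<Sum>j<2 ^ (b a - a). w (a, j))"
    by (subst sum.Sigma) auto
  also have "\<dots> \<le> (\<Sum>a\<in>{2..<2 + N}. \<Sum>j<(2::nat) ^ (b a - a). 2 powr - real (b a))"
    using w by (intro sum_mono) auto
  also have "\<dots> = (\<Sum>a\<in>{2..<2 + N}. (1 / 2) ^ a)"
  proof (rule sum.cong[OF refl])
    fix a
    have "(\<Sum>j<(2::nat) ^ (b a - a). 2 powr - real (b a)) = 2 ^ (b a - a) * 2 powr - real (b a)" by simp
    also have "\<dots> = 2 powr - real a" by (rule block_width)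
    also have "\<dots> = (1 / 2) ^ a" by (simp add: powr_minus powr_realpow power_one_over inverse_eq_divide)
    finally show "(\<Sum>j<(2::nat) ^ (b a - a). 2 powr - real (b a)) = (1 / 2) ^ a" .
  qed
  also have "\<dots> \<le> 1 / 2" unfolding half_power_sum by simp
  finally show ?thesis .
qed

text \<open>
  Whatever intervals are chosen inside the tiles, their maps do not overlap, and their fixed
  points meet every small tile once.
\<close>

lemma tile_ifs:
  assumes m: "0 < m"
    and C: "\<And>p. p \<in> tiles m \<Longrightarrow> tile_left m p \<le> C p \<and> C p + R p \<le> tile_right m p \<and> 0 < R p \<and> R p \<le> 1 / 2"
  defines "I \<equiv> prod_encode ` tiles m"
  defines "c \<equiv> \<lambda>i. C (prod_decode i)" and "\<rho> \<equiv> \<lambda>i. R (prod_decode i)"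
  shows "affine_ifs I c \<rho> (1 / 2)"
    and "\<exists>B x. transversal s t \<alpha> (fixed_point_set I (affine_ifs.f c \<rho>)) B x"
proof -
  have I: "prod_decode i \<in> tiles m" if "i \<in> I" for i using that unfolding I_def by auto
  have bounds: "0 \<le> tile_left m p \<and> tile_right m p \<le> 1" if p: "p \<in> tiles m" for p
    using p
  proof (cases rule: tiles_cases)
    case (1 j)
    then show ?thesis using big_tile_bounds[of j m] p by auto
  next
    case (2 a j)
    have "0 < 2 powr - real a" by simp
    moreover have "(a, j) \<in> tiles m" using 2(1) p by simp
    ultimately have "0 \<le> tile_left m (a, j)" "tile_right m (a, j) \<le> 1"
      using small_tile_bounds[OF 2(2), of j m] by linarith+
    then show ?thesis using 2(1) by simp
  qed
  show ifs: "affine_ifs I c \<rho> (1 / 2)"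
  proof
    show "I \<noteq> {}" using m unfolding I_def tiles_def by auto
    fix i assume i: "i \<in> I"
    show "0 \<le> c i" "c i + \<rho> i \<le> 1" "0 < \<rho> i" "\<rho> i \<le> 1 / 2"
      using C[OF I[OF i]] bounds[OF I[OF i]] unfolding c_def \<rho>_def by linarith+
    fix j assume j: "j \<in> I" "i \<noteq> j"
    then have "prod_decode i \<noteq> prod_decode j" by simp
    from tiles_nonoverlapping[OF I[OF i] I[OF j(1)] this]
    show "c i + \<rho> i \<le> c j \<or> c j + \<rho> j \<le> c i"
      using C[OF I[OF i]] C[OF I[OF j(1)]] unfolding c_def \<rho>_def by linarith
  qed simp
  interpret affine_ifs I c \<rho> "1 / 2" by (rule ifs)
  define x where "x a j = fixpt (prod_encode (a, j))" for a j
  define B where "B = fixpt ` prod_encode ` ({0} \<times> {..<m})"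
  have "transversal s t \<alpha> F B x"
  proof
    have "I = prod_encode ` ({0} \<times> {..<m}) \<union> prod_encode ` small_tiles"
      unfolding I_def tiles_def by (rule image_Un)
    then have "F = B \<union> fixpt ` prod_encode ` small_tiles"
      unfolding fixed_point_set_eq B_def by (simp only: image_Un)
    also have "fixpt ` prod_encode ` small_tiles
        = {x a j |a j. 2 \<le> a \<and> j < 2 ^ (b a - a)}"
      unfolding x_def small_tiles_def by force
    finally show "F = {x a j |a j. 2 \<le> a \<and> j < 2 ^ (b a - a)} \<union> B" by (simp only: Un_commute)
    show "finite B" unfolding B_def by simp
    show "F \<subseteq> {0..1}" by (rule fixed_points_in_unit)
    fix a j assume aj: "2 \<le> a" "j < (2::nat) ^ (b a - a)"
    then have p: "(a, j) \<in> tiles m" unfolding tiles_def small_tiles_def by simp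
    then have "prod_encode (a, j) \<in> I" unfolding I_def by simp
    from fixpt_in_image[OF this] C[OF p]
    have "tile_left m (a, j) \<le> x a j" "x a j \<le> tile_right m (a, j)"
      unfolding x_def c_def \<rho>_def by auto
    then show "x a j \<in> {2 powr - real a + real j * 2 powr - real (b a)..2 powr - real a + (real j + 1) * 2 powr - real (b a)}"
      using aj(1) by (simp add: tile_left_def tile_right_pair)
  qed
  then show "\<exists>B x. transversal s t \<alpha> F B x" by (intro exI)
qed

text \<open>
  Half-open tiles partition \<open>{0<..1}\<close>; they are closed on the right because the tiles
  accumulate at \<open>0\<close>.
\<close>

lemma tiles_cover:
  assumes "0 < y" "y \<le> 1"
  shows "\<exists>p\<in>tiles 1. tile_left 1 p < y \<and> y \<le> tile_right 1 p"
proof (cases "1 / 2 < y")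
  case True
  then show ?thesis using assms(2)
    by (intro bexI[of _ "(0, 0)"]) (auto simp: tiles_def small_tiles_def tile_left_def tile_right_pair)
next
  case False
  \<comment> \<open>The block of \<open>y\<close>, determined by \<open>2 powr - a < y \<le> 2 powr (1 - a)\<close>.\<close>
  define a where "a = nat \<lfloor>- log 2 y\<rfloor> + 1"
  have "log 2 y \<le> log 2 (1 / 2)" using False assms(1) by (subst log_le_cancel_iff) auto
  then have "1 \<le> - log 2 y" by (simp add: log_divide)
  then have a: "2 \<le> a" "real a - 1 \<le> - log 2 y" "- log 2 y < real a" unfolding a_def by linarith+
  have y: "2 powr (log 2 y) = y" using assms(1) by simp
  have "2 powr (log 2 y) \<le> 2 powr - (real a - 1)" using a(2) by (intro powr_mono) auto
  then have up: "y \<le> 2 powr - (real a - 1)" unfolding y .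
  have "2 powr - real a < 2 powr (log 2 y)" using a(3) by (intro powr_less_mono) auto
  then have low: "2 powr - real a < y" unfolding y .
  define w where "w = 2 powr - real (b a)"
  have w: "0 < w" unfolding w_def by simp
  define q where "q = (y - 2 powr - real a) / w"
  have q: "0 < q" using low w unfolding q_def by simp
  have "2 powr - (real a - 1) = 2 powr - real a + 2 powr - real a"
    using powr_add[of 2 "- real a" 1] by simp
  then have "y - 2 powr - real a \<le> 2 ^ (b a - a) * w" using up unfolding w_def block_width by simp
  then have q2: "q \<le> 2 ^ (b a - a)" unfolding q_def using w by (simp add: pos_divide_le_eq)
  define j where "j = nat (\<lceil>q\<rceil> - 1)"
  have j: "real j < q" "q \<le> real j + 1" using q unfolding j_def by linarith+
  from less_le_trans[OF j(1) q2] have "j < 2 ^ (b a - a)" by simp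
  then have "(a, j) \<in> tiles 1" using a(1) unfolding tiles_def small_tiles_def by simp
  moreover have "real j * w < y - 2 powr - real a" "y - 2 powr - real a \<le> (real j + 1) * w"
    using j w unfolding q_def by (simp_all add: pos_less_divide_eq pos_divide_le_eq)
  ultimately show ?thesis
    using a(1) unfolding w_def by (intro bexI[of _ "(a, j)"]) (simp_all add: tile_left_def tile_right_pair)
qed

text \<open>
  The tiles themselves serve as images. As every point of \<open>{0<..1}\<close> lies in the half-open
  image of \<open>{0<..1}\<close> under one of the maps, this set is part of the attractor.
\<close>

lemma full_dimension_ifs:
  "\<exists>I c \<rho> B x. affine_ifs_dim I c \<rho> (1 / 2) 1 \<and>
     transversal s t \<alpha> (fixed_point_set I (affine_ifs.f c \<rho>)) B x \<and>
     {0<..1} \<subseteq> attractor I (affine_ifs.f c \<rho>)"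
proof -
  define I where "I = prod_encode ` tiles 1"
  define c where "c i = tile_left 1 (prod_decode i)" for i
  define \<rho> where "\<rho> i = tile_width 1 (prod_decode i)" for i
  have C: "tile_left 1 p \<le> tile_left 1 p \<and> tile_left 1 p + tile_width 1 p \<le> tile_right 1 p
      \<and> 0 < tile_width 1 p \<and> tile_width 1 p \<le> 1 / 2" if p: "p \<in> tiles 1" for p
  proof -
    have "tile_width 1 p \<le> 1 / 2" by (rule tile_width_le[OF zero_less_one p])
    then show ?thesis using tile_width_pos[of 1 p] by (simp add: tile_right_def)
  qed
  note ifs = tile_ifs[OF zero_less_one C, folded I_def c_def[abs_def] \<rho>_def[abs_def]]
  interpret affine_ifs I c \<rho> "1 / 2" by (rule ifs(1))
  have sums: "(\<Sum>i\<in>T. \<rho> i powr 1) \<le> 1" if T: "finite T" "T \<subseteq> I" for T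
  proof -
    define S where "S = prod_decode ` T"
    have S: "finite S" "S \<subseteq> tiles 1" using T unfolding S_def I_def by auto
    have "(\<Sum>i\<in>T. \<rho> i powr 1) = (\<Sum>i\<in>T. tile_width 1 (prod_decode i))"
      using less_imp_le[OF tile_width_pos[OF zero_less_one]] unfolding \<rho>_def by simp
    also have "\<dots> = sum (tile_width 1) S"
      unfolding S_def by (subst sum.reindex) (auto simp: inj_on_def)
    also have "\<dots> \<le> sum (tile_width 1) (S \<inter> small_tiles \<union> {(0, 0)})"
      using S tile_width_pos[of 1] by (intro sum_mono2) (auto simp: tiles_def small_tiles_def less_imp_le)
    also have "\<dots> = sum (tile_width 1) (S \<inter> small_tiles) + tile_width 1 (0, 0)"
      using S(1) by (subst sum.union_disjoint) (auto simp: small_tiles_def)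
    also have "sum (tile_width 1) (S \<inter> small_tiles) \<le> 1 / 2"
      using S(1) by (intro small_tiles_weight) (auto simp: tile_width_def)
    finally show ?thesis by (simp add: tile_width_def)
  qed
  have "affine_ifs_dim I c \<rho> (1 / 2) 1"
    by unfold_locales (use sums in auto)
  moreover have "{0<..1} \<subseteq> \<Lambda>"
  proof (rule post_fixed_subset_attractor[OF f_image_subset])
    show "{0<..1::real} \<subseteq> {0..1}" by auto
    show "{0<..1} \<subseteq> (\<Union>i\<in>I. f i ` {0<..1})"
    proof
      fix y :: real assume "y \<in> {0<..1}"
      then obtain p where p: "p \<in> tiles 1" "tile_left 1 p < y" "y \<le> tile_right 1 p"
        using tiles_cover[of y] by auto
      define i where "i = prod_encode p"
      have i: "i \<in> I" using p(1) unfolding i_def I_def by simp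
      have ci: "c i = tile_left 1 p" "c i + \<rho> i = tile_right 1 p"
        unfolding c_def \<rho>_def i_def tile_right_def by simp_all
      have "y = f i ((y - c i) / \<rho> i)" using ratio_pos[OF i] by (simp add: f_def)
      moreover have "(y - c i) / \<rho> i \<in> {0<..1}"
        using p(2,3) ci ratio_pos[OF i] by (auto simp: pos_divide_le_eq)
      ultimately show "y \<in> (\<Union>i\<in>I. f i ` {0<..1})" using i by blast
    qed
  qed
  ultimately show ?thesis using ifs(2) by blast
qed

end

section \<open>Realisation of all admissible values\<close>

context profile
begin

text \<open>
  The small tiles contain images of length \<open>2 powr - (k * b a)\<close> in their interior, where
  \<open>k * h \<ge> 1\<close> bounds the sum \<open>\<sigma>\<close> of their \<open>h\<close>-th powers by \<open>1 / 2\<close>. The remaining \<open>1 - \<sigma>\<close> is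
  distributed evenly over \<open>m\<close> maps with images in \<open>[1/2, 1]\<close>. Their ratio
  \<open>q = ((1 - \<sigma>) / m) powr (1 / h)\<close> is \<open>o(1 / m)\<close> because \<open>h < 1\<close>, so for large \<open>m\<close> the images
  fit into the tiles with room to spare.
\<close>

lemma separated_ifs:
  assumes h: "0 < h" "h < 1"
  shows "\<exists>I c \<rho> B x. profile_ifs I c \<rho> (1 / 2) h s t \<alpha> B x"
proof -
  define k :: nat where "k = max 2 (nat \<lceil>1 / h\<rceil>)"
  have k: "2 \<le> k" "1 / h \<le> real k" unfolding k_def by linarith+
  then have kh: "1 \<le> real k * h" using h(1) by (simp add: pos_divide_le_eq)
  define w where "w = (\<lambda>p::nat \<times> nat. (2 powr - (real k * real (b (fst p)))) powr h)"
  have w_le: "0 \<le> w (a, j) \<and> w (a, j) \<le> 2 powr - real (b a)" for a j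
  proof -
    have "1 * real (b a) \<le> real k * h * real (b a)" using kh by (intro mult_right_mono) auto
    then have "2 powr - (real k * h * real (b a)) \<le> 2 powr - real (b a)" by (intro powr_mono) auto
    then show ?thesis by (simp add: w_def powr_powr mult_ac)
  qed
  have fin: "sum w T \<le> 1 / 2" if "finite T" "T \<subseteq> small_tiles" for T
    using small_tiles_weight[OF that, of w] w_le by blast
  have summable: "w summable_on small_tiles"
    by (rule nonneg_bounded_partial_sums_imp_summable_on[of _ _ "1 / 2"])
       (use fin in \<open>auto simp: w_def intro: eventually_finite_subsets_at_top_weakI\<close>)
  define \<sigma> where "\<sigma> = infsum w small_tiles"
  have \<sigma>: "(w has_sum \<sigma>) small_tiles" unfolding \<sigma>_def using summable by simp
  have \<sigma>_le: "\<sigma> \<le> 1 / 2" unfolding \<sigma>_def by (rule infsum_le_finite_sums[OF summable fin])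
  have \<sigma>_ge: "0 \<le> \<sigma>" unfolding \<sigma>_def by (rule infsum_nonneg) (simp add: w_def)
  \<comment> \<open>The excess of \<open>1 / h\<close> over \<open>1\<close> decides how large \<open>m\<close> must be for \<open>q \<le> 1 / (4 * m)\<close>.\<close>
  define e where "e = 1 / h - 1"
  have e: "0 < e" using h by (simp add: e_def)
  define m where "m = nat \<lceil>4 powr (1 / e)\<rceil>"
  have mge: "4 powr (1 / e) \<le> real m" unfolding m_def by linarith
  have "0 < 4 powr (1 / e)" by simp
  then have m: "0 < m" using mge by linarith
  have me: "4 \<le> real m powr e"
  proof -
    have "(4 powr (1 / e)) powr e \<le> real m powr e" using mge e by (intro powr_mono2) auto
    then show ?thesis using e by (simp add: powr_powr)
  qed
  define q where "q = ((1 - \<sigma>) / real m) powr (1 / h)"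
  have q_pos: "0 < q" using \<sigma>_le m unfolding q_def by simp
  have q_pow: "q powr h = (1 - \<sigma>) / real m" using \<sigma>_le m h unfolding q_def by (simp add: powr_powr)
  have q_le: "q \<le> 1 / (4 * real m)"
  proof -
    have "q \<le> (1 / real m) powr (1 / h)"
      unfolding q_def using \<sigma>_ge \<sigma>_le h(1) by (intro powr_mono2 divide_right_mono) auto
    also have "\<dots> = (1 / real m) powr (1 + e)" by (simp add: e_def)
    also have "\<dots> = (1 / real m) * (1 / real m powr e)" using m by (simp add: powr_add powr_divide)
    also have "\<dots> \<le> (1 / real m) * (1 / 4)" using me m by (intro mult_left_mono divide_left_mono) auto
    finally show ?thesis by simp
  qed
  define R where "R p = (if fst p = 0 then q else 2 powr - (real k * real (b (fst p))))" for p :: "nat \<times> nat"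
  \<comment> \<open>The quarter keeps the image away from the left end of its tile, and \<open>R p \<le> tile_width m p / 2\<close> keeps it away from the right end.\<close>
  define C where "C p = tile_left m p + tile_width m p / 4" for p
  have R: "0 < R p" "R p \<le> tile_width m p / 2" if p: "p \<in> tiles m" for p
  proof -
    show "0 < R p" using q_pos by (simp add: R_def)
    obtain a j where aj: "p = (a, j)" by (cases p)
    show "R p \<le> tile_width m p / 2"
    proof (cases "a = 0")
      case True
      then show ?thesis using q_le by (simp add: aj R_def tile_width_def)
    next
      case False
      then have "2 \<le> a" using p unfolding aj tiles_def small_tiles_def by auto
      then have "1 \<le> b a" using b_bounds(3)[of a] by simp
      then have "real (b a) + 1 \<le> 2 * real (b a)" by simp
      also have "\<dots> \<le> real k * real (b a)" using k(1) by (intro mult_right_mono) auto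
      finally have "2 powr - (real k * real (b a)) \<le> 2 powr (- real (b a) + - 1)" by (intro powr_mono) auto
      also have "\<dots> = 2 powr - real (b a) / 2" by (simp only: powr_add) (simp add: powr_minus)
      finally show ?thesis using False by (simp add: aj R_def tile_width_def)
    qed
  qed
  have C: "tile_left m p < C p" "C p + R p < tile_right m p" if p: "p \<in> tiles m" for p
    using R[OF p] tile_width_pos[OF m, of p] unfolding C_def tile_right_def by linarith+
  have inside: "tile_left m p \<le> C p \<and> C p + R p \<le> tile_right m p \<and> 0 < R p \<and> R p \<le> 1 / 2"
    if p: "p \<in> tiles m" for p
    using C[OF p] R[OF p] tile_width_le[OF m p] by auto
  define I where "I = prod_encode ` tiles m"
  define c where "c i = C (prod_decode i)" for i
  define \<rho> where "\<rho> i = R (prod_decode i)" for i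
  note ifs = tile_ifs[OF m inside, folded I_def c_def[abs_def] \<rho>_def[abs_def]]
  interpret affine_ifs I c \<rho> "1 / 2" by (rule ifs(1))
  have tail: "((\<lambda>p. R p powr h) has_sum \<sigma>) small_tiles"
    using \<sigma> by (rule has_sum_cong[THEN iffD2, rotated]) (auto simp: R_def w_def small_tiles_def)
  have base: "((\<lambda>p. R p powr h) has_sum (1 - \<sigma>)) ({0} \<times> {..<m})"
  proof -
    have "(\<Sum>p\<in>{0} \<times> {..<m}. R p powr h) = (\<Sum>p\<in>{0::nat} \<times> {..<m}. (1 - \<sigma>) / real m)"
      by (intro sum.cong) (auto simp: R_def q_pow)
    also have "\<dots> = 1 - \<sigma>" using m by (simp add: card_cartesian_product)
    finally show ?thesis using has_sum_finite[of "{0} \<times> {..<m}" "\<lambda>p. R p powr h"] by simp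
  qed
  have "((\<lambda>p. R p powr h) has_sum (1 - \<sigma> + \<sigma>)) (tiles m)"
    unfolding tiles_def using base tail by (rule has_sum_Un_disjoint) (auto simp: small_tiles_def)
  then have "((\<lambda>i. \<rho> i powr h) has_sum 1) I"
    unfolding I_def \<rho>_def by (subst has_sum_reindex) (auto simp: o_def inj_on_def)
  note sum1 = this
  have fin1: "(\<Sum>i\<in>T. \<rho> i powr h) \<le> 1" if "finite T" "T \<subseteq> I" for T
    by (rule has_sum_mono_neutral[OF has_sum_finite[OF that(1)] sum1]) (use that(2) in auto)
  have apart: "c i + \<rho> i < c j \<or> c j + \<rho> j < c i" if ij: "i \<in> I" "j \<in> I" "i \<noteq> j" for i j
  proof -
    have t: "prod_decode i \<in> tiles m" "prod_decode j \<in> tiles m" "prod_decode i \<noteq> prod_decode j"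
      using ij unfolding I_def by auto
    show ?thesis
      using tiles_nonoverlapping[OF t] C[OF t(1)] C[OF t(2)] unfolding c_def \<rho>_def by linarith
  qed
  have sep: "separated_affine_ifs I c \<rho> (1 / 2) h"
    by unfold_locales (use h(1) fin1 sum1 apart in auto)
  have "\<exists>B x. transversal s t \<alpha> F B x" by (rule ifs(2))
  then obtain B x where "transversal s t \<alpha> F B x" by (elim exE)
  with sep have "profile_ifs I c \<rho> (1 / 2) h s t \<alpha> B x" by (rule profile_ifs.intro)
  then show ?thesis by (intro exI)
qed

end

text \<open>
  The peak position \<open>b (\<alpha> n)\<close> depends on \<open>\<alpha>\<close> only through \<open>\<alpha> n\<close> (this is \<open>\<tau>_special\<close>), so the
  distances between special blocks can be prescribed by recursion.
\<close>

lemma profile_exists: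
  fixes \<kappa> :: "nat \<Rightarrow> real"
  assumes "0 \<le> s" "s \<le> t" "t \<le> 1"
  shows "\<exists>\<alpha>. profile s t \<alpha> \<and>
    (\<forall>n. \<alpha> (Suc n) = max (\<alpha> n + 1) (nat \<lceil>\<kappa> n * real (profile.b s t \<alpha> (\<alpha> n))\<rceil>))"
proof -
  define y where "y a = nat \<lfloor>real a / (1 - t * (real a / (real a + 1)))\<rfloor>" for a :: nat
  define \<alpha> where "\<alpha> = rec_nat 2 (\<lambda>n a. max (a + 1) (nat \<lceil>\<kappa> n * real (y a)\<rceil>))"
  have step: "\<alpha> (Suc n) = max (\<alpha> n + 1) (nat \<lceil>\<kappa> n * real (y (\<alpha> n))\<rceil>)" for n
    by (simp add: \<alpha>_def)
  have "strict_mono \<alpha>" unfolding strict_mono_Suc_iff step by (simp add: max_def)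
  then have prof: "profile s t \<alpha>" using assms by unfold_locales (simp_all add: \<alpha>_def)
  interpret profile s t \<alpha> by (rule prof)
  have "b (\<alpha> n) = y (\<alpha> n)" for n unfolding b_def y_def \<tau>_special ..
  with step have "\<alpha> (Suc n) = max (\<alpha> n + 1) (nat \<lceil>\<kappa> n * real (b (\<alpha> n))\<rceil>)" for n by simp
  with prof show ?thesis by (intro exI conjI allI)
qed

lemma sparse_profile_exists:
  assumes "0 \<le> s" "s \<le> t" "t \<le> 1"
  shows "\<exists>\<alpha>. profile s t \<alpha> \<and> (\<forall>n. real n * real (profile.b s t \<alpha> (\<alpha> n)) \<le> real (\<alpha> (Suc n)))"
proof -
  obtain \<alpha> where \<alpha>: "profile s t \<alpha>"
    "\<forall>n. \<alpha> (Suc n) = max (\<alpha> n + 1) (nat \<lceil>real n * real (profile.b s t \<alpha> (\<alpha> n))\<rceil>)"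
    using profile_exists[OF assms, of real] by (elim exE conjE)
  have "real n * real (profile.b s t \<alpha> (\<alpha> n)) \<le> real (\<alpha> (Suc n))" for n
    unfolding \<alpha>(2)[rule_format] by linarith
  with \<alpha>(1) show ?thesis by (intro exI conjI allI)
qed

text \<open>
  As \<open>b (\<alpha> n)\<close> is about \<open>\<alpha> n / (1 - t)\<close>, the condition \<open>1 - t < \<kappa>\<close> says that \<open>\<kappa> * b (\<alpha> n)\<close>
  eventually exceeds \<open>\<alpha> n\<close>. From then on the alternative \<open>\<alpha> n + 1\<close> in the recursion does not
  spoil the upper bound.
\<close>

lemma proportional_profile_exists:
  assumes st: "0 \<le> s" "s \<le> t" "t \<le> 1" and \<kappa>: "1 - t < \<kappa>"
  shows "\<exists>\<alpha>. profile s t \<alpha> \<and> (\<forall>n. \<kappa> * real (profile.b s t \<alpha> (\<alpha> n)) \<le> real (\<alpha> (Suc n))) \<and>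
    (\<exists>n0. \<forall>n\<ge>n0. real (\<alpha> (Suc n)) - 1 \<le> \<kappa> * real (profile.b s t \<alpha> (\<alpha> n)))"
proof -
  obtain \<alpha> where \<alpha>: "profile s t \<alpha>"
    "\<forall>n. \<alpha> (Suc n) = max (\<alpha> n + 1) (nat \<lceil>\<kappa> * real (profile.b s t \<alpha> (\<alpha> n))\<rceil>)"
    using profile_exists[OF st, of "\<lambda>_. \<kappa>"] by (elim exE conjE)
  interpret profile s t \<alpha> by (rule \<alpha>(1))
  have lower: "\<kappa> * real (b (\<alpha> n)) \<le> real (\<alpha> (Suc n))" for n
    unfolding \<alpha>(2)[rule_format] by linarith
  \<comment> \<open>Halfway between \<open>t\<close> and \<open>1 - \<kappa>\<close>: eventually \<open>\<tau>\<close> exceeds \<open>w\<close> on special blocks, and \<open>1 - w < \<kappa>\<close>.\<close>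
  define w where "w = t - (\<kappa> - 1 + t) / 2"
  have w: "w < t" "0 < \<kappa> - 1 + w" using \<kappa> unfolding w_def by (simp_all add: field_simps)
  define n0 where "n0 = max (nat \<lceil>w / (t - w)\<rceil>) (nat \<lceil>(1 - w) / (\<kappa> - 1 + w)\<rceil>)"
  have "real (\<alpha> (Suc n)) - 1 \<le> \<kappa> * real (b (\<alpha> n))" if "n0 \<le> n" for n
  proof -
    define y where "y = real (b (\<alpha> n))"
    have n: "w / (t - w) \<le> real n" "(1 - w) / (\<kappa> - 1 + w) \<le> real n"
      using that unfolding n0_def by linarith+
    have ny: "real n \<le> real (\<alpha> n)" "real (\<alpha> n) \<le> y"
      using \<alpha>_ge(2)[of n] b_bounds(3)[of "\<alpha> n"] unfolding y_def by simp_all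
    have "w \<le> \<tau> (\<alpha> n)"
      unfolding \<tau>_special by (rule frac_ge[OF w(1)]) (use n(1) ny in linarith)
    then have "(y + 1) * (1 - \<tau> (\<alpha> n)) \<le> (y + 1) * (1 - w)"
      unfolding y_def by (intro mult_left_mono) auto
    with b_bounds(2)[of "\<alpha> n"] have 1: "real (\<alpha> n) < (y + 1) * (1 - w)" unfolding y_def by linarith
    have "(1 - w) / (\<kappa> - 1 + w) \<le> y" using n(2) ny by linarith
    then have "1 - w \<le> y * (\<kappa> - 1 + w)" using w(2) by (simp add: pos_divide_le_eq)
    with 1 have "real (\<alpha> n) \<le> \<kappa> * y" by (simp add: algebra_simps)
    moreover have "0 \<le> \<kappa> * y" using \<kappa> st(3) unfolding y_def by (intro mult_nonneg_nonneg) auto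
    then have "real (nat \<lceil>\<kappa> * y\<rceil>) \<le> \<kappa> * y + 1" by linarith
    moreover have "\<alpha> (Suc n) = max (\<alpha> n + 1) (nat \<lceil>\<kappa> * y\<rceil>)" unfolding y_def by (rule \<alpha>(2)[rule_format])
    ultimately show ?thesis unfolding y_def[symmetric] by (simp add: max_def)
  qed
  with \<alpha>(1) lower show ?thesis by blast
qed

lemma sparse_troughs:
  assumes "profile s t \<alpha>" "s < t" "0 < \<epsilon>"
    and sparse: "\<And>n. real n * real (profile.b s t \<alpha> (\<alpha> n)) \<le> real (\<alpha> (Suc n))"
  shows "\<exists>n\<ge>N. t * real (profile.b s t \<alpha> (\<alpha> n)) \<le> \<epsilon> * real (\<alpha> (Suc n))"
proof -
  interpret profile s t \<alpha> by (rule assms(1))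
  define n where "n = max N (nat \<lceil>1 / \<epsilon>\<rceil>)"
  have "1 / \<epsilon> \<le> real n" unfolding n_def by linarith
  then have n: "1 \<le> \<epsilon> * real n" using assms(3) by (simp add: pos_divide_le_eq mult.commute)
  have "t * real (b (\<alpha> n)) \<le> 1 * real (b (\<alpha> n))" using t_le_1 by (intro mult_right_mono) auto
  also have "\<dots> \<le> \<epsilon> * real n * real (b (\<alpha> n))" using n by (intro mult_right_mono) auto
  also have "\<dots> \<le> \<epsilon> * real (\<alpha> (Suc n))"
    using sparse[of n] assms(3) by (simp add: mult.assoc)
  finally show ?thesis unfolding n_def by (intro exI[of _ "max N (nat \<lceil>1 / \<epsilon>\<rceil>)"]) simp
qed

lemma sparse_lower_box_dim:
  assumes "transversal s t \<alpha> A B x"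
    and sparse: "\<And>n. real n * real (profile.b s t \<alpha> (\<alpha> n)) \<le> real (\<alpha> (Suc n))"
  shows "lower_box_dim A = ereal s"
proof -
  interpret transversal s t \<alpha> A B x by (rule assms(1))
  show ?thesis
  proof (rule lower_box_dim_A)
    fix \<epsilon> :: real and N assume e: "0 < \<epsilon>" and st: "s < t"
    obtain n where n: "n \<ge> N" "t * real (b (\<alpha> n)) \<le> \<epsilon> * real (\<alpha> (Suc n))"
      using sparse_troughs[OF profile_axioms st e sparse] by blast
    have s1: "0 < 1 - s" using st t_le_1 by simp
    have "real (\<alpha> (Suc n)) * (1 - s) \<le> real (\<alpha> (Suc n)) * 1" using s_nonneg by (intro mult_left_mono) auto
    then have le: "real (\<alpha> (Suc n)) \<le> real (\<alpha> (Suc n)) / (1 - s)" using s1 by (simp add: pos_le_divide_eq)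
    have "\<epsilon> * real (\<alpha> (Suc n)) \<le> (s + \<epsilon>) * (real (\<alpha> (Suc n)) / (1 - s))"
      using le e s_nonneg by (intro mult_mono) auto
    with n show "\<exists>n\<ge>N. t * real (b (\<alpha> n)) \<le> (s + \<epsilon>) * (real (\<alpha> (Suc n)) / (1 - s))" by (meson order_trans)
  qed
qed

definition realisable :: "real \<Rightarrow> real \<Rightarrow> real \<Rightarrow> real \<Rightarrow> bool" where
  "realisable h s t \<beta> \<longleftrightarrow>
     (\<exists>(I :: nat set) (f :: nat \<Rightarrow> real \<Rightarrow> real) (\<rho> :: nat \<Rightarrow> real).
           similarity_ifs I f \<rho> \<and>
           bounded_neighbourhood_condition I f \<rho> \<and>
           hausdorff_dim (attractor I f) = ereal h \<and>
           lower_box_dim (fixed_point_set I f) = ereal s \<and>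
           upper_box_dim (fixed_point_set I f) = ereal t \<and>
           lower_box_dim (attractor I f) = ereal \<beta>)"

lemma (in profile_ifs) realisation:
  assumes "lower_box_dim F = ereal s" "lower_box_dim \<Lambda> = ereal \<beta>"
  shows "realisable h s t \<beta>"
  unfolding realisable_def
  by (intro exI conjI) (rule similarity bounded_neighbourhood hausdorff_dim_attractor assms(1) upper_box_dim_A assms(2))+

lemma full_dimension_case:
  assumes st: "0 \<le> s" "s \<le> t" "t \<le> 1"
  shows "realisable 1 s t 1"
proof -
  obtain \<alpha> where \<alpha>: "profile s t \<alpha>"
    and sparse: "\<forall>n. real n * real (profile.b s t \<alpha> (\<alpha> n)) \<le> real (\<alpha> (Suc n))"
    using sparse_profile_exists[OF st] by (elim exE conjE)
  obtain I c \<rho> B x where dim: "affine_ifs_dim I c \<rho> (1 / 2) 1"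
    and trans: "transversal s t \<alpha> (fixed_point_set I (affine_ifs.f c \<rho>)) B x"
    and full: "{0<..1} \<subseteq> attractor I (affine_ifs.f c \<rho>)"
    using profile.full_dimension_ifs[OF \<alpha>] by (elim exE conjE)
  interpret affine_ifs_dim I c \<rho> "1 / 2" 1 by (rule dim)
  interpret transversal s t \<alpha> F B x by (rule trans)
  have "hausdorff_dim \<Lambda> = ereal 1"
    by (rule antisym[OF hausdorff_dim_attractor_le hausdorff_dim_ge_1[OF full]])
  moreover have "lower_box_dim \<Lambda> = ereal 1"
  proof (rule antisym[OF _ lower_box_dim_ge_1[OF full bounded_attractor]])
    have "upper_box_dim \<Lambda> \<le> ereal 1"
      by (rule upper_box_dim_attractor_le[OF order_refl log_cover_le_t]) (use t_le_1 in simp)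
    with lower_le_upper_box_dim show "lower_box_dim \<Lambda> \<le> ereal 1" by (rule order_trans)
  qed
  moreover have "lower_box_dim F = ereal s"
    by (rule sparse_lower_box_dim[OF trans sparse[rule_format]])
  ultimately show ?thesis
    using similarity bounded_neighbourhood upper_box_dim_A unfolding realisable_def by (intro exI conjI)
qed

text \<open>
  With \<open>b (\<alpha> n) / \<alpha> (Suc n)\<close> tending to \<open>0\<close> the peaks have no influence on the next trough.
  This covers the values of \<open>\<beta>\<close> that are forced, and \<open>\<beta> = h\<close>.
\<close>

lemma sparse_case:
  assumes h: "0 < h" "h < 1" and st: "0 \<le> s" "s \<le> t" "t \<le> 1"
    and \<beta>: "t \<le> h \<and> \<beta> = h \<or> h < t \<and> s = t \<and> \<beta> = t \<or> h < t \<and> s < t \<and> s \<le> h \<and> \<beta> = h"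
  shows "realisable h s t \<beta>"
proof -
  obtain \<alpha> where \<alpha>: "profile s t \<alpha>"
    and sparse: "\<forall>n. real n * real (profile.b s t \<alpha> (\<alpha> n)) \<le> real (\<alpha> (Suc n))"
    using sparse_profile_exists[OF st] by (elim exE conjE)
  obtain I c \<rho> B x where ifs: "profile_ifs I c \<rho> (1 / 2) h s t \<alpha> B x"
    using profile.separated_ifs[OF \<alpha> h] by (elim exE)
  interpret profile_ifs I c \<rho> "1 / 2" h s t \<alpha> B x by (rule ifs)
  have F: "lower_box_dim F = ereal s"
    by (rule sparse_lower_box_dim[OF profile_ifs.axioms(2)[OF ifs] sparse[rule_format]])
  have "lower_box_dim \<Lambda> = ereal \<beta>"
    using \<beta>
  proof (elim disjE conjE)
    assume "t \<le> h" "\<beta> = h"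
    then show ?thesis using lower_box_dim_attractor_if_t_le_h by simp
  next
    assume "h < t" "s = t" "\<beta> = t"
    then show ?thesis using lower_box_dim_attractor_if_s_eq_t by simp
  next
    assume a: "h < t" "s < t" "s \<le> h" "\<beta> = h"
    have "lower_box_dim \<Lambda> \<le> ereal h"
    proof (rule lower_box_dim_attractor_le[OF h(2) less_imp_le[OF a(1)] order_refl a(3)])
      fix \<epsilon> :: real and N assume e: "0 < \<epsilon>"
      obtain n where n: "n \<ge> N" "t * real (b (\<alpha> n)) \<le> \<epsilon> * real (\<alpha> (Suc n))"
        using sparse_troughs[OF \<alpha> a(2) e sparse[rule_format]] by blast
      have "(t - h) * real (b (\<alpha> n)) \<le> t * real (b (\<alpha> n))" using h(1) by (intro mult_right_mono) auto
      also have "\<dots> \<le> \<epsilon> * crossing n"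
        using n(2) crossing_ge[OF h(2) less_imp_le[OF a(1)], of n] e
        by (meson less_imp_le mult_left_mono order_trans)
      finally show "\<exists>n\<ge>N. (t - h) * real (b (\<alpha> n)) \<le> (h - h + \<epsilon>) * crossing n"
        using n(1) by (intro exI[of _ n]) simp
    qed
    with lower_box_dim_attractor_ge a(4) show ?thesis by (simp add: antisym)
  qed
  with F show ?thesis by (rule realisation)
qed

text \<open>
  With \<open>p = \<beta> - h\<close> and \<open>q = (t - h) * (1 - \<beta>)\<close> the special blocks are placed in proportion
  \<open>q / p\<close>. The upper bound on \<open>\<beta>\<close> is equivalent to \<open>t * (1 - s) * p \<le> s * q\<close>, which lets \<open>F\<close>
  reach its troughs, and it implies \<open>\<beta> < t\<close>, hence \<open>1 - t < q / p\<close>, which makes the sequence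
  grow. The identity \<open>p + (1 - \<beta>) = 1 - h\<close> places the crossings exactly at exponent \<open>\<beta>\<close>.
\<close>

lemma intermediate_case:
  assumes h: "0 < h" "h < 1" and st: "0 \<le> s" "s < t" "t \<le> 1" and ht: "h < t"
    and \<beta>: "h < \<beta>" "s \<le> \<beta>" "(\<beta> - h) * (t - h * s) \<le> (t - h) * (1 - h) * s"
  shows "realisable h s t \<beta>"
proof -
  define p where "p = \<beta> - h"
  define q where "q = (t - h) * (1 - \<beta>)"
  have p: "0 < p" using \<beta>(1) by (simp add: p_def)
  have "h * s \<le> h * 1" using h st by (intro mult_left_mono) auto
  then have D: "0 < t - h * s" using ht by simp
  have "(1 - h) * s < t - h * s" using st(2) by (simp add: algebra_simps)
  then have "(t - h) * ((1 - h) * s) < (t - h) * (t - h * s)" using ht by (intro mult_strict_left_mono) auto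
  with \<beta>(3) have "(\<beta> - h) * (t - h * s) < (t - h) * (t - h * s)" by (simp only: mult.assoc)
  then have \<beta>t: "\<beta> < t" using D by simp
  have q0: "0 < q" using ht \<beta>t st(3) unfolding q_def by (intro mult_pos_pos) auto
  have "0 < (t - \<beta>) * (1 - h)" using \<beta>t h by (intro mult_pos_pos) auto
  then have "(1 - t) * p < q" unfolding p_def q_def by (simp add: algebra_simps)
  then have \<kappa>: "1 - t < q / p" using p by (simp add: pos_less_divide_eq)
  have qs: "t * (1 - s) * p \<le> s * q" using \<beta>(3) unfolding p_def q_def by (simp add: algebra_simps)
  obtain \<alpha> n0 where \<alpha>: "profile s t \<alpha>"
    and lower: "\<forall>n. q / p * real (profile.b s t \<alpha> (\<alpha> n)) \<le> real (\<alpha> (Suc n))"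
    and n0: "\<forall>n\<ge>n0. real (\<alpha> (Suc n)) - 1 \<le> q / p * real (profile.b s t \<alpha> (\<alpha> n))"
    using proportional_profile_exists[OF st(1) less_imp_le[OF st(2)] st(3) \<kappa>] by (elim exE conjE)
  obtain I c \<rho> B x where ifs: "profile_ifs I c \<rho> (1 / 2) h s t \<alpha> B x"
    using profile.separated_ifs[OF \<alpha> h] by (elim exE)
  interpret profile_ifs I c \<rho> "1 / 2" h s t \<alpha> B x by (rule ifs)
  have lower': "q * real (b (\<alpha> n)) \<le> p * real (\<alpha> (Suc n))" for n
    using lower[rule_format, of n] p by (simp add: pos_divide_le_eq mult.commute)
  have "lower_box_dim F = ereal s"
  proof (rule lower_box_dim_A)
    fix \<epsilon> :: real and N assume e: "0 < \<epsilon>"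
    define y where "y = real (b (\<alpha> N))"
    define a where "a = real (\<alpha> (Suc N))"
    have "t * (1 - s) * p * y \<le> s * q * y" using qs unfolding y_def by (intro mult_right_mono) auto
    also have "\<dots> \<le> s * (p * a)"
      using lower'[of N] st(1) unfolding y_def a_def by (simp add: mult.assoc mult_left_mono)
    finally have "p * (t * (1 - s) * y) \<le> p * (s * a)" by (simp add: mult_ac)
    then have "t * y * (1 - s) \<le> s * a" using p by (simp add: mult_ac)
    then have "t * y \<le> s * (a / (1 - s))" using st by (simp add: pos_le_divide_eq)
    also have "\<dots> \<le> (s + \<epsilon>) * (a / (1 - s))"
      using e st unfolding a_def by (intro mult_right_mono divide_nonneg_nonneg) auto
    finally show "\<exists>n\<ge>N. t * real (b (\<alpha> n)) \<le> (s + \<epsilon>) * (real (\<alpha> (Suc n)) / (1 - s))"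
      unfolding y_def a_def by (intro exI[of _ N]) simp
  qed
  moreover have "lower_box_dim \<Lambda> = ereal \<beta>"
  proof (rule antisym)
    show "lower_box_dim \<Lambda> \<le> ereal \<beta>"
    proof (rule lower_box_dim_attractor_le[OF h(2) less_imp_le[OF ht] less_imp_le[OF \<beta>(1)] \<beta>(2)])
      fix \<epsilon> :: real and N assume e: "0 < \<epsilon>"
      define y where "y = real (b (\<alpha> N))"
      have "(1 - h) * ((t - h) * y) = p * ((t - h) * y) + q * y"
        unfolding p_def q_def by (simp add: algebra_simps)
      also have "\<dots> \<le> p * ((t - h) * y) + p * real (\<alpha> (Suc N))" using lower'[of N] unfolding y_def by simp
      also have "\<dots> = p * ((1 - h) * crossing N)"
        unfolding crossing_eq[OF h(2)] y_def by (simp only: distrib_left)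
      also have "\<dots> = (1 - h) * (p * crossing N)" by (rule mult.left_commute)
      finally have "(t - h) * y \<le> p * crossing N" using h(2) by simp
      also have "\<dots> \<le> (p + \<epsilon>) * crossing N"
        using e crossing_ge[OF h(2) less_imp_le[OF ht], of N] by (intro mult_right_mono) auto
      finally show "\<exists>n\<ge>N. (t - h) * real (b (\<alpha> n)) \<le> (\<beta> - h + \<epsilon>) * crossing n"
        unfolding y_def p_def by (intro exI[of _ N]) simp
    qed
    have "(\<beta> - h) * (real (\<alpha> (Suc n)) - 1) \<le> (t - h) * (1 - \<beta>) * real (b (\<alpha> n))" if "n0 \<le> n" for n
    proof -
      have "p * (real (\<alpha> (Suc n)) - 1) \<le> p * (q / p * real (b (\<alpha> n)))"
        using n0 that p by (intro mult_left_mono) auto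
      also have "\<dots> = q * real (b (\<alpha> n))" using p by simp
      finally show ?thesis unfolding p_def q_def .
    qed
    then show "ereal \<beta> \<le> lower_box_dim \<Lambda>"
      using \<beta>t st(3) by (intro lower_box_dim_attractor_ge_intermediate[OF h(2) ht \<beta>(1)]) auto
  qed
  ultimately show ?thesis by (rule realisation)
qed

theorem proposition4p9:
  fixes h s t \<beta> :: real
  assumes "0 < h" and "h \<le> 1"
    and "0 \<le> s" and "s \<le> t" and "t \<le> 1"
    and "\<beta> \<in> dim_range h s t 1"
  shows "\<exists>(I :: nat set) (f :: nat \<Rightarrow> real \<Rightarrow> real) (\<rho> :: nat \<Rightarrow> real).
           similarity_ifs I f \<rho> \<and>
           bounded_neighbourhood_condition I f \<rho> \<and>
           hausdorff_dim (attractor I f) = ereal h \<and>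
           lower_box_dim (fixed_point_set I f) = ereal s \<and>
           upper_box_dim (fixed_point_set I f) = ereal t \<and>
           lower_box_dim (attractor I f) = ereal \<beta>"
proof -
  have "realisable h s t \<beta>"
  proof (cases "h = 1")
    case True
    then have "\<beta> = 1" using assms(5,6) by (simp add: dim_range_def)
    with True full_dimension_case[OF assms(3-5)] show ?thesis by simp
  next
    case False
    then have h1: "h < 1" using assms(2) by simp
    show ?thesis
    proof (cases "t \<le> h")
      case True
      then have "\<beta> = h" using assms(6) by (simp add: dim_range_def)
      with True show ?thesis by (intro sparse_case[OF assms(1) h1 assms(3-5)]) simp
    next
      case False
      then have ht: "h < t" by simp
      have "h * s \<le> h * 1" using assms by (intro mult_left_mono) auto
      then have D: "0 < t - h * s" using ht by simp
      have \<beta>: "h \<le> \<beta>" "s \<le> \<beta>" "\<beta> \<le> h + (t - h) * (1 - h) * s / (t - h * s)"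
        using assms(6) ht by (auto simp: dim_range_def)
      then have "\<beta> - h \<le> (t - h) * (1 - h) * s / (t - h * s)" by simp
      then have \<beta>D: "(\<beta> - h) * (t - h * s) \<le> (t - h) * (1 - h) * s" using D by (simp only: pos_le_divide_eq)
      show ?thesis
      proof (cases "s = t")
        case True
        have "(\<beta> - h) * (t - h * s) \<le> (t - h) * (t - h * s)" using \<beta>D unfolding True by (simp add: algebra_simps)
        then have "\<beta> \<le> t" using D by simp
        with \<beta>(2) True ht show ?thesis by (intro sparse_case[OF assms(1) h1 assms(3-5)]) simp
      next
        case False
        then have st: "s < t" using assms(4) by simp
        show ?thesis
        proof (cases "\<beta> = h")
          case True
          with ht st \<beta>(2) show ?thesis by (intro sparse_case[OF assms(1) h1 assms(3-5)]) simp
        next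
          case False
          then have "h < \<beta>" using \<beta>(1) by simp
          then show ?thesis by (rule intermediate_case[OF assms(1) h1 assms(3) st assms(5) ht _ \<beta>(2) \<beta>D])
        qed
      qed
    qed
  qed
  then show ?thesis unfolding realisable_def .
qed

end
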